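(* Let $n\geq 4$ and let $M^n$ be a closed $n$-dimensional manifold. Let $(M^n,g(t),h(t))$, $t\in[0,T)$, $T<\infty$, be a solution to the linearized Ricci flow system $$\frac{\partial}{\partial t}g_{ij}=-2R_{ij},\qquad \frac{\partial}{\partial t}h_{ij}=\Delta h_{ij}+2R_{ikjl}h_{kl}-R_{ik}h_{kj}-R_{jk}h_{ki},$$ where the $g(t)$ are Riemannian metrics with positive scalar curvature and the $h(t)$ are symmetric $2$-tensors. Assume that the Weyl tensor of $g(t)$ vanishes identically on $M$ for all $t\in[0,T)$. Then there exists a constant $c_0<\infty$, depending only on $g(0)$ and $h(0)$, such that $$\frac{|h|}{R}(x,t)\leq c_0\qquad\text{for all }(x,t)\in M\times[0,T).$$
   Context: A closed manifold is compact without boundary. $(g(t))_{t\in[0,T)}$ is a smooth family of Riemannian metrics on $M$, and $h(t)$ is a smooth family of symmetric $2$-tensors. $R_{ikjl}$, $R_{ij}$ and $R$ denote the Riemann curvature tensor, Ricci curvature and scalar curvature of $g(t)$; $\Delta$ is the (rough) Laplacian of $g(t)$ acting on tensors; $|h|$ is the norm of $h(t)$ with respect to $g(t)$. Repeated indices are summed using the metric $g(t)$. The sign convention for the curvature is such that $g^{ij}R_{ikjl}=R_{kl}$ (so $R_{1212}>0$ on the round sphere). The Weyl tensor is $$W_{ikjl}=R_{ikjl}-\frac{1}{n-2}(g_{ij}R_{kl}+g_{kl}R_{ij}-g_{il}R_{jk}-g_{jk}R_{il})+\frac{R}{(n-1)(n-2)}(g_{ij}g_{kl}-g_{il}g_{jk}).$$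 *)

theory Defs
  imports "HOL-Analysis.Analysis"
begin

section \<open>Smooth functions\<close>

text \<open>
  Derivatives are taken within \<open>S\<close>, so that the notion also covers sets of the form
  \<open>U \<times> {0..<T}\<close> with \<open>U\<close> open, where it means smooth up to the initial time.  On
  such sets, as on open sets, the derivative within \<open>S\<close> is unique.
\<close>

primrec Ck_on :: "nat \<Rightarrow> 'a::real_normed_vector set \<Rightarrow> ('a \<Rightarrow> 'b::real_normed_vector) \<Rightarrow> bool" where
  "Ck_on 0 S f \<longleftrightarrow> continuous_on S f"
| "Ck_on (Suc k) S f \<longleftrightarrow>
     (\<exists>f'. (\<forall>x\<in>S. (f has_derivative f' x) (at x within S)) \<and> (\<forall>v. Ck_on k S (\<lambda>x. f' x v)))"

definition smooth_on :: "'a::real_normed_vector set \<Rightarrow> ('a \<Rightarrow> 'b::real_normed_vector) \<Rightarrow> bool" where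
  "smooth_on S f \<longleftrightarrow> (\<forall>k. Ck_on k S f)"


section \<open>Closed manifolds\<close>

type_synonym ('m, 'n) chart = "'m set \<times> ('m \<Rightarrow> real^'n)"

abbreviation chart_dom :: "('m, 'n::finite) chart \<Rightarrow> 'm set" where
  "chart_dom \<equiv> fst"

abbreviation coord :: "('m, 'n::finite) chart \<Rightarrow> 'm \<Rightarrow> real^'n" where
  "coord \<equiv> snd"

abbreviation chart_ran :: "('m, 'n::finite) chart \<Rightarrow> (real^'n) set" where
  "chart_ran c \<equiv> coord c ` chart_dom c"

definition transition :: "('m, 'n::finite) chart \<Rightarrow> ('m, 'n) chart \<Rightarrow> real^'n \<Rightarrow> real^'n" where
  "transition c d = coord d \<circ> inv_into (chart_dom c) (coord c)"

definition smooth_atlas :: "'m::topological_space set \<Rightarrow> ('m, 'n::finite) chart set \<Rightarrow> bool" where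
  "smooth_atlas M \<A> \<longleftrightarrow>
     (\<forall>c\<in>\<A>. openin (top_of_set M) (chart_dom c) \<and> open (chart_ran c) \<and>
        homeomorphism (chart_dom c) (chart_ran c) (coord c) (inv_into (chart_dom c) (coord c))) \<and>
     (\<Union>c\<in>\<A>. chart_dom c) = M \<and>
     (\<forall>c\<in>\<A>. \<forall>d\<in>\<A>. smooth_on (coord c ` (chart_dom c \<inter> chart_dom d)) (transition c d))"

text \<open>
  All charts take values in open subsets of \<open>\<real>\<^sup>n\<close>, so there is no boundary.  Second
  countability follows from compactness; the atlas need not be maximal; \<open>M\<close> need not be
  connected.
\<close>

definition closed_manifold :: "'m::t2_space set \<Rightarrow> ('m, 'n::finite) chart set \<Rightarrow> bool" where
  "closed_manifold M \<A> \<longleftrightarrow> compact M \<and> smooth_atlas M \<A>"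


section \<open>Tensor calculus in local coordinates\<close>

definition partial :: "'n::finite \<Rightarrow> (real^'n \<Rightarrow> real) \<Rightarrow> real^'n \<Rightarrow> real" where
  "partial i f x = frechet_derivative f (at x) (axis i 1)"

text \<open>
  The arguments \<open>G\<close> and \<open>H\<close> below are the matrices of components \<open>g\<^sub>i\<^sub>j\<close>
  and \<open>h\<^sub>i\<^sub>j\<close> as functions of the coordinates \<open>x\<close>.
\<close>

type_synonym 'n local_tensor = "real^'n \<Rightarrow> real^'n^'n"

definition ginv :: "'n::finite local_tensor \<Rightarrow> 'n \<Rightarrow> 'n \<Rightarrow> real^'n \<Rightarrow> real" where
  "ginv G i j x = matrix_inv (G x) $ i $ j"

definition christoffel :: "'n::finite local_tensor \<Rightarrow> 'n \<Rightarrow> 'n \<Rightarrow> 'n \<Rightarrow> real^'n \<Rightarrow> real" where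
  "christoffel G k i j x = (\<Sum>l\<in>UNIV. ginv G k l x *
     (partial i (\<lambda>y. G y $ j $ l) x + partial j (\<lambda>y. G y $ i $ l) x
      - partial l (\<lambda>y. G y $ i $ j) x)) / 2"

text \<open>
  \<open>curv G m i j k\<close> is the component along \<open>\<partial>\<^sub>m\<close> of
  \<open>R(\<partial>\<^sub>i, \<partial>\<^sub>j) \<partial>\<^sub>k\<close>, where
  \<open>R(X,Y)Z = \<nabla>\<^sub>X \<nabla>\<^sub>Y Z - \<nabla>\<^sub>Y \<nabla>\<^sub>X Z - \<nabla>\<^bsub>[X,Y]\<^esub> Z\<close>.
  \<open>riem G i j k l\<close> is \<open>R\<^sub>i\<^sub>j\<^sub>k\<^sub>l = g(R(\<partial>\<^sub>i, \<partial>\<^sub>j) \<partial>\<^sub>l, \<partial>\<^sub>k)\<close>;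
  with this order of the last two indices \<open>R\<^sub>1\<^sub>2\<^sub>1\<^sub>2 > 0\<close> on the round
  sphere and the Ricci tensor is the trace over the first and third index.
\<close>

definition curv :: "'n::finite local_tensor \<Rightarrow> 'n \<Rightarrow> 'n \<Rightarrow> 'n \<Rightarrow> 'n \<Rightarrow> real^'n \<Rightarrow> real" where
  "curv G m i j k x =
     partial i (christoffel G m j k) x - partial j (christoffel G m i k) x
     + (\<Sum>p\<in>UNIV. christoffel G p j k x * christoffel G m i p x
                 - christoffel G p i k x * christoffel G m j p x)"

definition riem :: "'n::finite local_tensor \<Rightarrow> 'n \<Rightarrow> 'n \<Rightarrow> 'n \<Rightarrow> 'n \<Rightarrow> real^'n \<Rightarrow> real" where
  "riem G i j k l x = (\<Sum>m\<in>UNIV. G x $ k $ m * curv G m i j l x)"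

definition ricci :: "'n::finite local_tensor \<Rightarrow> 'n \<Rightarrow> 'n \<Rightarrow> real^'n \<Rightarrow> real" where
  "ricci G k l x = (\<Sum>i\<in>UNIV. \<Sum>j\<in>UNIV. ginv G i j x * riem G i k j l x)"

definition scal :: "'n::finite local_tensor \<Rightarrow> real^'n \<Rightarrow> real" where
  "scal G x = (\<Sum>k\<in>UNIV. \<Sum>l\<in>UNIV. ginv G k l x * ricci G k l x)"

definition weyl :: "'n::finite local_tensor \<Rightarrow> 'n \<Rightarrow> 'n \<Rightarrow> 'n \<Rightarrow> 'n \<Rightarrow> real^'n \<Rightarrow> real" where
  "weyl G i k j l x = riem G i k j l x
     - 1 / (real CARD('n) - 2) *
         (G x $ i $ j * ricci G k l x + G x $ k $ l * ricci G i j x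
          - G x $ i $ l * ricci G j k x - G x $ j $ k * ricci G i l x)
     + scal G x / ((real CARD('n) - 1) * (real CARD('n) - 2)) *
         (G x $ i $ j * G x $ k $ l - G x $ i $ l * G x $ j $ k)"

text \<open>
  \<open>nabla G H k i j\<close> is \<open>\<nabla>\<^sub>k h\<^sub>i\<^sub>j\<close> and \<open>nabla2 G H k l i j\<close> is
  \<open>\<nabla>\<^sub>k \<nabla>\<^sub>l h\<^sub>i\<^sub>j\<close>, the covariant derivative of the 3-tensor \<open>\<nabla>h\<close>.
\<close>

definition nabla :: "'n::finite local_tensor \<Rightarrow> 'n local_tensor \<Rightarrow> 'n \<Rightarrow> 'n \<Rightarrow> 'n \<Rightarrow> real^'n \<Rightarrow> real" where
  "nabla G H k i j x = partial k (\<lambda>y. H y $ i $ j) x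
     - (\<Sum>m\<in>UNIV. christoffel G m k i x * H x $ m $ j + christoffel G m k j x * H x $ i $ m)"

definition nabla2 ::
  "'n::finite local_tensor \<Rightarrow> 'n local_tensor \<Rightarrow> 'n \<Rightarrow> 'n \<Rightarrow> 'n \<Rightarrow> 'n \<Rightarrow> real^'n \<Rightarrow> real" where
  "nabla2 G H k l i j x = partial k (nabla G H l i j) x
     - (\<Sum>m\<in>UNIV. christoffel G m k l x * nabla G H m i j x
                 + christoffel G m k i x * nabla G H l m j x
                 + christoffel G m k j x * nabla G H l i m x)"

definition rough_laplacian ::
  "'n::finite local_tensor \<Rightarrow> 'n local_tensor \<Rightarrow> 'n \<Rightarrow> 'n \<Rightarrow> real^'n \<Rightarrow> real" where
  "rough_laplacian G H i j x = (\<Sum>k\<in>UNIV. \<Sum>l\<in>UNIV. ginv G k l x * nabla2 G H k l i j x)"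

definition tensor_norm :: "'n::finite local_tensor \<Rightarrow> 'n local_tensor \<Rightarrow> real^'n \<Rightarrow> real" where
  "tensor_norm G H x = sqrt (\<Sum>i\<in>UNIV. \<Sum>j\<in>UNIV. \<Sum>k\<in>UNIV. \<Sum>l\<in>UNIV.
     ginv G i k x * ginv G j l x * H x $ i $ j * H x $ k $ l)"

text \<open>
  The right-hand side of the evolution equation for \<open>h\<close>, with the metric contractions
  over repeated lower indices written out.
\<close>

definition lichnerowicz_rhs ::
  "'n::finite local_tensor \<Rightarrow> 'n local_tensor \<Rightarrow> 'n \<Rightarrow> 'n \<Rightarrow> real^'n \<Rightarrow> real" where
  "lichnerowicz_rhs G H i j x = rough_laplacian G H i j x
     + 2 * (\<Sum>k\<in>UNIV. \<Sum>l\<in>UNIV. \<Sum>p\<in>UNIV. \<Sum>q\<in>UNIV.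
              ginv G k p x * ginv G l q x * riem G i k j l x * H x $ p $ q)
     - (\<Sum>k\<in>UNIV. \<Sum>p\<in>UNIV. ginv G k p x * ricci G i k x * H x $ p $ j)
     - (\<Sum>k\<in>UNIV. \<Sum>p\<in>UNIV. ginv G k p x * ricci G j k x * H x $ p $ i)"


section \<open>Tensor fields on a manifold\<close>

text \<open>
  A covariant 2-tensor field is given by its components in each chart of the atlas, as functions
  on the range of the chart, subject to the transformation law.  Values outside the
  range of the chart, or at sets that are not charts of the atlas, are irrelevant.
\<close>

type_synonym ('m, 'n) field2 = "('m, 'n) chart \<Rightarrow> 'n local_tensor"

definition tensor_field :: "('m, 'n::finite) chart set \<Rightarrow> ('m, 'n) field2 \<Rightarrow> bool" where
  "tensor_field \<A> S \<longleftrightarrow> (\<forall>c\<in>\<A>. \<forall>d\<in>\<A>. \<forall>x\<in>coord c ` (chart_dom c \<inter> chart_dom d). \<forall>i j.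
     S c x $ i $ j = (\<Sum>a\<in>UNIV. \<Sum>b\<in>UNIV.
       partial i (\<lambda>y. transition c d y $ a) x * partial j (\<lambda>y. transition c d y $ b) x *
       S d (transition c d x) $ a $ b))"

definition same_field ::
  "('m, 'n::finite) chart set \<Rightarrow> ('m, 'n) field2 \<Rightarrow> ('m, 'n) field2 \<Rightarrow> bool" where
  "same_field \<A> S S' \<longleftrightarrow> (\<forall>c\<in>\<A>. \<forall>x\<in>chart_ran c. S c x = S' c x)"

definition symmetric_tensor_field :: "('m, 'n::finite) chart set \<Rightarrow> ('m, 'n) field2 \<Rightarrow> bool" where
  "symmetric_tensor_field \<A> S \<longleftrightarrow> tensor_field \<A> S \<and>
     (\<forall>c\<in>\<A>. \<forall>x\<in>chart_ran c. \<forall>i j. S c x $ i $ j = S c x $ j $ i)"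

definition riemannian_metric :: "('m, 'n::finite) chart set \<Rightarrow> ('m, 'n) field2 \<Rightarrow> bool" where
  "riemannian_metric \<A> S \<longleftrightarrow> symmetric_tensor_field \<A> S \<and>
     (\<forall>c\<in>\<A>. \<forall>x\<in>chart_ran c. \<forall>v. v \<noteq> 0 \<longrightarrow> v \<bullet> (S c x *v v) > 0)"

definition smooth_family ::
  "('m, 'n::finite) chart set \<Rightarrow> real \<Rightarrow> (real \<Rightarrow> ('m, 'n) field2) \<Rightarrow> bool" where
  "smooth_family \<A> T S \<longleftrightarrow>
     (\<forall>c\<in>\<A>. smooth_on (chart_ran c \<times> {0..<T}) (\<lambda>(x, t). S t c x))"

definition linearized_ricci_flow ::
  "('m, 'n::finite) chart set \<Rightarrow> real \<Rightarrow> (real \<Rightarrow> ('m, 'n) field2) \<Rightarrow> (real \<Rightarrow> ('m, 'n) field2) \<Rightarrow> bool"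
  where
  "linearized_ricci_flow \<A> T g h \<longleftrightarrow>
     smooth_family \<A> T g \<and> smooth_family \<A> T h \<and>
     (\<forall>t\<in>{0..<T}. riemannian_metric \<A> (g t) \<and> symmetric_tensor_field \<A> (h t)) \<and>
     (\<forall>t\<in>{0..<T}. \<forall>c\<in>\<A>. \<forall>x\<in>chart_ran c. \<forall>i j.
        ((\<lambda>s. g s c x $ i $ j) has_real_derivative - 2 * ricci (g t c) i j x)
          (at t within {0..<T}) \<and>
        ((\<lambda>s. h s c x $ i $ j) has_real_derivative lichnerowicz_rhs (g t c) (h t c) i j x)
          (at t within {0..<T}))"

definition positive_scalar_curvature :: "('m, 'n::finite) chart set \<Rightarrow> ('m, 'n) field2 \<Rightarrow> bool" where
  "positive_scalar_curvature \<A> S \<longleftrightarrow> (\<forall>c\<in>\<A>. \<forall>x\<in>chart_ran c. scal (S c) x > 0)"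

definition weyl_vanishes :: "('m, 'n::finite) chart set \<Rightarrow> ('m, 'n) field2 \<Rightarrow> bool" where
  "weyl_vanishes \<A> S \<longleftrightarrow> (\<forall>c\<in>\<A>. \<forall>x\<in>chart_ran c. \<forall>i k j l. weyl (S c) i k j l x = 0)"

end

(*
  With u = |h|^2 / R^2, a maximum (x, t) of u - eps t over M x [0, t1] at a positive time is
  excluded, so u never exceeds its initial maximum.  At such a point put C = u(x, t) and
  psi = |h|^2 - C R^2, which has a spatial maximum with value 0 there.  The evolution equations
  d/dt R = Lap R + 2 |Ric|^2 and d/dt |h|^2 = Lap |h|^2 - 2 |nabla h|^2 + 4 Rm(h, h) give

    d/dt psi = Lap psi + 2 (C |nabla R|^2 - |nabla h|^2) + 4 (Rm(h, h) - C R |Ric|^2).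

  The first bracket is nonpositive by a Kato inequality (Cauchy-Schwarz, since nabla psi = 0),
  the second because R Rm(h, h) <= |Ric|^2 |h|^2 when the Weyl tensor vanishes.  This algebraic
  inequality reduces, after splitting off traces and minimizing in the trace of h, to
  (n-1) (tr B^3)^2 + tr B^4 <= (n-2)^2/(n-1) + 1/n for traceless symmetric B with |B| = 1, which
  is the trace of the positive semidefinite matrix (m - B)(B + c)(B + d)^2 for suitable constants;
  no diagonalization is needed.
*)

theory Submission
  imports Defs
begin

section \<open>Smooth functions\<close>

text \<open>Space and time form one open set: over a chart, the coordinate fields and the time
  direction are constant vectors, so every exchange of time and space derivatives is symmetry of
  second derivatives. Tensors become matrix-valued functions, and index manipulations become
  identities between products and traces. The comparison argument differentiates in time only at
  positive times, away from the one-sided derivatives at 0, and needs mere continuity down to 0.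
  Using \<psi> in place of the quotient avoids derivatives of 1/R^2 and leaves terms that have a
  sign one by one. The trace inequality has to be sharp: equality holds for eigenvalues proportional
  to (n-1, -1, ..., -1), up to sign the traceless Ricci tensor of a round cylinder. This dictates
  the constants: m is the simple eigenvalue and -d the repeated one, where the polynomial has a
  double zero. One bound has to serve all flows with the same initial data, so the initial maximum
  is also shown to depend on those data alone.\<close>

lemma Ck_on_Suc_imp: "Ck_on (Suc k) S f \<Longrightarrow> Ck_on k S f"
proof (induction k arbitrary: f)
  case 0
  then show ?case
    by (auto simp: continuous_on_eq_continuous_within dest: has_derivative_continuous)
next
  case (Suc k)
  from Suc.prems obtain f' where
    "\<forall>x\<in>S. (f has_derivative f' x) (at x within S)" "\<forall>v. Ck_on (Suc k) S (\<lambda>x. f' x v)"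
    by (simp only: Ck_on.simps(2)[of "Suc k"]) blast
  then show ?case
    using Suc.IH by (auto simp only: Ck_on.simps(2)[of k])
qed

lemma Ck_on_const: "Ck_on k S (\<lambda>_. c)"
proof (induction k arbitrary: c)
  case (Suc k)
  show ?case
    by (auto intro!: exI[of _ "\<lambda>_ _. 0"] Suc.IH)
qed simp

lemma Ck_on_add: "Ck_on k S f \<Longrightarrow> Ck_on k S g \<Longrightarrow> Ck_on k S (\<lambda>x. f x + g x)"
proof (induction k arbitrary: f g)
  case (Suc k)
  then obtain f' g' where
    "\<forall>x\<in>S. (f has_derivative f' x) (at x within S)" "\<forall>v. Ck_on k S (\<lambda>x. f' x v)"
    "\<forall>x\<in>S. (g has_derivative g' x) (at x within S)" "\<forall>v. Ck_on k S (\<lambda>x. g' x v)"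
    by auto
  then show ?case
    by (auto intro!: exI[of _ "\<lambda>x v. f' x v + g' x v"] has_derivative_add Suc.IH)
qed (simp add: continuous_on_add)

lemma Ck_on_linear:
  assumes "bounded_linear L"
  shows "Ck_on k S f \<Longrightarrow> Ck_on k S (\<lambda>x. L (f x))"
proof (induction k arbitrary: f)
  case 0
  then show ?case using bounded_linear.continuous_on[OF assms] by simp
next
  case (Suc k)
  then obtain f' where
    "\<forall>x\<in>S. (f has_derivative f' x) (at x within S)" "\<forall>v. Ck_on k S (\<lambda>x. f' x v)"
    by auto
  then show ?case
    by (auto intro!: exI[of _ "\<lambda>x v. L (f' x v)"] bounded_linear.has_derivative[OF assms] Suc.IH)
qed

lemma Ck_on_bilinear:
  assumes "bounded_bilinear B"
  shows "Ck_on k S f \<Longrightarrow> Ck_on k S g \<Longrightarrow> Ck_on k S (\<lambda>x. B (f x) (g x))"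
proof (induction k arbitrary: f g)
  case 0
  then show ?case using bounded_bilinear.continuous_on[OF assms] by simp
next
  case (Suc k)
  then obtain f' g' where
    "\<forall>x\<in>S. (f has_derivative f' x) (at x within S)" "\<forall>v. Ck_on k S (\<lambda>x. f' x v)"
    "\<forall>x\<in>S. (g has_derivative g' x) (at x within S)" "\<forall>v. Ck_on k S (\<lambda>x. g' x v)"
    by auto
  moreover have "Ck_on k S f" "Ck_on k S g"
    using Suc.prems Ck_on_Suc_imp by blast+
  ultimately show ?case
    by (auto intro!: exI[of _ "\<lambda>x v. B (f x) (g' x v) + B (f' x v) (g x)"]
        bounded_bilinear.FDERIV[OF assms] Ck_on_add Suc.IH)
qed

text \<open>The derivative of 1/f is built from 1/f and f', so the claim for 1/f at the lower order
  closes the induction.\<close>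

lemma Ck_on_inverse:
  fixes f :: "'a::real_normed_vector \<Rightarrow> real"
  assumes "\<And>x. x \<in> S \<Longrightarrow> f x \<noteq> 0"
  shows "Ck_on k S f \<Longrightarrow> Ck_on k S (\<lambda>x. inverse (f x))"
proof (induction k)
  case 0
  then show ?case using assms by (auto intro: continuous_on_inverse)
next
  case (Suc k)
  then obtain f' where
    "\<forall>x\<in>S. (f has_derivative f' x) (at x within S)" "\<forall>v. Ck_on k S (\<lambda>x. f' x v)"
    by auto
  moreover have "Ck_on k S (\<lambda>x. inverse (f x))"
    using Suc Ck_on_Suc_imp by blast
  ultimately show ?case
    using assms
    by (auto intro!: exI[of _ "\<lambda>x v. - (inverse (f x) * f' x v * inverse (f x))"]
        has_derivative_inverse Ck_on_bilinear[OF bounded_bilinear_mult]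
        Ck_on_linear[OF bounded_linear_minus[OF bounded_linear_ident]])
qed

lemma Ck_on_eqI:
  assumes "Ck_on k S g" "\<And>x. x \<in> S \<Longrightarrow> f x = g x"
  shows "Ck_on k S f"
proof (cases k)
  case 0
  then show ?thesis using assms continuous_on_cong[of S S f g] by auto
next
  case (Suc m)
  then obtain g' where g': "\<And>x. x \<in> S \<Longrightarrow> (g has_derivative g' x) (at x within S)"
    "\<And>v. Ck_on m S (\<lambda>x. g' x v)"
    using assms(1) by auto
  have "(f has_derivative g' x) (at x within S)" if "x \<in> S" for x
    using has_derivative_transform[OF that _ g'(1)[OF that], of f] assms(2) by auto
  then show ?thesis using Suc g'(2) by auto
qed

lemma Ck_on_subset: "Ck_on k S f \<Longrightarrow> S' \<subseteq> S \<Longrightarrow> Ck_on k S' f"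
proof (induction k arbitrary: f)
  case 0
  then show ?case using continuous_on_subset by auto
next
  case (Suc k)
  then show ?case
    by (auto simp: subset_iff) (metis has_derivative_subset subsetI)
qed

named_theorems smooth_intros

lemma smooth_on_const [smooth_intros]: "smooth_on S (\<lambda>_. c)"
  by (simp add: smooth_on_def Ck_on_const)

lemma smooth_on_add [smooth_intros]:
  "smooth_on S f \<Longrightarrow> smooth_on S g \<Longrightarrow> smooth_on S (\<lambda>x. f x + g x)"
  by (simp add: smooth_on_def Ck_on_add)

lemma smooth_on_linear: "bounded_linear L \<Longrightarrow> smooth_on S f \<Longrightarrow> smooth_on S (\<lambda>x. L (f x))"
  by (simp add: smooth_on_def Ck_on_linear)

lemma smooth_on_bilinear:
  "bounded_bilinear B \<Longrightarrow> smooth_on S f \<Longrightarrow> smooth_on S g \<Longrightarrow> smooth_on S (\<lambda>x. B (f x) (g x))"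
  by (simp add: smooth_on_def Ck_on_bilinear)

lemmas smooth_on_mult [smooth_intros] =
  smooth_on_bilinear[OF bounded_bilinear_mult[where 'a = real]]

lemma smooth_on_uminus [smooth_intros]: "smooth_on S f \<Longrightarrow> smooth_on S (\<lambda>x. - f x)"
  by (rule smooth_on_linear[OF bounded_linear_minus[OF bounded_linear_ident]])

lemma smooth_on_diff [smooth_intros]:
  "smooth_on S f \<Longrightarrow> smooth_on S g \<Longrightarrow> smooth_on S (\<lambda>x. f x - g x)"
  using smooth_on_add[of S f "\<lambda>x. - g x"] smooth_on_uminus[of S g] by simp

lemma smooth_on_sum [smooth_intros]:
  "(\<And>i. i \<in> I \<Longrightarrow> smooth_on S (f i)) \<Longrightarrow> smooth_on S (\<lambda>x. \<Sum>i\<in>I. f i x)"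
  by (induction I rule: infinite_finite_induct) (auto intro: smooth_intros)

lemma smooth_on_prod [smooth_intros]:
  fixes f :: "'i \<Rightarrow> 'a::real_normed_vector \<Rightarrow> real"
  shows "(\<And>i. i \<in> I \<Longrightarrow> smooth_on S (f i)) \<Longrightarrow> smooth_on S (\<lambda>x. \<Prod>i\<in>I. f i x)"
  by (induction I rule: infinite_finite_induct) (auto intro: smooth_intros)

lemma smooth_on_divide [smooth_intros]:
  fixes f g :: "'a::real_normed_vector \<Rightarrow> real"
  assumes "smooth_on S f" "smooth_on S g" "\<And>x. x \<in> S \<Longrightarrow> g x \<noteq> 0"
  shows "smooth_on S (\<lambda>x. f x / g x)"
proof -
  have "smooth_on S (\<lambda>x. inverse (g x))"
    using assms(2,3) unfolding smooth_on_def by (blast intro: Ck_on_inverse)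
  then show ?thesis
    using smooth_on_mult[OF assms(1)] by (simp add: divide_inverse)
qed

lemma smooth_on_eqI: "smooth_on S g \<Longrightarrow> (\<And>x. x \<in> S \<Longrightarrow> f x = g x) \<Longrightarrow> smooth_on S f"
  unfolding smooth_on_def using Ck_on_eqI by blast

lemma smooth_on_subset: "smooth_on S f \<Longrightarrow> S' \<subseteq> S \<Longrightarrow> smooth_on S' f"
  unfolding smooth_on_def using Ck_on_subset by blast

lemma smooth_on_imp_continuous_on: "smooth_on S f \<Longrightarrow> continuous_on S f"
  unfolding smooth_on_def by (metis Ck_on.simps(1))

lemma smooth_on_vec_nth [smooth_intros]: "smooth_on S f \<Longrightarrow> smooth_on S (\<lambda>x. f x $ i)"
  by (rule smooth_on_linear[OF bounded_linear_vec_nth])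

lemma smooth_on_matrix:
  fixes f :: "'a::real_normed_vector \<Rightarrow> real^'n^'m"
  assumes "\<And>i j. smooth_on S (\<lambda>x. f x $ i $ j)"
  shows "smooth_on S f"
proof -
  let ?E = "\<lambda>a b r. (\<chi> i j. if i = a \<and> j = b then r else 0) :: real^'n^'m"
  have lin: "bounded_linear (?E a b)" for a b
    by (rule linear_conv_bounded_linear[THEN iffD1], rule linearI) (simp_all add: vec_eq_iff)
  have "smooth_on S (\<lambda>x. \<Sum>a\<in>UNIV. \<Sum>b\<in>UNIV. ?E a b (f x $ a $ b))"
    by (intro smooth_on_sum smooth_on_linear[OF lin assms])
  moreover have "(\<Sum>a\<in>UNIV. \<Sum>b\<in>UNIV. ?E a b (A $ a $ b)) = A" for A :: "real^'n^'m"
  proof -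
    have "(\<Sum>a\<in>UNIV. \<Sum>b\<in>UNIV. if i = a \<and> j = b then A $ a $ b else 0) = A $ i $ j" for i j
    proof -
      have "(\<Sum>b\<in>UNIV. if i = a \<and> j = b then A $ a $ b else 0) = (if i = a then A $ a $ j else 0)" for a
        by (cases "i = a") simp_all
      then show ?thesis by simp
    qed
    then show ?thesis by (simp add: vec_eq_iff)
  qed
  ultimately show ?thesis by simp
qed

lemma bounded_bilinear_matrix_mult:
  "bounded_bilinear ((**) :: real^'n^'m \<Rightarrow> real^'p^'n \<Rightarrow> real^'p^'m)"
  unfolding bilinear_conv_bounded_bilinear[symmetric] bilinear_def
  by (auto intro!: linearI simp: matrix_matrix_mult_def vec_eq_iff sum.distrib algebra_simps sum_distrib_left)

lemmas smooth_on_matrix_mult [smooth_intros] = smooth_on_bilinear[OF bounded_bilinear_matrix_mult]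

lemma bounded_linear_transpose: "bounded_linear (transpose :: real^'n^'m \<Rightarrow> real^'m^'n)"
  by (rule linear_conv_bounded_linear[THEN iffD1], rule linearI) (simp_all add: vec_eq_iff transpose_def)

lemmas smooth_on_transpose [smooth_intros] = smooth_on_linear[OF bounded_linear_transpose]

lemma bounded_linear_trace: "bounded_linear (trace :: real^'n^'n \<Rightarrow> real)"
  by (rule linear_conv_bounded_linear[THEN iffD1], rule linearI)
    (simp_all add: trace_def sum.distrib sum_distrib_left)

lemmas smooth_on_trace [smooth_intros] = smooth_on_linear[OF bounded_linear_trace]

lemma smooth_on_det [smooth_intros]:
  fixes f :: "'a::real_normed_vector \<Rightarrow> real^'n^'n"
  assumes "\<And>i j. smooth_on S (\<lambda>x. f x $ i $ j)"
  shows "smooth_on S (\<lambda>x. det (f x))"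
  unfolding det_def by (intro smooth_intros assms)

lemma matrix_inv_inverse:
  fixes A :: "real^'n^'n"
  assumes "invertible A"
  shows "A ** matrix_inv A = mat 1" "matrix_inv A ** A = mat 1"
  using someI_ex[OF assms[unfolded invertible_def]] by (simp_all add: matrix_inv_def)

lemma matrix_inv_cramer:
  fixes A :: "real^'n^'n"
  assumes "invertible A"
  shows "matrix_inv A $ k $ l = det (\<chi> i j. if j = k then axis l 1 $ i else A $ i $ j) / det A"
proof -
  let ?x = "matrix_inv A *v axis l 1"
  have "A *v ?x = axis l 1"
    by (metis assms matrix_inv_inverse(1) matrix_vector_mul_assoc matrix_vector_mul_lid)
  then have x: "?x = (\<chi> k. det (\<chi> i j. if j = k then axis l 1 $ i else A $ i $ j) / det A)"
    using cramer[of A ?x "axis l 1"] assms invertible_det_nz by blast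
  have "?x $ k = matrix_inv A $ k $ l"
    by (simp add: matrix_vector_mult_basis column_def)
  then show ?thesis
    unfolding x by simp
qed

text \<open>By Cramer's rule each entry of the inverse is a quotient of determinants, and these are
  polynomials in the entries.\<close>

lemma smooth_on_matrix_inv [smooth_intros]:
  fixes f :: "'a::real_normed_vector \<Rightarrow> real^'n^'n"
  assumes "smooth_on S f" "\<And>x. x \<in> S \<Longrightarrow> invertible (f x)"
  shows "smooth_on S (\<lambda>x. matrix_inv (f x))"
proof (rule smooth_on_matrix)
  fix k l
  have "smooth_on S (\<lambda>x. (\<chi> i j. if j = k then axis l 1 $ i else f x $ i $ j) $ i $ j)" for i j
    using assms(1) by (cases "j = k") (auto intro: smooth_intros)
  then have "smooth_on S (\<lambda>x. det (\<chi> i j. if j = k then axis l 1 $ i else f x $ i $ j))"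
    by (rule smooth_on_det)
  moreover have "smooth_on S (\<lambda>x. det (f x))"
    by (intro smooth_intros assms(1))
  ultimately have sm:
    "smooth_on S (\<lambda>x. det (\<chi> i j. if j = k then axis l 1 $ i else f x $ i $ j) / det (f x))"
    using assms(2) by (intro smooth_on_divide) (auto simp: invertible_det_nz)
  have eq: "matrix_inv (f x) $ k $ l =
      det (\<chi> i j. if j = k then axis l 1 $ i else f x $ i $ j) / det (f x)" if "x \<in> S" for x
    by (rule matrix_inv_cramer[OF assms(2)[OF that]])
  show "smooth_on S (\<lambda>x. matrix_inv (f x) $ k $ l)"
    by (rule smooth_on_eqI[OF sm eq])
qed

section \<open>Directional derivatives\<close>

text \<open>The direction precedes the function so that \<open>dd v f\<close> is again a function of
  the point and can be differentiated in turn.\<close>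

definition dd :: "'a::real_normed_vector \<Rightarrow> ('a \<Rightarrow> 'b::real_normed_vector) \<Rightarrow> 'a \<Rightarrow> 'b" where
  "dd v f x = frechet_derivative f (at x) v"

lemma dd_eq: "(f has_derivative f') (at x) \<Longrightarrow> dd v f x = f' v"
  by (simp add: dd_def frechet_derivative_at[symmetric])

lemma smooth_on_imp_has_derivative:
  assumes "smooth_on W f" "open W" "x \<in> W"
  shows "(f has_derivative (\<lambda>v. dd v f x)) (at x)"
proof -
  have "Ck_on (Suc 0) W f" using assms(1) smooth_on_def by blast
  then obtain f' where "(f has_derivative f' x) (at x within W)"
    using assms(3) by auto
  then have "(f has_derivative f' x) (at x)"
    using at_within_open[OF assms(3,2)] by simp
  then show ?thesis
    by (simp add: dd_eq)
qed

lemma linear_dd: "smooth_on W f \<Longrightarrow> open W \<Longrightarrow> x \<in> W \<Longrightarrow> linear (\<lambda>v. dd v f x)"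
  using smooth_on_imp_has_derivative has_derivative_linear by blast

lemma smooth_on_dd [smooth_intros]:
  assumes "smooth_on W f" "open W"
  shows "smooth_on W (dd v f)"
  unfolding smooth_on_def
proof
  fix k
  have "Ck_on (Suc k) W f" using assms(1) smooth_on_def by blast
  then obtain f' where f': "\<forall>x\<in>W. (f has_derivative f' x) (at x within W)" "\<forall>v. Ck_on k W (\<lambda>x. f' x v)"
    by auto
  have "dd v f x = f' x v" if "x \<in> W" for x
    using f'(1)[rule_format, OF that] unfolding at_within_open[OF that assms(2)] by (rule dd_eq)
  then show "Ck_on k W (dd v f)" by (rule Ck_on_eqI[OF f'(2)[rule_format]])
qed

text \<open>Functions that agree near \<open>x\<close> have the same candidate derivatives there, so
  their \<open>frechet_derivative\<close> agrees even where neither is differentiable. This is what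
  makes curvature quantities local without any smoothness hypothesis.\<close>

lemma dd_cong:
  assumes "open W" "x \<in> W" "\<And>y. y \<in> W \<Longrightarrow> f y = g y"
  shows "dd v f x = dd v g x"
proof -
  have "(f has_derivative D) (at x) \<longleftrightarrow> (g has_derivative D) (at x)" for D
    using assms has_derivative_transform_within_open by metis
  then show ?thesis by (simp add: dd_def frechet_derivative_def)
qed

lemma dd_const [simp]: "dd v (\<lambda>_. c) x = 0"
  by (rule dd_eq) simp

lemma dd_linear:
  assumes "bounded_linear L" "smooth_on W f" "open W" "x \<in> W"
  shows "dd v (\<lambda>y. L (f y)) x = L (dd v f x)"
  by (rule dd_eq) (intro bounded_linear.has_derivative[OF assms(1)] smooth_on_imp_has_derivative[where W = W] assms)

lemma dd_bilinear:
  assumes "bounded_bilinear B" "smooth_on W f" "smooth_on W g" "open W" "x \<in> W"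
  shows "dd v (\<lambda>y. B (f y) (g y)) x = B (dd v f x) (g x) + B (f x) (dd v g x)"
  using dd_eq[OF bounded_bilinear.FDERIV[OF assms(1) smooth_on_imp_has_derivative[OF assms(2,4,5)]
      smooth_on_imp_has_derivative[OF assms(3,4,5)]]]
  by (simp add: add.commute)

lemma dd_add:
  assumes "smooth_on W f" "smooth_on W g" "open W" "x \<in> W"
  shows "dd v (\<lambda>y. f y + g y) x = dd v f x + dd v g x"
  by (rule dd_eq) (intro has_derivative_add smooth_on_imp_has_derivative[where W = W] assms)

lemma dd_diff:
  assumes "smooth_on W f" "smooth_on W g" "open W" "x \<in> W"
  shows "dd v (\<lambda>y. f y - g y) x = dd v f x - dd v g x"
  by (rule dd_eq) (intro has_derivative_diff smooth_on_imp_has_derivative[where W = W] assms)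

lemma dd_uminus:
  assumes "smooth_on W f" "open W" "x \<in> W"
  shows "dd v (\<lambda>y. - f y) x = - dd v f x"
  by (rule dd_eq) (intro has_derivative_minus smooth_on_imp_has_derivative[where W = W] assms)

lemma dd_sum:
  assumes "\<And>i. i \<in> I \<Longrightarrow> smooth_on W (f i)" "open W" "x \<in> W"
  shows "dd v (\<lambda>y. \<Sum>i\<in>I. f i y) x = (\<Sum>i\<in>I. dd v (f i) x)"
  by (rule dd_eq) (intro has_derivative_sum smooth_on_imp_has_derivative[where W = W] assms)

lemmas dd_vec_nth = dd_linear[OF bounded_linear_vec_nth]
lemmas dd_transpose = dd_linear[OF bounded_linear_transpose]
lemmas dd_trace = dd_linear[OF bounded_linear_trace]
lemmas dd_mult = dd_bilinear[OF bounded_bilinear_mult[where 'a = real]]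
lemmas dd_matrix_mult = dd_bilinear[OF bounded_bilinear_matrix_mult]

lemma dd_real_line:
  fixes f :: "'a::real_normed_vector \<Rightarrow> real"
  assumes "smooth_on W f" "open W" "x + s *\<^sub>R v \<in> W"
  shows "((\<lambda>s. f (x + s *\<^sub>R v)) has_real_derivative dd v f (x + s *\<^sub>R v)) (at s)"
proof -
  have "((\<lambda>s. x + s *\<^sub>R v) has_derivative (\<lambda>r. r *\<^sub>R v)) (at s)"
    by (auto intro!: derivative_eq_intros)
  from diff_chain_at[OF this smooth_on_imp_has_derivative[OF assms]]
  have "((\<lambda>s. f (x + s *\<^sub>R v)) has_derivative (\<lambda>r. dd (r *\<^sub>R v) f (x + s *\<^sub>R v))) (at s)"
    by (simp add: o_def)
  moreover have "dd (r *\<^sub>R v) f (x + s *\<^sub>R v) = r * dd v f (x + s *\<^sub>R v)" for r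
    using linear_dd[OF assms] by (simp add: linear_iff)
  ultimately show ?thesis
    by (simp add: has_field_derivative_def mult.commute[of _ "dd v f _"])
qed

section \<open>Symmetry of mixed directional derivatives\<close>

lemma second_difference_mvt:
  fixes f :: "'a::real_normed_vector \<Rightarrow> real"
  assumes f: "smooth_on W f" and W: "open W" and h: "h > 0"
    and sub: "\<And>s t. 0 \<le> s \<Longrightarrow> s \<le> h \<Longrightarrow> 0 \<le> t \<Longrightarrow> t \<le> h \<Longrightarrow> x + s *\<^sub>R v + t *\<^sub>R w \<in> W"
  obtains s t where "0 \<le> s" "s \<le> h" "0 \<le> t" "t \<le> h"
    "f (x + h *\<^sub>R v + h *\<^sub>R w) - f (x + h *\<^sub>R v) - f (x + h *\<^sub>R w) + f x
       = h * h * dd w (dd v f) (x + s *\<^sub>R v + t *\<^sub>R w)"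
proof -
  \<comment> \<open>The difference along \<open>w\<close>, viewed as a function of the displacement
    along \<open>v\<close>. One mean value theorem produces a difference of values of
    \<open>dd v f\<close>, and a second one, along \<open>w\<close>, the mixed derivative.\<close>
  define \<phi> where "\<phi> s = f ((x + h *\<^sub>R w) + s *\<^sub>R v) - f (x + s *\<^sub>R v)" for s
  have "(\<phi> has_real_derivative dd v f ((x + h *\<^sub>R w) + s *\<^sub>R v) - dd v f (x + s *\<^sub>R v)) (at s)"
    if "0 \<le> s" "s \<le> h" for s
    unfolding \<phi>_def using sub[of s h] sub[of s 0] that h
    by (intro DERIV_diff dd_real_line[OF f W]) (auto simp: algebra_simps)
  from MVT2[OF h this] obtain s where s: "0 < s" "s < h"
    "\<phi> h - \<phi> 0 = h * (dd v f ((x + h *\<^sub>R w) + s *\<^sub>R v) - dd v f (x + s *\<^sub>R v))"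
    by auto
  have "((\<lambda>t. dd v f ((x + s *\<^sub>R v) + t *\<^sub>R w)) has_real_derivative
      dd w (dd v f) ((x + s *\<^sub>R v) + t *\<^sub>R w)) (at t)" if "0 \<le> t" "t \<le> h" for t
    using sub[of s t] that s by (intro dd_real_line[OF smooth_on_dd[OF f W] W]) auto
  from MVT2[OF h this] obtain t where t: "0 < t" "t < h"
    "dd v f ((x + s *\<^sub>R v) + h *\<^sub>R w) - dd v f (x + s *\<^sub>R v)
      = h * dd w (dd v f) ((x + s *\<^sub>R v) + t *\<^sub>R w)"
    by auto
  have "\<phi> h - \<phi> 0 = h * h * dd w (dd v f) (x + s *\<^sub>R v + t *\<^sub>R w)"
    using s(3) t(3) by (simp add: algebra_simps)
  then show ?thesis
    using that[of s t] s t by (simp add: \<phi>_def algebra_simps)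
qed

text \<open>The second difference of \<open>f\<close> is symmetric in \<open>v\<close> and
  \<open>w\<close> and equals h^2 times either mixed derivative, each taken at some point of the
  same small parallelogram. Continuity of both mixed derivatives at \<open>x\<close> excludes a gap
  between them.\<close>

lemma dd_commute_real:
  fixes f :: "'a::real_normed_vector \<Rightarrow> real"
  assumes f: "smooth_on W f" and W: "open W" and x: "x \<in> W"
  shows "dd w (dd v f) x = dd v (dd w f) x"
proof (rule ccontr)
  assume ne: "dd w (dd v f) x \<noteq> dd v (dd w f) x"
  define \<epsilon> where "\<epsilon> = \<bar>dd w (dd v f) x - dd v (dd w f) x\<bar> / 2"
  have \<epsilon>: "\<epsilon> > 0" using ne by (simp add: \<epsilon>_def)
  have "continuous_on W (dd w (dd v f))" "continuous_on W (dd v (dd w f))"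
    by (intro smooth_on_imp_continuous_on smooth_intros f W)+
  then have "\<forall>\<^sub>F y in at x. \<bar>dd w (dd v f) y - dd w (dd v f) x\<bar> < \<epsilon>"
    "\<forall>\<^sub>F y in at x. \<bar>dd v (dd w f) y - dd v (dd w f) x\<bar> < \<epsilon>"
    using W x \<epsilon> by (auto simp: continuous_on_eq_continuous_at isCont_def tendsto_iff dist_real_def)
  moreover have "\<forall>\<^sub>F y in at x. y \<in> W"
    using W x by (simp add: eventually_at_in_open')
  ultimately have "\<forall>\<^sub>F y in at x. y \<in> W \<and> \<bar>dd w (dd v f) y - dd w (dd v f) x\<bar> < \<epsilon> \<and>
      \<bar>dd v (dd w f) y - dd v (dd w f) x\<bar> < \<epsilon>"
    by eventually_elim auto
  then obtain d where d: "d > 0" and near: "\<And>y. dist y x < d \<Longrightarrow> y \<in> W \<and>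
      \<bar>dd w (dd v f) y - dd w (dd v f) x\<bar> < \<epsilon> \<and> \<bar>dd v (dd w f) y - dd v (dd w f) x\<bar> < \<epsilon>"
    unfolding eventually_at using x \<epsilon> by (metis abs_zero diff_self UNIV_I)
  \<comment> \<open>The scale puts the whole parallelogram spanned by h v and h w within distance
    \<open>d\<close> of \<open>x\<close>; the summand 1 keeps the denominator positive when both
    vectors vanish.\<close>
  define h where "h = d / (2 * (norm v + norm w + 1))"
  have h: "h > 0" using d by (simp add: h_def add_nonneg_pos)
  have close: "dist (x + s *\<^sub>R v + t *\<^sub>R w) x < d" if "0 \<le> s" "s \<le> h" "0 \<le> t" "t \<le> h" for s t
  proof -
    have "norm (s *\<^sub>R v + t *\<^sub>R w) \<le> s * norm v + t * norm w"
      using that norm_triangle_ineq[of "s *\<^sub>R v" "t *\<^sub>R w"] by simp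
    also have "\<dots> \<le> h * norm v + h * norm w"
      using that by (intro add_mono mult_right_mono) auto
    also have "\<dots> = h * (norm v + norm w)"
      by (simp add: distrib_left)
    also have "\<dots> < h * (2 * (norm v + norm w + 1))"
      using h by (intro mult_strict_left_mono) (simp_all add: add_nonneg_pos)
    also have "\<dots> = d"
    proof -
      have "norm v + norm w + 1 > 0" by (simp add: add_nonneg_pos)
      then show ?thesis by (simp add: h_def)
    qed
    finally show ?thesis by (simp add: dist_norm add.assoc)
  qed
  obtain s t where st: "0 \<le> s" "s \<le> h" "0 \<le> t" "t \<le> h"
    "f (x + h *\<^sub>R v + h *\<^sub>R w) - f (x + h *\<^sub>R v) - f (x + h *\<^sub>R w) + f x
       = h * h * dd w (dd v f) (x + s *\<^sub>R v + t *\<^sub>R w)"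
    by (rule second_difference_mvt[OF f W h, of x v w]) (use near[OF close] in blast)
  have "x + s *\<^sub>R w + t *\<^sub>R v \<in> W" if "0 \<le> s" "s \<le> h" "0 \<le> t" "t \<le> h" for s t
    using near[OF close[OF that(3,4,1,2)]] by (simp add: algebra_simps)
  then obtain s' t' where st': "0 \<le> s'" "s' \<le> h" "0 \<le> t'" "t' \<le> h"
    "f (x + h *\<^sub>R w + h *\<^sub>R v) - f (x + h *\<^sub>R w) - f (x + h *\<^sub>R v) + f x
       = h * h * dd v (dd w f) (x + s' *\<^sub>R w + t' *\<^sub>R v)"
    by (rule second_difference_mvt[OF f W h, of x w v])
  have "h * h * dd w (dd v f) (x + s *\<^sub>R v + t *\<^sub>R w) = h * h * dd v (dd w f) (x + t' *\<^sub>R v + s' *\<^sub>R w)"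
    using st(5) st'(5) by (simp add: algebra_simps)
  then have "dd w (dd v f) (x + s *\<^sub>R v + t *\<^sub>R w) = dd v (dd w f) (x + t' *\<^sub>R v + s' *\<^sub>R w)"
    using h by simp
  then have "\<bar>dd w (dd v f) x - dd v (dd w f) x\<bar> < 2 * \<epsilon>"
    using near[OF close[OF st(1-4)]] near[OF close[OF st'(3,4,1,2)]] by linarith
  then show False by (simp add: \<epsilon>_def)
qed

lemma dd_commute:
  fixes f :: "'a::real_normed_vector \<Rightarrow> real^'n^'m"
  assumes f: "smooth_on W f" and W: "open W" and x: "x \<in> W"
  shows "dd w (dd v f) x = dd v (dd w f) x"
proof -
  have *: "dd w (dd v f) x $ i $ j = dd w (dd v (\<lambda>y. f y $ i $ j)) x" for v w i j
  proof -
    have "dd w (dd v f) x $ i $ j = dd w (\<lambda>y. dd v f y $ i $ j) x"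
      using x by (simp add: dd_vec_nth[where W = W] smooth_intros f W)
    also have "\<dots> = dd w (dd v (\<lambda>y. f y $ i $ j)) x"
      using x by (intro dd_cong[OF W]) (simp_all add: dd_vec_nth[where W = W] smooth_intros f W)
    finally show ?thesis .
  qed
  have "dd w (dd v f) x $ i $ j = dd v (dd w f) x $ i $ j" for i j
    unfolding * by (intro dd_commute_real[OF _ W x] smooth_intros f)
  then show ?thesis by (simp add: vec_eq_iff)
qed

section \<open>Levi-Civita connections and curvature\<close>

lemmas matrix_mult_simps =
  bounded_bilinear.add_left[OF bounded_bilinear_matrix_mult]
  bounded_bilinear.add_right[OF bounded_bilinear_matrix_mult]
  bounded_bilinear.diff_left[OF bounded_bilinear_matrix_mult]
  bounded_bilinear.diff_right[OF bounded_bilinear_matrix_mult]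
  bounded_bilinear.minus_left[OF bounded_bilinear_matrix_mult]
  bounded_bilinear.minus_right[OF bounded_bilinear_matrix_mult]
  bounded_bilinear.zero_left[OF bounded_bilinear_matrix_mult]
  bounded_bilinear.zero_right[OF bounded_bilinear_matrix_mult]
  bounded_bilinear.scaleR_left[OF bounded_bilinear_matrix_mult]
  bounded_bilinear.scaleR_right[OF bounded_bilinear_matrix_mult]
  matrix_mul_assoc

lemma transpose_simps:
  fixes A B :: "real^'n^'m"
  shows "transpose (A + B) = transpose A + transpose B"
    "transpose (A - B) = transpose A - transpose B"
    "transpose (- A) = - transpose A"
    "transpose (c *\<^sub>R A) = c *\<^sub>R transpose A"
  by (simp_all add: transpose_def vec_eq_iff)

lemma trace_simps:
  fixes A B :: "real^'n^'n"
  shows "trace (A + B) = trace A + trace B"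
    "trace (A - B) = trace A - trace B"
    "trace (- A) = - trace A"
    "trace (c *\<^sub>R A) = c * trace A"
    "trace (transpose A) = trace A"
  by (simp_all add: trace_def sum.distrib sum_subtractf sum_negf sum_distrib_left transpose_def)

lemma trace_mult: "trace ((A :: real^'n^'m) ** B) = (\<Sum>i\<in>UNIV. \<Sum>j\<in>UNIV. A $ i $ j * B $ j $ i)"
  by (simp add: trace_def matrix_matrix_mult_def)

lemma mult_nth: "((A :: real^'n^'m) ** B) $ i $ j = (\<Sum>k\<in>UNIV. A $ i $ k * B $ k $ j)"
  by (simp add: matrix_matrix_mult_def)

lemma transpose_nth: "transpose A $ i $ j = A $ j $ i"
  by (simp add: transpose_def)

text \<open>
  The vectors \<open>e i\<close> play the role of the coordinate fields; they need not span \<open>'a\<close>, so that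
  \<open>W\<close> may have an additional time direction.
\<close>

locale levi_civita =
  fixes W :: "'a::real_normed_vector set"
    and e :: "'n::finite \<Rightarrow> 'a"
    and G :: "'a \<Rightarrow> real^'n^'n"
    and \<Gamma> :: "'n \<Rightarrow> 'a \<Rightarrow> real^'n^'n"
  assumes open_W: "open W"
    and smooth_G: "smooth_on W G"
    and smooth_\<Gamma>: "smooth_on W (\<Gamma> i)"
    and G_sym: "z \<in> W \<Longrightarrow> transpose (G z) = G z"
    and G_invertible: "z \<in> W \<Longrightarrow> invertible (G z)"
    and torsion_free: "z \<in> W \<Longrightarrow> \<Gamma> i z $ m $ k = \<Gamma> k z $ m $ i"
    and metric_compatible: "z \<in> W \<Longrightarrow> dd (e i) G z = transpose (\<Gamma> i z) ** G z + G z ** \<Gamma> i z"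
begin

definition gi :: "'a \<Rightarrow> real^'n^'n" where
  "gi z = matrix_inv (G z)"

definition F :: "'n \<Rightarrow> 'n \<Rightarrow> 'a \<Rightarrow> real^'n^'n" where
  "F i j z = dd (e i) (\<Gamma> j) z - dd (e j) (\<Gamma> i) z + \<Gamma> i z ** \<Gamma> j z - \<Gamma> j z ** \<Gamma> i z"

definition Ric :: "'a \<Rightarrow> real^'n^'n" where
  "Ric z = (\<chi> k l. \<Sum>m\<in>UNIV. F m k z $ m $ l)"

definition R :: "'a \<Rightarrow> real" where
  "R z = trace (gi z ** Ric z)"

text \<open>\<open>\<Gamma> k\<close> carries the upper index as row index, so the first slot of a
  covariant 2-tensor is corrected by its transpose from the left and the second slot by
  \<open>\<Gamma> k\<close> from the right.\<close>

definition cov :: "'n \<Rightarrow> ('a \<Rightarrow> real^'n^'n) \<Rightarrow> 'a \<Rightarrow> real^'n^'n" where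
  "cov k h z = dd (e k) h z - transpose (\<Gamma> k z) ** h z - h z ** \<Gamma> k z"

definition cov2 :: "'n \<Rightarrow> 'n \<Rightarrow> ('a \<Rightarrow> real^'n^'n) \<Rightarrow> 'a \<Rightarrow> real^'n^'n" where
  "cov2 k l h z = cov k (cov l h) z - (\<Sum>m\<in>UNIV. \<Gamma> k z $ m $ l *\<^sub>R cov m h z)"

definition hess :: "'n \<Rightarrow> 'n \<Rightarrow> ('a \<Rightarrow> real) \<Rightarrow> 'a \<Rightarrow> real" where
  "hess k l f z = dd (e k) (dd (e l) f) z - (\<Sum>m\<in>UNIV. \<Gamma> k z $ m $ l * dd (e m) f z)"

definition lap :: "('a \<Rightarrow> real) \<Rightarrow> 'a \<Rightarrow> real" where
  "lap f z = (\<Sum>k\<in>UNIV. \<Sum>l\<in>UNIV. gi z $ k $ l * hess k l f z)"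

definition lap_tensor :: "('a \<Rightarrow> real^'n^'n) \<Rightarrow> 'a \<Rightarrow> real^'n^'n" where
  "lap_tensor h z = (\<Sum>k\<in>UNIV. \<Sum>l\<in>UNIV. gi z $ k $ l *\<^sub>R cov2 k l h z)"

lemma smooth_gi: "smooth_on W gi"
  unfolding gi_def[abs_def] by (intro smooth_intros smooth_G G_invertible)

lemma smooth_F: "smooth_on W (F i j)"
  unfolding F_def[abs_def] by (intro smooth_intros smooth_\<Gamma> open_W)

lemma smooth_Ric: "smooth_on W Ric"
  by (rule smooth_on_matrix) (simp add: Ric_def smooth_on_sum smooth_on_vec_nth smooth_F)

lemma smooth_R: "smooth_on W R"
  unfolding R_def[abs_def] by (intro smooth_intros smooth_gi smooth_Ric)

lemma smooth_cov: "smooth_on W h \<Longrightarrow> smooth_on W (cov k h)"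
  unfolding cov_def[abs_def] by (intro smooth_intros smooth_\<Gamma> open_W)

lemma gi_inverse: "z \<in> W \<Longrightarrow> gi z ** G z = mat 1" "z \<in> W \<Longrightarrow> G z ** gi z = mat 1"
  by (simp_all add: gi_def matrix_inv_inverse G_invertible)

lemma gi_G_cancel: "z \<in> W \<Longrightarrow> A ** gi z ** G z = A" "z \<in> W \<Longrightarrow> A ** G z ** gi z = A"
  by (simp_all add: matrix_mul_assoc[symmetric] gi_inverse)

lemma gi_sym:
  assumes "z \<in> W"
  shows "transpose (gi z) = gi z"
proof -
  have "transpose (gi z) ** (G z ** gi z) = transpose (G z ** gi z) ** gi z"
    by (simp add: matrix_transpose_mul G_sym assms matrix_mul_assoc)
  then show ?thesis by (simp add: gi_inverse assms)
qed

lemma gi_sym_nth: "z \<in> W \<Longrightarrow> gi z $ i $ j = gi z $ j $ i"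
  using gi_sym[of z] by (metis transpose_nth)

lemma dd_gi:
  assumes z: "z \<in> W"
  shows "dd v gi z = - (gi z ** dd v G z ** gi z)"
proof -
  have "dd v (\<lambda>y. gi y ** G y) z = dd v (\<lambda>y. mat 1 :: real^'n^'n) z"
    by (intro dd_cong[OF open_W z]) (simp add: gi_inverse)
  then have "dd v gi z ** G z + gi z ** dd v G z = 0"
    by (simp add: dd_matrix_mult[OF smooth_gi smooth_G open_W z])
  then have "(dd v gi z ** G z + gi z ** dd v G z) ** gi z = 0"
    by (simp add: matrix_mult_simps)
  then show ?thesis
    by (simp add: matrix_mult_simps gi_G_cancel z eq_neg_iff_add_eq_0)
qed

lemma dd_gi_e:
  assumes z: "z \<in> W"
  shows "dd (e i) gi z = - (\<Gamma> i z ** gi z) - gi z ** transpose (\<Gamma> i z)"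
  by (simp add: dd_gi[OF z] metric_compatible[OF z] matrix_mult_simps gi_G_cancel gi_inverse z)

section \<open>Symmetries of the curvature and the second Bianchi identity\<close>

lemma F_antisym: "F i j z = - F j i z"
  by (simp add: F_def)

text \<open>Metric compatibility expresses the second derivatives of \<open>G\<close> through
  \<open>\<Gamma>\<close>. Mixed derivatives agree, and the difference of the two expressions is
  exactly the lowered curvature plus its transpose.\<close>

lemma G_F_skew:
  assumes z: "z \<in> W"
  shows "G z ** F i j z + transpose (F i j z) ** G z = 0"
proof -
  have D: "dd (e j) (dd (e i) G) z = transpose (dd (e j) (\<Gamma> i) z) ** G z
      + transpose (\<Gamma> i z) ** (transpose (\<Gamma> j z) ** G z + G z ** \<Gamma> j z)
      + (transpose (\<Gamma> j z) ** G z + G z ** \<Gamma> j z) ** \<Gamma> i z + G z ** dd (e j) (\<Gamma> i) z" for i j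
  proof -
    have "dd (e j) (dd (e i) G) z = dd (e j) (\<lambda>y. transpose (\<Gamma> i y) ** G y + G y ** \<Gamma> i y) z"
      by (intro dd_cong[OF open_W z] metric_compatible)
    also have "\<dots> = dd (e j) (\<lambda>y. transpose (\<Gamma> i y) ** G y) z + dd (e j) (\<lambda>y. G y ** \<Gamma> i y) z"
      by (intro dd_add[OF _ _ open_W z] smooth_intros smooth_\<Gamma> smooth_G)
    finally show ?thesis
      by (simp add: dd_matrix_mult[OF _ _ open_W z] smooth_intros smooth_\<Gamma> smooth_G
          dd_transpose[OF _ open_W z] metric_compatible[OF z])
  qed
  show ?thesis
    using dd_commute[OF smooth_G open_W z, of "e j" "e i"] unfolding D F_def
    by (simp add: matrix_mult_simps transpose_simps matrix_transpose_mul algebra_simps)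
qed

definition E :: "'n \<Rightarrow> 'n \<Rightarrow> 'a \<Rightarrow> real^'n^'n" where
  "E i j z = F i j z ** gi z"

lemma smooth_E: "smooth_on W (E i j)"
  unfolding E_def[abs_def] by (intro smooth_intros smooth_F smooth_gi)

lemma E_antisym: "E i j z = - E j i z"
  by (simp add: E_def F_antisym[of i j] matrix_mult_simps)

lemma E_skew:
  assumes z: "z \<in> W"
  shows "transpose (E i j z) = - E i j z"
proof -
  have "gi z ** (G z ** F i j z + transpose (F i j z) ** G z) ** gi z = 0"
    by (simp add: G_F_skew[OF z] matrix_mult_simps)
  then show ?thesis
    by (simp add: E_def matrix_transpose_mul gi_sym[OF z] matrix_mult_simps gi_inverse[OF z]
        gi_G_cancel[OF z] eq_neg_iff_add_eq_0 add.commute)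
qed

lemma E_skew_nth: "z \<in> W \<Longrightarrow> E i j z $ m $ l = - E i j z $ l $ m"
  using E_skew[of z i j] by (metis transpose_nth vector_uminus_component)

text \<open>\<open>F i j\<close> is the endomorphism \<open>R(e\<^sub>i, e\<^sub>j)\<close>, \<open>E i j\<close> its version with both matrix indices
  raised, and \<open>B k i j\<close> the covariant derivative of the latter, except for the Christoffel terms
  belonging to \<open>i, j\<close>; those cancel in the cyclic sum.\<close>

definition B :: "'n \<Rightarrow> 'n \<Rightarrow> 'n \<Rightarrow> 'a \<Rightarrow> real^'n^'n" where
  "B k i j z = dd (e k) (E i j) z + \<Gamma> k z ** E i j z + E i j z ** transpose (\<Gamma> k z)"

text \<open>The inverse metric is parallel, so raising the second matrix index commutes with the
  derivative, and \<open>B\<close> becomes a commutator expression in \<open>F\<close>.\<close>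

lemma B_alt:
  assumes z: "z \<in> W"
  shows "B k i j z = (dd (e k) (F i j) z + \<Gamma> k z ** F i j z - F i j z ** \<Gamma> k z) ** gi z"
proof -
  have "dd (e k) (E i j) z = dd (e k) (F i j) z ** gi z + F i j z ** dd (e k) gi z"
    unfolding E_def[abs_def] by (rule dd_matrix_mult[OF smooth_F smooth_gi open_W z])
  then show ?thesis
    by (simp add: B_def E_def dd_gi_e[OF z] matrix_mult_simps)
qed

lemma dd_F:
  assumes z: "z \<in> W"
  shows "dd v (F i j) z = dd v (dd (e i) (\<Gamma> j)) z - dd v (dd (e j) (\<Gamma> i)) z
    + (dd v (\<Gamma> i) z ** \<Gamma> j z + \<Gamma> i z ** dd v (\<Gamma> j) z)
    - (dd v (\<Gamma> j) z ** \<Gamma> i z + \<Gamma> j z ** dd v (\<Gamma> i) z)"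
  unfolding F_def[abs_def]
  by (simp add: dd_add[OF _ _ open_W z] dd_diff[OF _ _ open_W z] dd_matrix_mult[OF _ _ open_W z]
      smooth_intros smooth_\<Gamma> open_W)

text \<open>This is the Jacobi identity for the operators of differentiation plus multiplication by
  \<open>\<Gamma> i\<close>, whose commutators are the \<open>F i j\<close>. Second derivatives of
  \<open>\<Gamma>\<close> cancel by symmetry, the remaining terms algebraically.\<close>

lemma bianchi:
  assumes z: "z \<in> W"
  shows "B i j k z + B j k i z + B k i j z = 0"
proof -
  have "dd (e i) (dd (e j) (\<Gamma> k)) z = dd (e j) (dd (e i) (\<Gamma> k)) z" for i j k
    by (rule dd_commute[OF smooth_\<Gamma> open_W z])
  note c = this[of i j k] this[of j k i] this[of k i j]
  have eq: "(dd (e i) (F j k) z + \<Gamma> i z ** F j k z - F j k z ** \<Gamma> i z)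
      + (dd (e j) (F k i) z + \<Gamma> j z ** F k i z - F k i z ** \<Gamma> j z)
      + (dd (e k) (F i j) z + \<Gamma> k z ** F i j z - F i j z ** \<Gamma> k z) = 0"
    unfolding dd_F[OF z] c by (simp add: F_def matrix_mult_simps algebra_simps)
  show ?thesis
    using arg_cong[OF eq, of "\<lambda>X. X ** gi z"] by (simp add: B_alt[OF z] matrix_mult_simps)
qed

section \<open>Leibniz rules for metric traces and the Laplacian of the squared norm\<close>

lemma dd_gi_mult:
  assumes h: "smooth_on W h" and z: "z \<in> W"
  shows "dd (e k) (\<lambda>y. gi y ** h y) z = gi z ** cov k h z + gi z ** h z ** \<Gamma> k z - \<Gamma> k z ** gi z ** h z"
  by (simp add: dd_matrix_mult[OF smooth_gi h open_W z] dd_gi_e[OF z] cov_def matrix_mult_simps)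

text \<open>Differentiating the endomorphism \<open>gi y ** h y\<close> gives
  \<open>gi z ** cov k h z\<close> plus a commutator with \<open>\<Gamma> k z\<close>, and
  commutators have trace zero.\<close>

lemma dd_trace_gi:
  assumes h: "smooth_on W h" and z: "z \<in> W"
  shows "dd (e k) (\<lambda>y. trace (gi y ** h y)) z = trace (gi z ** cov k h z)"
proof -
  have "dd (e k) (\<lambda>y. trace (gi y ** h y)) z = trace (dd (e k) (\<lambda>y. gi y ** h y) z)"
    by (intro dd_trace[OF _ open_W z] smooth_intros smooth_gi h)
  also have "\<dots> = trace (gi z ** cov k h z)"
    using trace_mul_sym[of "gi z ** h z" "\<Gamma> k z"]
    by (simp add: dd_gi_mult[OF h z] trace_simps matrix_mul_assoc)
  finally show ?thesis .
qed

lemma dd_trace_gi2: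
  assumes p: "smooth_on W p" and q: "smooth_on W q" and z: "z \<in> W"
  shows "dd (e k) (\<lambda>y. trace (gi y ** p y ** gi y ** q y)) z
    = trace (gi z ** cov k p z ** gi z ** q z) + trace (gi z ** p z ** gi z ** cov k q z)"
proof -
  have "dd (e k) (\<lambda>y. trace (gi y ** p y ** gi y ** q y)) z
      = trace (dd (e k) (\<lambda>y. (gi y ** p y) ** (gi y ** q y)) z)"
    unfolding matrix_mul_assoc by (intro dd_trace[OF _ open_W z] smooth_intros smooth_gi p q)
  also have "dd (e k) (\<lambda>y. (gi y ** p y) ** (gi y ** q y)) z
      = dd (e k) (\<lambda>y. gi y ** p y) z ** (gi z ** q z) + (gi z ** p z) ** dd (e k) (\<lambda>y. gi y ** q y) z"
    by (intro dd_matrix_mult[OF _ _ open_W z] smooth_intros smooth_gi p q)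
  also have "trace \<dots> = trace (gi z ** cov k p z ** gi z ** q z) + trace (gi z ** p z ** gi z ** cov k q z)"
    using trace_mul_sym[of "gi z ** p z ** gi z ** q z" "\<Gamma> k z"]
    by (simp add: dd_gi_mult[OF p z] dd_gi_mult[OF q z] trace_simps matrix_mult_simps)
  finally show ?thesis .
qed

text \<open>Iterating the Leibniz rule yields \<open>cov k (cov l h)\<close>, which lacks the
  Christoffel correction of the derivative index \<open>l\<close>. The corrections contained in
  \<open>hess\<close> and in \<open>cov2\<close> are the same, so they match on both sides.\<close>

lemma hess_trace_gi2:
  assumes h: "smooth_on W h" and z: "z \<in> W"
  shows "hess k l (\<lambda>y. trace (gi y ** h y ** gi y ** h y)) z
    = 2 * trace (gi z ** cov2 k l h z ** gi z ** h z) + 2 * trace (gi z ** cov k h z ** gi z ** cov l h z)"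
proof -
  have sym: "trace (gi y ** p y ** gi y ** q y) = trace (gi y ** q y ** gi y ** p y)" for p q y
    using trace_mul_sym[of "gi y ** p y" "gi y ** q y"] by (simp add: matrix_mul_assoc)
  have D: "dd (e m) (\<lambda>y. trace (gi y ** h y ** gi y ** h y)) y = 2 * trace (gi y ** cov m h y ** gi y ** h y)"
    if "y \<in> W" for m y
    by (simp add: dd_trace_gi2[OF h h that] sym[where p = h and q = "cov m h"])
  have "dd (e k) (dd (e l) (\<lambda>y. trace (gi y ** h y ** gi y ** h y))) z
      = dd (e k) (\<lambda>y. 2 * trace (gi y ** cov l h y ** gi y ** h y)) z"
    by (intro dd_cong[OF open_W z] D)
  also have "\<dots> = 2 * (trace (gi z ** cov k (cov l h) z ** gi z ** h z)
      + trace (gi z ** cov l h z ** gi z ** cov k h z))"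
    by (simp add: dd_mult[OF _ _ open_W z] smooth_intros smooth_gi smooth_cov h dd_trace_gi2[OF _ _ z])
  finally have DD: "dd (e k) (dd (e l) (\<lambda>y. trace (gi y ** h y ** gi y ** h y))) z = \<dots>" .
  have "trace (gi z ** (\<Sum>m\<in>UNIV. \<Gamma> k z $ m $ l *\<^sub>R cov m h z) ** gi z ** h z)
      = (\<Sum>m\<in>UNIV. \<Gamma> k z $ m $ l * trace (gi z ** cov m h z ** gi z ** h z))"
  proof -
    define L where "L X = trace (gi z ** X ** gi z ** h z)" for X
    have L: "linear L"
      by (rule linearI) (simp_all add: L_def matrix_mult_simps trace_simps)
    show ?thesis
      unfolding L_def[symmetric] by (simp add: linear_sum[OF L] linear_scale[OF L])
  qed
  then show ?thesis
    unfolding hess_def DD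
    by (simp add: D[OF z] cov2_def matrix_mult_simps trace_simps sum_distrib_left sum_subtractf algebra_simps
        sym[where p = "cov l h" and q = "cov k h"])
qed

lemma lap_trace_gi2:
  assumes h: "smooth_on W h" and z: "z \<in> W"
  shows "lap (\<lambda>y. trace (gi y ** h y ** gi y ** h y)) z
    = 2 * trace (gi z ** lap_tensor h z ** gi z ** h z)
      + 2 * (\<Sum>k\<in>UNIV. \<Sum>l\<in>UNIV. gi z $ k $ l * trace (gi z ** cov k h z ** gi z ** cov l h z))"
proof -
  define L where "L X = trace (gi z ** X ** gi z ** h z)" for X
  have L: "linear L"
    by (rule linearI) (simp_all add: L_def matrix_mult_simps trace_simps)
  have tr: "trace (gi z ** lap_tensor h z ** gi z ** h z)
      = (\<Sum>k\<in>UNIV. \<Sum>l\<in>UNIV. gi z $ k $ l * trace (gi z ** cov2 k l h z ** gi z ** h z))"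
    unfolding L_def[symmetric] lap_tensor_def by (simp add: linear_sum[OF L] linear_scale[OF L])
  show ?thesis
    unfolding lap_def hess_trace_gi2[OF h z] tr sum_distrib_left sum.distrib[symmetric]
    by (intro sum.cong refl) (simp add: algebra_simps)
qed

end

section \<open>The Ricci tensor and the contracted second Bianchi identity\<close>

locale levi_civita_symmetric = levi_civita W e G \<Gamma>
  for W :: "'a::real_normed_vector set"
    and e :: "'n::finite \<Rightarrow> 'a"
    and G :: "'a \<Rightarrow> real^'n^'n"
    and \<Gamma> :: "'n \<Rightarrow> 'a \<Rightarrow> real^'n^'n" +
  assumes Ric_sym: "z \<in> W \<Longrightarrow> transpose (Ric z) = Ric z"
begin

definition \<rho> :: "'a \<Rightarrow> real^'n^'n" where
  "\<rho> z = gi z ** Ric z"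

lemma smooth_\<rho>: "smooth_on W \<rho>"
  unfolding \<rho>_def[abs_def] by (intro smooth_intros smooth_gi smooth_Ric)

text \<open>Symmetry of \<open>Ric\<close> allows the raised Ricci tensor to be read as a
  contraction of \<open>E\<close>. The two antisymmetries of \<open>E\<close> then give the second
  contraction \<open>\<rho>_nth'\<close>; the contracted Bianchi identity involves both.\<close>

lemma \<rho>_nth:
  assumes z: "z \<in> W"
  shows "\<rho> z $ l $ k = (\<Sum>m\<in>UNIV. E m k z $ m $ l)"
proof -
  have "\<rho> z $ l $ k = (\<Sum>p\<in>UNIV. \<Sum>m\<in>UNIV. F m k z $ m $ p * gi z $ p $ l)"
  proof -
    have "Ric z $ p $ k = Ric z $ k $ p" for p
      using Ric_sym[OF z] by (metis transpose_nth)
    then show ?thesis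
      by (simp add: \<rho>_def mult_nth gi_sym_nth[OF z, of l] Ric_def sum_distrib_left mult.commute)
  qed
  also have "\<dots> = (\<Sum>m\<in>UNIV. E m k z $ m $ l)"
    by (subst sum.swap) (simp add: E_def mult_nth)
  finally show ?thesis .
qed

lemma \<rho>_nth':
  assumes z: "z \<in> W"
  shows "\<rho> z $ m $ k = (\<Sum>l\<in>UNIV. E k l z $ m $ l)"
proof -
  have "E k l z $ m $ l = E l k z $ l $ m" for l
    using E_skew_nth[OF z, of k l m l] E_antisym[of k l z] by simp
  then show ?thesis by (simp add: \<rho>_nth[OF z])
qed

lemma R_eq: "R z = trace (\<rho> z)"
  by (simp add: R_def \<rho>_def)

text \<open>The second Bianchi identity \<open>B m l k + B l k m + B k m l = 0\<close>, contracted over both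
  upper indices \<open>m\<close> and \<open>l\<close>.\<close>

lemma divergence_\<rho>:
  assumes z: "z \<in> W"
  shows "(\<Sum>m\<in>UNIV. dd (e m) \<rho> z $ m $ k + (\<Gamma> m z ** \<rho> z) $ m $ k)
    = dd (e k) R z / 2 + trace (\<Gamma> k z ** \<rho> z)"
proof -
  define T where "T = (\<Sum>m\<in>UNIV. \<Sum>l\<in>UNIV. B m l k z $ m $ l)"
  \<comment> \<open>Swapping \<open>k\<close> with \<open>m\<close> and transposing the matrix each
    cost a sign, so two of the three cyclic terms have the same contraction
    \<open>T\<close>.\<close>
  have Bsym: "B l k m z $ m $ l = B l m k z $ l $ m" for l m
  proof -
    have "B l k m z = transpose (B l m k z)"
    proof -
      have "E k m = (\<lambda>y. - E m k y)" by (rule ext) (rule E_antisym)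
      then have "dd (e l) (E k m) z = - dd (e l) (E m k) z"
        by (simp add: dd_uminus[OF smooth_E open_W z])
      moreover have "transpose (dd (e l) (E m k) z) = - dd (e l) (E m k) z"
      proof -
        have "transpose (dd (e l) (E m k) z) = dd (e l) (\<lambda>y. transpose (E m k y)) z"
          by (rule dd_transpose[OF smooth_E open_W z, symmetric])
        also have "\<dots> = dd (e l) (\<lambda>y. - E m k y) z"
          by (intro dd_cong[OF open_W z] E_skew)
        finally show ?thesis by (simp add: dd_uminus[OF smooth_E open_W z])
      qed
      ultimately show ?thesis
        by (simp add: B_def E_antisym[of k m z] transpose_simps matrix_transpose_mul E_skew[OF z]
            matrix_mult_simps)
    qed
    then show ?thesis by (simp add: transpose_nth)
  qed
  have "0 = (\<Sum>m\<in>UNIV. \<Sum>l\<in>UNIV. (B m l k z + B l k m z + B k m l z) $ m $ l)"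
    by (simp add: bianchi[OF z])
  also have "\<dots> = T + (\<Sum>m\<in>UNIV. \<Sum>l\<in>UNIV. B l m k z $ l $ m) + (\<Sum>m\<in>UNIV. \<Sum>l\<in>UNIV. B k m l z $ m $ l)"
    by (simp add: sum.distrib T_def Bsym)
  also have "(\<Sum>m\<in>UNIV. \<Sum>l\<in>UNIV. B l m k z $ l $ m) = T"
    unfolding T_def by (rule sum.swap)
  finally have 1: "2 * T + (\<Sum>m\<in>UNIV. \<Sum>l\<in>UNIV. B k m l z $ m $ l) = 0" by simp
  have dd\<rho>: "dd v \<rho> z $ l $ k = (\<Sum>m\<in>UNIV. dd v (E m k) z $ m $ l)" for v l k
  proof -
    have "dd v \<rho> z $ l $ k = dd v (\<lambda>y. \<rho> y $ l $ k) z"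
      by (simp add: dd_vec_nth[OF _ open_W z] smooth_intros smooth_\<rho>)
    also have "\<dots> = dd v (\<lambda>y. \<Sum>m\<in>UNIV. E m k y $ m $ l) z"
      by (intro dd_cong[OF open_W z] \<rho>_nth)
    also have "\<dots> = (\<Sum>m\<in>UNIV. dd v (E m k) z $ m $ l)"
      by (simp add: dd_sum[OF _ open_W z] dd_vec_nth[OF _ open_W z] smooth_intros smooth_E)
    finally show ?thesis .
  qed
  have ddE: "dd v (E i j) z $ m $ l = - dd v (E i j) z $ l $ m" for v i j m l
  proof -
    have "dd v (E i j) z $ m $ l = dd v (\<lambda>y. E i j y $ m $ l) z"
      by (simp add: dd_vec_nth[OF _ open_W z] smooth_intros smooth_E)
    also have "\<dots> = dd v (\<lambda>y. - E i j y $ l $ m) z"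
      by (intro dd_cong[OF open_W z] E_skew_nth)
    finally show ?thesis
      by (simp add: dd_vec_nth[OF _ open_W z] dd_uminus[OF _ open_W z] smooth_intros smooth_E)
  qed
  have ddR: "dd v R z = trace (dd v \<rho> z)" for v
    unfolding R_eq[abs_def] by (rule dd_trace[OF smooth_\<rho> open_W z])
  have a1: "(\<Sum>m\<in>UNIV. \<Sum>l\<in>UNIV. dd (e k) (E m l) z $ m $ l) = dd (e k) R z"
    unfolding ddR trace_def dd\<rho> by (rule sum.swap)
  have a2: "(\<Sum>m\<in>UNIV. \<Sum>l\<in>UNIV. (\<Gamma> k z ** E m l z) $ m $ l) = trace (\<Gamma> k z ** \<rho> z)"
  proof -
    have "(\<Sum>l\<in>UNIV. (\<Gamma> k z ** E m l z) $ m $ l) = (\<Gamma> k z ** \<rho> z) $ m $ m" for m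
      unfolding mult_nth \<rho>_nth'[OF z] sum_distrib_left by (rule sum.swap)
    then show ?thesis by (simp add: trace_def)
  qed
  have a3: "(\<Sum>m\<in>UNIV. \<Sum>l\<in>UNIV. (E m l z ** transpose (\<Gamma> k z)) $ m $ l) = trace (\<Gamma> k z ** \<rho> z)"
  proof -
    have "(\<Sum>m\<in>UNIV. (E m l z ** transpose (\<Gamma> k z)) $ m $ l) = (\<Gamma> k z ** \<rho> z) $ l $ l" for l
      unfolding mult_nth \<rho>_nth[OF z] sum_distrib_left transpose_nth mult.commute[of "E _ _ z $ _ $ _"]
      by (rule sum.swap)
    then show ?thesis by (subst sum.swap) (simp add: trace_def)
  qed
  have 2: "(\<Sum>m\<in>UNIV. \<Sum>l\<in>UNIV. B k m l z $ m $ l) = dd (e k) R z + 2 * trace (\<Gamma> k z ** \<rho> z)"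
    by (simp add: B_def sum.distrib a1 a2 a3)
  have b1: "(\<Sum>l\<in>UNIV. dd (e m) (E l k) z $ m $ l) = - dd (e m) \<rho> z $ m $ k" for m
    unfolding dd\<rho> by (subst ddE) (simp add: sum_negf)
  have b2: "(\<Sum>l\<in>UNIV. (\<Gamma> m z ** E l k z) $ m $ l) = - (\<Gamma> m z ** \<rho> z) $ m $ k" for m
  proof -
    have "(\<Sum>l\<in>UNIV. (\<Gamma> m z ** E l k z) $ m $ l) = (\<Sum>p\<in>UNIV. \<Sum>l\<in>UNIV. \<Gamma> m z $ m $ p * E l k z $ p $ l)"
      unfolding mult_nth by (rule sum.swap)
    also have "\<dots> = (\<Sum>p\<in>UNIV. \<Gamma> m z $ m $ p * - \<rho> z $ p $ k)"
    proof -
      have "E l k z $ p $ l = - E l k z $ l $ p" for p l by (rule E_skew_nth[OF z])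
      then show ?thesis by (simp only: \<rho>_nth[OF z] sum_negf[symmetric] sum_distrib_left)
    qed
    finally show ?thesis by (simp add: mult_nth sum_negf)
  qed
  \<comment> \<open>\<open>\<Gamma> m z $ l $ p\<close> is symmetric in \<open>m\<close>,
    \<open>p\<close> because there is no torsion, while \<open>E l k\<close> is antisymmetric in its
    matrix indices.\<close>
  have b3: "(\<Sum>m\<in>UNIV. (E l k z ** transpose (\<Gamma> m z)) $ m $ l) = 0" for l
  proof -
    let ?s = "\<Sum>m\<in>UNIV. \<Sum>p\<in>UNIV. E l k z $ m $ p * \<Gamma> m z $ l $ p"
    have "?s = (\<Sum>m\<in>UNIV. \<Sum>p\<in>UNIV. E l k z $ p $ m * \<Gamma> p z $ l $ m)"
      by (rule sum.swap)
    also have "\<dots> = (\<Sum>m\<in>UNIV. \<Sum>p\<in>UNIV. - (E l k z $ m $ p * \<Gamma> m z $ l $ p))"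
    proof (intro sum.cong refl)
      fix m p
      show "E l k z $ p $ m * \<Gamma> p z $ l $ m = - (E l k z $ m $ p * \<Gamma> m z $ l $ p)"
        using E_skew_nth[OF z, of l k p m] torsion_free[OF z, of p l m] by simp
    qed
    finally have "?s = - ?s" by (simp add: sum_negf)
    then show ?thesis by (simp add: mult_nth transpose_nth)
  qed
  have "T = (\<Sum>m\<in>UNIV. - dd (e m) \<rho> z $ m $ k - (\<Gamma> m z ** \<rho> z) $ m $ k)
      + (\<Sum>m\<in>UNIV. \<Sum>l\<in>UNIV. (E l k z ** transpose (\<Gamma> m z)) $ m $ l)"
    by (simp add: T_def B_def sum.distrib b1 b2 sum_negf sum_subtractf)
  also have "(\<Sum>m\<in>UNIV. \<Sum>l\<in>UNIV. (E l k z ** transpose (\<Gamma> m z)) $ m $ l) = 0"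
    by (subst sum.swap) (simp add: b3)
  finally have "T = - (\<Sum>m\<in>UNIV. dd (e m) \<rho> z $ m $ k + (\<Gamma> m z ** \<rho> z) $ m $ k)"
    by (simp add: sum.distrib sum_negf sum_subtractf)
  then show ?thesis using 1 2 by simp
qed

text \<open>Passing from the derivative of \<open>\<rho>\<close> to the covariant derivative adds
  the products \<open>\<rho> z ** \<Gamma> k z\<close>. Without torsion their contraction is the
  trace term left over in \<open>divergence_\<rho>\<close>, and the two cancel.\<close>

lemma contracted_bianchi:
  assumes z: "z \<in> W"
  shows "(\<Sum>k\<in>UNIV. (gi z ** cov k Ric z) $ k $ p) = dd (e p) R z / 2"
proof -
  have "gi z ** cov k Ric z = dd (e k) \<rho> z + \<Gamma> k z ** \<rho> z - \<rho> z ** \<Gamma> k z" for k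
    using dd_gi_mult[OF smooth_Ric z, of k] by (simp add: \<rho>_def[abs_def] matrix_mul_assoc)
  moreover have "(\<Sum>k\<in>UNIV. (\<rho> z ** \<Gamma> k z) $ k $ p) = trace (\<Gamma> p z ** \<rho> z)"
    by (subst trace_mul_sym) (simp add: trace_def mult_nth torsion_free[OF z, of p])
  ultimately show ?thesis
    using divergence_\<rho>[OF z, of p] by (simp add: sum_subtractf)
qed

lemma cov_Ric_sym: "z \<in> W \<Longrightarrow> transpose (cov k Ric z) = cov k Ric z"
proof -
  assume z: "z \<in> W"
  have "transpose (dd (e k) Ric z) = dd (e k) (\<lambda>y. transpose (Ric y)) z"
    by (rule dd_transpose[OF smooth_Ric open_W z, symmetric])
  also have "\<dots> = dd (e k) Ric z"
    by (intro dd_cong[OF open_W z] Ric_sym)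
  finally show "transpose (cov k Ric z) = cov k Ric z"
    by (simp add: cov_def transpose_simps matrix_transpose_mul Ric_sym[OF z])
qed

lemma trace_cov_Ric: "z \<in> W \<Longrightarrow> trace (gi z ** cov l Ric z) = dd (e l) R z"
  unfolding R_def[abs_def] by (rule dd_trace_gi[OF smooth_Ric, symmetric])

end

section \<open>Variation of the connection and evolution of the scalar curvature\<close>

locale ricci_flow = levi_civita_symmetric W e G \<Gamma>
  for W :: "'a::real_normed_vector set"
    and e :: "'n::finite \<Rightarrow> 'a"
    and G :: "'a \<Rightarrow> real^'n^'n"
    and \<Gamma> :: "'n \<Rightarrow> 'a \<Rightarrow> real^'n^'n" +
  fixes \<tau> :: 'a
  assumes flow: "z \<in> W \<Longrightarrow> dd \<tau> G z = - (2 *\<^sub>R Ric z)"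
begin

text \<open>Unlike the Christoffel symbols themselves, their time derivative is a tensor; this is
  why it can be expressed through covariant derivatives of \<open>Ric\<close>.\<close>

definition A :: "'n \<Rightarrow> 'a \<Rightarrow> real^'n^'n" where
  "A i z = dd \<tau> (\<Gamma> i) z"

lemma smooth_A: "smooth_on W (A i)"
  unfolding A_def[abs_def] by (intro smooth_intros smooth_\<Gamma> open_W)

lemma dd_gi_\<tau>: "z \<in> W \<Longrightarrow> dd \<tau> gi z = 2 *\<^sub>R (gi z ** Ric z ** gi z)"
  by (simp add: dd_gi flow matrix_mult_simps)

lemma A_torsion_free:
  assumes z: "z \<in> W"
  shows "A i z $ m $ k = A k z $ m $ i"
proof -
  have "A i z $ m $ k = dd \<tau> (\<lambda>y. \<Gamma> i y $ m $ k) z" for i k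
    by (simp add: A_def dd_vec_nth[OF _ open_W z] smooth_intros smooth_\<Gamma>)
  moreover have "dd \<tau> (\<lambda>y. \<Gamma> i y $ m $ k) z = dd \<tau> (\<lambda>y. \<Gamma> k y $ m $ i) z"
    by (intro dd_cong[OF open_W z] torsion_free)
  ultimately show ?thesis by simp
qed

text \<open>The mixed derivative of \<open>G\<close> along \<open>\<tau>\<close> and
  \<open>e i\<close> is computed in both orders, once by metric compatibility and once by the flow
  equation.\<close>

lemma A_cov:
  assumes z: "z \<in> W"
  shows "G z ** A i z + transpose (G z ** A i z) = - (2 *\<^sub>R cov i Ric z)"
proof -
  have "dd \<tau> (dd (e i) G) z = dd \<tau> (\<lambda>y. transpose (\<Gamma> i y) ** G y + G y ** \<Gamma> i y) z"
    by (intro dd_cong[OF open_W z] metric_compatible)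
  also have "\<dots> = dd \<tau> (\<lambda>y. transpose (\<Gamma> i y) ** G y) z + dd \<tau> (\<lambda>y. G y ** \<Gamma> i y) z"
    by (intro dd_add[OF _ _ open_W z] smooth_intros smooth_\<Gamma> smooth_G)
  also have "\<dots> = transpose (A i z) ** G z - 2 *\<^sub>R (transpose (\<Gamma> i z) ** Ric z)
      - 2 *\<^sub>R (Ric z ** \<Gamma> i z) + G z ** A i z"
    by (simp add: dd_matrix_mult[OF _ _ open_W z] smooth_intros smooth_\<Gamma> smooth_G
        dd_transpose[OF _ open_W z] flow[OF z] A_def matrix_mult_simps)
  finally have 1: "dd \<tau> (dd (e i) G) z = \<dots>" .
  have "dd (e i) (dd \<tau> G) z = dd (e i) (\<lambda>y. (-2) *\<^sub>R Ric y) z"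
    by (intro dd_cong[OF open_W z]) (simp add: flow)
  also have "\<dots> = (-2) *\<^sub>R dd (e i) Ric z"
    by (rule dd_linear[OF bounded_linear_scaleR_right smooth_Ric open_W z])
  finally show ?thesis
    using 1 dd_commute[OF smooth_G open_W z, of \<tau> "e i"]
    by (simp add: cov_def matrix_transpose_mul G_sym[OF z] algebra_simps)
qed

text \<open>The argument of the Koszul formula: \<open>A_cov\<close> fixes the part of the lowered
  \<open>A\<close> symmetric in \<open>l\<close>, \<open>j\<close>, absence of torsion gives
  symmetry in \<open>i\<close>, \<open>j\<close>, and an alternating sum over three permutations
  isolates one component.\<close>

lemma A_lower:
  assumes z: "z \<in> W"
  shows "(G z ** A i z) $ l $ j = - (cov i Ric z $ l $ j + cov j Ric z $ l $ i - cov l Ric z $ i $ j)"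
proof -
  have 1: "(G z ** A i z) $ a $ b + (G z ** A i z) $ b $ a = - 2 * cov i Ric z $ a $ b" for i a b
    using arg_cong[OF A_cov[OF z, of i], of "\<lambda>X. X $ a $ b"] by (simp add: transpose_nth)
  have 2: "(G z ** A i z) $ a $ b = (G z ** A b z) $ a $ i" for i a b
    unfolding mult_nth by (simp add: A_torsion_free[OF z, of i])
  show ?thesis
    using 1[of i l j] 1[of j l i] 1[of l i j] 2[of i l j] 2[of i j l] 2[of j i l] by linarith
qed

text \<open>The trace of the Christoffel symbols is the logarithmic derivative of the volume
  density, which decays at rate R. In the computation, only the symmetric part of
  \<open>G z ** A l z\<close> survives the trace against the symmetric \<open>gi z\<close>, and
  \<open>A_cov\<close> determines that part.\<close>

lemma A_trace:
  assumes z: "z \<in> W"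
  shows "(\<Sum>m\<in>UNIV. A m z $ m $ l) = - dd (e l) R z"
proof -
  have "(\<Sum>m\<in>UNIV. A m z $ m $ l) = trace (A l z)"
    by (simp add: trace_def A_torsion_free[OF z, of l])
  also have "A l z = gi z ** (G z ** A l z)"
    by (simp add: matrix_mul_assoc gi_inverse z)
  also have "trace \<dots> = trace (gi z ** (G z ** A l z + transpose (G z ** A l z))) / 2"
  proof -
    have "trace (gi z ** transpose (G z ** A l z)) = trace (transpose (gi z ** transpose (G z ** A l z)))"
      by (simp add: trace_simps)
    also have "\<dots> = trace (gi z ** (G z ** A l z))"
      by (simp add: matrix_transpose_mul gi_sym z G_sym trace_mul_sym[of "gi z"])
    finally show ?thesis by (simp add: matrix_mult_simps trace_simps)
  qed
  also have "\<dots> = - dd (e l) R z"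
    by (simp only: A_cov[OF z]) (simp add: matrix_mult_simps trace_simps trace_cov_Ric[OF z])
  finally show ?thesis .
qed

text \<open>After lowering the free index, the contraction of \<open>A_lower\<close> is dR minus
  twice the divergence of \<open>Ric\<close>, which is zero by the contracted Bianchi
  identity.\<close>

lemma A_harmonic:
  assumes z: "z \<in> W"
  shows "(\<Sum>k\<in>UNIV. (A k z ** gi z) $ m $ k) = 0"
proof -
  have lower: "(\<Sum>k\<in>UNIV. (G z ** A k z ** gi z) $ p $ k) = 0" for p
  proof -
    have c: "(\<Sum>k\<in>UNIV. \<Sum>j\<in>UNIV. gi z $ k $ j * cov k Ric z $ j $ p) = dd (e p) R z / 2"
      using contracted_bianchi[OF z, of p] by (simp add: mult_nth)
    have sym: "cov k Ric z $ i $ j = cov k Ric z $ j $ i" for k i j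
      using cov_Ric_sym[OF z] by (metis transpose_nth)
    have "(\<Sum>k\<in>UNIV. (G z ** A k z ** gi z) $ p $ k)
        = (\<Sum>k\<in>UNIV. \<Sum>j\<in>UNIV. - (gi z $ k $ j * cov k Ric z $ j $ p)
            - gi z $ j $ k * cov j Ric z $ k $ p + gi z $ k $ j * cov p Ric z $ j $ k)"
      unfolding mult_nth[of "G z ** A _ z"] A_lower[OF z]
    proof (intro sum.cong refl)
      fix k j
      show "- (cov k Ric z $ p $ j + cov j Ric z $ p $ k - cov p Ric z $ k $ j) * gi z $ j $ k
          = - (gi z $ k $ j * cov k Ric z $ j $ p)
            - gi z $ j $ k * cov j Ric z $ k $ p + gi z $ k $ j * cov p Ric z $ j $ k"
        unfolding sym[of k p j] sym[of j p k] sym[of p k j] gi_sym_nth[OF z, of j k]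
        by (simp add: algebra_simps)
    qed
    also have "\<dots> = - (dd (e p) R z / 2) - (\<Sum>k\<in>UNIV. \<Sum>j\<in>UNIV. gi z $ j $ k * cov j Ric z $ k $ p)
        + dd (e p) R z"
      using trace_cov_Ric[OF z, of p]
      by (simp add: sum.distrib sum_subtractf sum_negf c trace_mult)
    also have "(\<Sum>k\<in>UNIV. \<Sum>j\<in>UNIV. gi z $ j $ k * cov j Ric z $ k $ p) = dd (e p) R z / 2"
      by (subst sum.swap) (rule c)
    finally show ?thesis by simp
  qed
  have "A k z ** gi z = gi z ** (G z ** A k z ** gi z)" for k
    by (simp add: matrix_mul_assoc gi_inverse z)
  then have "(A k z ** gi z) $ m $ k = (\<Sum>p\<in>UNIV. gi z $ m $ p * (G z ** A k z ** gi z) $ p $ k)" for k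
    unfolding mult_nth[of "gi z", symmetric] by (rule arg_cong)
  then have "(\<Sum>k\<in>UNIV. (A k z ** gi z) $ m $ k)
      = (\<Sum>k\<in>UNIV. \<Sum>p\<in>UNIV. gi z $ m $ p * (G z ** A k z ** gi z) $ p $ k)"
    by simp
  also have "\<dots> = (\<Sum>p\<in>UNIV. gi z $ m $ p * (\<Sum>k\<in>UNIV. (G z ** A k z ** gi z) $ p $ k))"
    unfolding sum_distrib_left by (rule sum.swap)
  finally show ?thesis by (simp add: lower)
qed

lemma dd_F_\<tau>:
  assumes z: "z \<in> W"
  shows "dd \<tau> (F i j) z = dd (e i) (A j) z - dd (e j) (A i) z
    + A i z ** \<Gamma> j z + \<Gamma> i z ** A j z - A j z ** \<Gamma> i z - \<Gamma> j z ** A i z"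
  using dd_commute[OF smooth_\<Gamma> open_W z, of \<tau> "e i" j] dd_commute[OF smooth_\<Gamma> open_W z, of \<tau> "e j" i]
  by (simp add: dd_F[OF z] A_def[abs_def] algebra_simps)

text \<open>The derivative of \<open>A_harmonic\<close>, with the Christoffel terms from
  differentiating \<open>gi\<close> arranged in the shape in which they occur in the time derivative
  of the curvature.\<close>

lemma dd_A_harmonic:
  assumes z: "z \<in> W"
  shows "(\<Sum>m\<in>UNIV. \<Sum>k\<in>UNIV. ((dd (e m) (A k) z - A k z ** \<Gamma> m z) ** gi z) $ m $ k)
    = (\<Sum>m\<in>UNIV. \<Sum>k\<in>UNIV. (A k z ** gi z ** transpose (\<Gamma> m z)) $ m $ k)"
proof -
  have "(\<Sum>k\<in>UNIV. ((dd (e m) (A k) z - A k z ** \<Gamma> m z) ** gi z) $ m $ k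
      - (A k z ** gi z ** transpose (\<Gamma> m z)) $ m $ k) = 0" for m
  proof -
    have "dd (e m) (\<lambda>y. \<Sum>k\<in>UNIV. (A k y ** gi y) $ m $ k) z = dd (e m) (\<lambda>y. 0) z"
      by (intro dd_cong[OF open_W z] A_harmonic)
    then have "0 = dd (e m) (\<lambda>y. \<Sum>k\<in>UNIV. (A k y ** gi y) $ m $ k) z"
      by simp
    also have "\<dots> = (\<Sum>k\<in>UNIV. dd (e m) (\<lambda>y. A k y ** gi y) z $ m $ k)"
      by (simp add: dd_sum[OF _ open_W z] dd_vec_nth[OF _ open_W z] smooth_intros smooth_A smooth_gi)
    also have "\<dots> = (\<Sum>k\<in>UNIV. ((dd (e m) (A k) z - A k z ** \<Gamma> m z) ** gi z) $ m $ k
      - (A k z ** gi z ** transpose (\<Gamma> m z)) $ m $ k)"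
      by (simp add: dd_matrix_mult[OF smooth_A smooth_gi open_W z] dd_gi_e[OF z] matrix_mult_simps
          algebra_simps)
    finally show ?thesis by simp
  qed
  then show ?thesis by (simp add: sum_subtractf)
qed

text \<open>This is the trace of Palatini's identity, by which the time derivative of
  \<open>Ric\<close> is the divergence of \<open>A\<close> minus the covariant derivative of its
  trace. The divergence drops out by \<open>A_harmonic\<close>, and \<open>A_trace\<close> turns the
  other term into the Laplacian of R.\<close>

lemma trace_dd_Ric_\<tau>:
  assumes z: "z \<in> W"
  shows "trace (gi z ** dd \<tau> Ric z) = lap R z"
proof -
  have ddRic: "dd \<tau> Ric z $ k $ l = (\<Sum>m\<in>UNIV. dd \<tau> (F m k) z $ m $ l)" for k l
  proof -
    have "dd \<tau> Ric z $ k $ l = dd \<tau> (\<lambda>y. \<Sum>m\<in>UNIV. F m k y $ m $ l) z"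
      by (simp add: dd_vec_nth[OF _ open_W z, symmetric] smooth_intros smooth_Ric) (simp add: Ric_def)
    then show ?thesis
      by (simp add: dd_sum[OF _ open_W z] dd_vec_nth[OF _ open_W z] smooth_intros smooth_F)
  qed
  have "trace (gi z ** dd \<tau> Ric z) = (\<Sum>k\<in>UNIV. \<Sum>l\<in>UNIV. \<Sum>m\<in>UNIV. dd \<tau> (F m k) z $ m $ l * gi z $ l $ k)"
    by (subst trace_mul_sym) (simp add: trace_mult ddRic sum_distrib_right)
  also have "\<dots> = (\<Sum>k\<in>UNIV. \<Sum>m\<in>UNIV. (dd \<tau> (F m k) z ** gi z) $ m $ k)"
    unfolding mult_nth by (intro sum.cong refl sum.swap)
  also have "\<dots> = (\<Sum>m\<in>UNIV. \<Sum>k\<in>UNIV. (dd \<tau> (F m k) z ** gi z) $ m $ k)"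
    by (rule sum.swap)
  \<comment> \<open>Of these five sums the second vanishes, the first cancels the last, and the
    third and fourth form the second-order and the Christoffel part of
    \<open>lap R z\<close>.\<close>
  also have "\<dots> = (\<Sum>m\<in>UNIV. \<Sum>k\<in>UNIV. ((dd (e m) (A k) z - A k z ** \<Gamma> m z) ** gi z) $ m $ k)
      + (\<Sum>m\<in>UNIV. \<Sum>k\<in>UNIV. (\<Gamma> m z ** A k z ** gi z) $ m $ k)
      - (\<Sum>m\<in>UNIV. \<Sum>k\<in>UNIV. (dd (e k) (A m) z ** gi z) $ m $ k)
      + (\<Sum>m\<in>UNIV. \<Sum>k\<in>UNIV. (A m z ** \<Gamma> k z ** gi z) $ m $ k)
      - (\<Sum>m\<in>UNIV. \<Sum>k\<in>UNIV. (\<Gamma> k z ** A m z ** gi z) $ m $ k)"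
    by (simp add: dd_F_\<tau>[OF z] matrix_mult_simps sum.distrib sum_subtractf)
  also have "(\<Sum>m\<in>UNIV. \<Sum>k\<in>UNIV. (\<Gamma> m z ** A k z ** gi z) $ m $ k) = 0"
  proof -
    have "(\<Sum>k\<in>UNIV. (\<Gamma> m z ** (A k z ** gi z)) $ m $ k) = 0" for m
    proof -
      have "(\<Sum>k\<in>UNIV. (\<Gamma> m z ** (A k z ** gi z)) $ m $ k)
          = (\<Sum>p\<in>UNIV. \<Gamma> m z $ m $ p * (\<Sum>k\<in>UNIV. (A k z ** gi z) $ p $ k))"
        unfolding mult_nth[of "\<Gamma> m z"] sum_distrib_left by (rule sum.swap)
      then show ?thesis by (simp add: A_harmonic[OF z])
    qed
    then show ?thesis by (simp add: matrix_mul_assoc)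
  qed
  also have "(\<Sum>m\<in>UNIV. \<Sum>k\<in>UNIV. (\<Gamma> k z ** A m z ** gi z) $ m $ k)
      = (\<Sum>m\<in>UNIV. \<Sum>k\<in>UNIV. (A k z ** gi z ** transpose (\<Gamma> m z)) $ m $ k)"
  proof -
    have "(\<Sum>k\<in>UNIV. (\<Gamma> k z ** (A m z ** gi z)) $ m $ k)
        = (\<Sum>p\<in>UNIV. \<Sum>k\<in>UNIV. (A m z ** gi z) $ p $ k * \<Gamma> p z $ m $ k)" for m
      unfolding mult_nth[of "\<Gamma> _ z"]
    proof (subst sum.swap, intro sum.cong refl)
      fix p k
      show "\<Gamma> k z $ m $ p * (A m z ** gi z) $ p $ k = (A m z ** gi z) $ p $ k * \<Gamma> p z $ m $ k"
        using torsion_free[OF z, of k m p] by simp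
    qed
    then have "(\<Sum>m\<in>UNIV. \<Sum>k\<in>UNIV. (\<Gamma> k z ** (A m z ** gi z)) $ m $ k)
        = (\<Sum>m\<in>UNIV. \<Sum>p\<in>UNIV. \<Sum>k\<in>UNIV. (A m z ** gi z) $ p $ k * \<Gamma> p z $ m $ k)"
      by simp
    also have "\<dots> = (\<Sum>p\<in>UNIV. \<Sum>m\<in>UNIV. (A m z ** gi z ** transpose (\<Gamma> p z)) $ p $ m)"
      by (subst sum.swap) (simp add: mult_nth[of _ "transpose _"] transpose_nth)
    finally show ?thesis
      by (simp add: matrix_mul_assoc)
  qed
  also have "(\<Sum>m\<in>UNIV. \<Sum>k\<in>UNIV. (dd (e k) (A m) z ** gi z) $ m $ k)
      = - (\<Sum>k\<in>UNIV. \<Sum>l\<in>UNIV. gi z $ k $ l * dd (e k) (dd (e l) R) z)"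
  proof -
    have "(\<Sum>m\<in>UNIV. dd v (A m) z $ m $ l) = - dd v (dd (e l) R) z" for v l
    proof -
      have "(\<Sum>m\<in>UNIV. dd v (A m) z $ m $ l) = dd v (\<lambda>y. \<Sum>m\<in>UNIV. A m y $ m $ l) z"
        by (simp add: dd_sum[OF _ open_W z] dd_vec_nth[OF _ open_W z] smooth_intros smooth_A)
      also have "\<dots> = dd v (\<lambda>y. - dd (e l) R y) z"
        by (intro dd_cong[OF open_W z] A_trace)
      finally show ?thesis
        by (simp add: dd_uminus[OF _ open_W z] smooth_intros smooth_R open_W)
    qed
    note t = this
    have "(\<Sum>m\<in>UNIV. (dd (e k) (A m) z ** gi z) $ m $ k) = (\<Sum>l\<in>UNIV. - (gi z $ k $ l * dd (e k) (dd (e l) R) z))" for k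
    proof -
      have "(\<Sum>m\<in>UNIV. (dd (e k) (A m) z ** gi z) $ m $ k)
          = (\<Sum>l\<in>UNIV. (\<Sum>m\<in>UNIV. dd (e k) (A m) z $ m $ l) * gi z $ l $ k)"
        unfolding mult_nth sum_distrib_right by (rule sum.swap)
      then show ?thesis by (simp add: t gi_sym_nth[OF z, of k] mult.commute)
    qed
    then show ?thesis by (subst sum.swap) (simp add: sum_negf)
  qed
  also have "(\<Sum>m\<in>UNIV. \<Sum>k\<in>UNIV. (A m z ** \<Gamma> k z ** gi z) $ m $ k)
      = - (\<Sum>k\<in>UNIV. \<Sum>l\<in>UNIV. gi z $ k $ l * (\<Sum>p\<in>UNIV. \<Gamma> k z $ p $ l * dd (e p) R z))"
  proof -
    have "(\<Sum>m\<in>UNIV. (A m z ** (\<Gamma> k z ** gi z)) $ m $ k)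
        = - (\<Sum>l\<in>UNIV. gi z $ k $ l * (\<Sum>p\<in>UNIV. \<Gamma> k z $ p $ l * dd (e p) R z))" for k
    proof -
      have "(\<Sum>m\<in>UNIV. (A m z ** (\<Gamma> k z ** gi z)) $ m $ k)
          = (\<Sum>p\<in>UNIV. (\<Sum>m\<in>UNIV. A m z $ m $ p) * (\<Gamma> k z ** gi z) $ p $ k)"
        unfolding mult_nth[of "A _ z"] sum_distrib_right by (rule sum.swap)
      also have "\<dots> = - (\<Sum>p\<in>UNIV. \<Sum>l\<in>UNIV. gi z $ k $ l * (\<Gamma> k z $ p $ l * dd (e p) R z))"
        by (simp add: A_trace[OF z] mult_nth gi_sym_nth[OF z, of k] sum_distrib_left sum_negf mult_ac)
      also have "(\<Sum>p\<in>UNIV. \<Sum>l\<in>UNIV. gi z $ k $ l * (\<Gamma> k z $ p $ l * dd (e p) R z))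
          = (\<Sum>l\<in>UNIV. gi z $ k $ l * (\<Sum>p\<in>UNIV. \<Gamma> k z $ p $ l * dd (e p) R z))"
        unfolding sum_distrib_left by (rule sum.swap)
      finally show ?thesis .
    qed
    then show ?thesis by (subst sum.swap) (simp add: matrix_mul_assoc sum_negf)
  qed
  also note dd_A_harmonic[OF z]
  finally show ?thesis
    by (simp add: lap_def hess_def right_diff_distrib sum_subtractf)
qed

lemma scalar_curvature_evolution:
  assumes z: "z \<in> W"
  shows "dd \<tau> R z = lap R z + 2 * trace (\<rho> z ** \<rho> z)"
proof -
  have "dd \<tau> R z = trace (dd \<tau> (\<lambda>y. gi y ** Ric y) z)"
    unfolding R_def[abs_def] by (intro dd_trace[OF _ open_W z] smooth_intros smooth_gi smooth_Ric)
  then show ?thesis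
    by (simp add: dd_matrix_mult[OF smooth_gi smooth_Ric open_W z] dd_gi_\<tau>[OF z] trace_simps
        matrix_mult_simps \<rho>_def trace_dd_Ric_\<tau>[OF z])
qed

lemma dd_\<tau>_trace_gi2:
  assumes h: "smooth_on W h" and z: "z \<in> W"
  shows "dd \<tau> (\<lambda>y. trace (gi y ** h y ** gi y ** h y)) z
    = 2 * trace (gi z ** dd \<tau> h z ** gi z ** h z) + 4 * trace (\<rho> z ** gi z ** h z ** gi z ** h z)"
proof -
  have D: "dd \<tau> (\<lambda>y. gi y ** h y) z = gi z ** dd \<tau> h z + 2 *\<^sub>R (\<rho> z ** gi z ** h z)"
    by (simp add: dd_matrix_mult[OF smooth_gi h open_W z] dd_gi_\<tau>[OF z] \<rho>_def matrix_mult_simps)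
  have "dd \<tau> (\<lambda>y. trace (gi y ** h y ** gi y ** h y)) z
      = trace (dd \<tau> (\<lambda>y. (gi y ** h y) ** (gi y ** h y)) z)"
    unfolding matrix_mul_assoc by (intro dd_trace[OF _ open_W z] smooth_intros smooth_gi h)
  also have "dd \<tau> (\<lambda>y. (gi y ** h y) ** (gi y ** h y)) z
      = dd \<tau> (\<lambda>y. gi y ** h y) z ** (gi z ** h z) + (gi z ** h z) ** dd \<tau> (\<lambda>y. gi y ** h y) z"
    by (intro dd_matrix_mult[OF _ _ open_W z] smooth_intros smooth_gi h)
  also have "trace \<dots> = 2 * trace (dd \<tau> (\<lambda>y. gi y ** h y) z ** (gi z ** h z))"
    by (simp add: trace_simps trace_mul_sym[of "gi z ** h z" "dd \<tau> (\<lambda>y. gi y ** h y) z"])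
  finally show ?thesis
    by (simp add: D matrix_mult_simps trace_simps)
qed

end

section \<open>Linear algebra at a point\<close>

lemma inner_matrix: "(X :: real^'n^'n) \<bullet> Y = trace (transpose X ** Y)"
proof -
  have "(\<Sum>i\<in>UNIV. \<Sum>j\<in>UNIV. X $ i $ j * Y $ i $ j) = (\<Sum>j\<in>UNIV. \<Sum>i\<in>UNIV. X $ i $ j * Y $ i $ j)"
    by (rule sum.swap)
  then show ?thesis by (simp add: inner_vec_def trace_mult transpose_nth)
qed

text \<open>Gram-Schmidt, one vector at a time: fewer than n vectors \<open>g *v v\<close> cannot
  span, a vector Euclidean-orthogonal to all of them is g-orthogonal to \<open>S\<close>, and it
  only has to be rescaled.\<close>

lemma g_orthonormal_set_exists:
  fixes g :: "real^'n^'n"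
  assumes sym: "transpose g = g" and pos: "\<And>v. v \<noteq> 0 \<Longrightarrow> v \<bullet> (g *v v) > 0"
  shows "k \<le> CARD('n) \<Longrightarrow> \<exists>S. finite S \<and> card S = k \<and> (\<forall>v\<in>S. \<forall>w\<in>S. v \<bullet> (g *v w) = (if v = w then 1 else 0))"
proof (induction k)
  case 0
  then show ?case by (intro exI[of _ "{}"]) simp
next
  case (Suc k)
  then obtain S where S: "finite S" "card S = k"
    "\<forall>v\<in>S. \<forall>w\<in>S. v \<bullet> (g *v w) = (if v = w then 1 else 0)"
    by auto
  have "dim ((*v) g ` S) \<le> card ((*v) g ` S)"
    using S(1) by (intro dim_le_card') simp
  also have "\<dots> \<le> k" using S card_image_le by metis
  finally have "dim ((*v) g ` S) < DIM(real^'n)" using Suc.prems by simp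
  then obtain x where x: "x \<noteq> 0" "\<And>y. y \<in> span ((*v) g ` S) \<Longrightarrow> orthogonal x y"
    using orthogonal_to_subspace_exists by blast
  have xS: "x \<bullet> (g *v v) = 0" if "v \<in> S" for v
    using x(2)[OF span_base] that by (auto simp: orthogonal_def)
  have swap: "v \<bullet> (g *v w) = w \<bullet> (g *v v)" for v w
    by (metis dot_lmul_matrix inner_commute sym transpose_matrix_vector)
  define q where "q = sqrt (x \<bullet> (g *v x))"
  have q: "q > 0" "q * q = x \<bullet> (g *v x)"
    using pos[OF x(1)] by (simp_all add: q_def)
  define u where "u = (1 / q) *\<^sub>R x"
  have uu: "u \<bullet> (g *v u) = 1"
    using q(1) by (simp add: u_def matrix_vector_mult_scaleR q(2)[symmetric])
  have uS: "u \<bullet> (g *v v) = 0" if "v \<in> S" for v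
    using xS[OF that] by (simp add: u_def)
  have Su: "v \<bullet> (g *v u) = 0" if "v \<in> S" for v
    using uS[OF that] swap[of v u] by simp
  have "u \<notin> S" using uu uS[of u] by auto
  then show ?case
    using S uu uS Su by (intro exI[of _ "insert u S"]) auto
qed

text \<open>The columns of \<open>P\<close> are a g-orthonormal basis. The formula for the inverse
  turns contractions with the inverse metric into sums over this basis, so pointwise inequalities
  reduce to Euclidean ones.\<close>

lemma orthonormal_frame:
  fixes g :: "real^'n^'n"
  assumes sym: "transpose g = g" and pos: "\<And>v. v \<noteq> 0 \<Longrightarrow> v \<bullet> (g *v v) > 0"
  obtains P :: "real^'n^'n" where "transpose P ** g ** P = mat 1" "matrix_inv g = P ** transpose P" "invertible g"
proof -
  obtain S where S: "finite S" "card S = CARD('n)"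
    "\<forall>v\<in>S. \<forall>w\<in>S. v \<bullet> (g *v w) = (if v = w then 1 else (0::real))"
    using g_orthonormal_set_exists[OF sym pos, of "CARD('n)"] by auto
  obtain f where f: "bij_betw f (UNIV :: 'n set) S"
    using S finite_same_card_bij[of "UNIV :: 'n set" S] by auto
  define P :: "real^'n^'n" where "P = (\<chi> i j. f j $ i)"
  have "(transpose P ** g ** P) $ a $ b = f a \<bullet> (g *v f b)" for a b
    by (simp add: matrix_mul_assoc[symmetric] P_def inner_vec_def mult_nth transpose_nth
        matrix_vector_mult_def)
  moreover have "f a \<bullet> (g *v f b) = (if a = b then 1 else 0)" for a b
    using S(3) f by (auto simp: bij_betw_def inj_on_def)
  ultimately have 1: "transpose P ** g ** P = mat 1"
    by (simp add: vec_eq_iff mat_def)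
  then have "P ** (transpose P ** g) = mat 1"
    using matrix_left_right_inverse by blast
  then have 2: "(P ** transpose P) ** g = mat 1"
    by (simp add: matrix_mul_assoc)
  then have 3: "g ** (P ** transpose P) = mat 1"
    using matrix_left_right_inverse by blast
  then have inv: "invertible g"
    using 2 invertible_def by blast
  have "matrix_inv g = (P ** transpose P) ** (g ** matrix_inv g)"
    using 2 by (simp add: matrix_mul_assoc)
  then have "matrix_inv g = P ** transpose P"
    by (simp add: matrix_inv_inverse inv)
  from that[OF 1 this inv] show ?thesis .
qed

section \<open>Sharp trace inequalities for symmetric matrices\<close>

lemma trace_congruence_nonneg:
  fixes M Q :: "real^'n^'n"
  assumes "\<And>x. x \<bullet> (Q *v x) \<ge> 0"
  shows "trace (transpose M ** Q ** M) \<ge> 0"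
proof -
  have "(transpose M ** Q ** M) $ i $ i = column i M \<bullet> (Q *v column i M)" for i
    by (simp add: matrix_mul_assoc[symmetric] inner_vec_def mult_nth transpose_nth
        matrix_vector_mult_def column_def)
  then show ?thesis
    using assms by (simp add: trace_def sum_nonneg)
qed

text \<open>\<open>|B x|\<^sup>2 = \<langle>B, sym(B x \<otimes> x)\<rangle>\<close>, and only the traceless part of \<open>sym(B x \<otimes> x)\<close> contributes.\<close>

lemma traceless_operator_bound:
  fixes B :: "real^'n^'n"
  assumes sym: "transpose B = B" and tr: "trace B = 0" and unit: "trace (B ** B) = 1"
    and card: "CARD('n) \<ge> 2"
  shows "(B *v x) \<bullet> (B *v x) \<le> (real CARD('n) - 1) / real CARD('n) * (x \<bullet> x)"
proof (cases "B *v x = 0")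
  case True
  then show ?thesis by simp
next
  case False
  define n where "n = real CARD('n)"
  have n: "n \<ge> 2" using card by (simp add: n_def)
  define u where "u = B *v x"
  define X :: "real^'n^'n" where "X = (\<chi> i j. u $ i * x $ j)"
  define Y where "Y = (1/2) *\<^sub>R (X + transpose X) - ((u \<bullet> x) / n) *\<^sub>R mat 1"
  have BI: "B \<bullet> mat 1 = 0" by (simp add: inner_matrix sym tr)
  have II: "(mat 1 :: real^'n^'n) \<bullet> mat 1 = n" by (simp add: inner_matrix n_def trace_I)
  have trX: "trace X = u \<bullet> x" by (simp add: X_def trace_def inner_vec_def)
  have XI: "X \<bullet> mat 1 = u \<bullet> x" "transpose X \<bullet> mat 1 = u \<bullet> x"
    by (simp_all add: inner_matrix trace_simps trX)
  have XX: "X \<bullet> X = (u \<bullet> u) * (x \<bullet> x)" "transpose X \<bullet> transpose X = (u \<bullet> u) * (x \<bullet> x)"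
  proof -
    show 1: "X \<bullet> X = (u \<bullet> u) * (x \<bullet> x)"
      by (simp add: X_def inner_vec_def sum_product mult_ac)
    show "transpose X \<bullet> transpose X = (u \<bullet> u) * (x \<bullet> x)"
      using 1 by (simp add: inner_matrix trace_mul_sym[of X])
  qed
  have XT: "X \<bullet> transpose X = (u \<bullet> x)\<^sup>2"
    by (simp add: X_def inner_vec_def sum_product transpose_nth power2_eq_square mult_ac)
  have BX: "B \<bullet> X = u \<bullet> u"
    by (simp add: X_def inner_vec_def u_def matrix_vector_mult_def sum_distrib_left mult_ac)
  have "B \<bullet> transpose X = B \<bullet> X"
  proof -
    have "trace (B ** transpose X) = trace (transpose (B ** transpose X))" by (simp add: trace_simps)
    also have "\<dots> = trace (B ** X)" by (simp add: matrix_transpose_mul sym trace_mul_sym[of B])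
    finally show ?thesis by (simp add: inner_matrix sym)
  qed
  then have BY: "B \<bullet> Y = u \<bullet> u"
    by (simp add: Y_def inner_diff_right inner_add_right BX BI)
  have BB: "B \<bullet> B = 1" by (simp add: inner_matrix sym unit)
  have YY: "Y \<bullet> Y = ((u \<bullet> u) * (x \<bullet> x) + (u \<bullet> x)\<^sup>2) / 2 - (u \<bullet> x)\<^sup>2 / n"
    using n unfolding Y_def
    by (simp add: inner_diff_right inner_add_right inner_diff_left inner_add_left XX XT II XI
        inner_commute[of "transpose X" X] inner_commute[of "mat 1" X] inner_commute[of "mat 1" "transpose X"]
        field_simps power2_eq_square)
  have "(B \<bullet> Y)\<^sup>2 \<le> (B \<bullet> B) * (Y \<bullet> Y)" by (rule Cauchy_Schwarz_ineq)
  then have "(u \<bullet> u)\<^sup>2 \<le> ((u \<bullet> u) * (x \<bullet> x) + (u \<bullet> x)\<^sup>2) / 2 - (u \<bullet> x)\<^sup>2 / n"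
    by (simp add: BY BB YY)
  also have "\<dots> = (u \<bullet> u) * (x \<bullet> x) / 2 + (u \<bullet> x)\<^sup>2 * (1 / 2 - 1 / n)"
    by (simp add: algebra_simps add_divide_distrib)
  \<comment> \<open>The factor 1/2 - 1/n is nonnegative as n is at least 2, so Cauchy-Schwarz may be
    applied to its companion \<open>(u \<bullet> x)\<^sup>2\<close>.\<close>
  also have "\<dots> \<le> (u \<bullet> u) * (x \<bullet> x) / 2 + (u \<bullet> u) * (x \<bullet> x) * (1 / 2 - 1 / n)"
    using n Cauchy_Schwarz_ineq[of u x] by (intro add_left_mono mult_right_mono) (auto simp: field_simps)
  also have "\<dots> = (u \<bullet> u) * ((n - 1) / n * (x \<bullet> x))"
    using n by (simp add: field_simps)
  finally have "(u \<bullet> u) * (u \<bullet> u) \<le> (u \<bullet> u) * ((n - 1) / n * (x \<bullet> x))"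
    by (simp add: power2_eq_square)
  moreover have "u \<bullet> u > 0" using False by (simp add: u_def)
  ultimately have "u \<bullet> u \<le> (n - 1) / n * (x \<bullet> x)"
    by (rule mult_left_le_imp_le)
  then show ?thesis by (simp only: u_def n_def)
qed

text \<open>\<open>\<delta>\<close> normalizes the spectrum with (n-1)\<delta> once and -\<delta>
  otherwise. Both bounds come from traces of nonnegative polynomials in B vanishing on this
  spectrum: (m - B)(B + \<delta>)^2 for the first, and the same multiplied by B + m + c for the
  second.\<close>

lemma traceless_cubic_quartic_bounds:
  fixes B :: "real^'n^'n"
  assumes sym: "transpose B = B" and tr: "trace B = 0" and unit: "trace (B ** B) = 1"
    and card: "CARD('n) \<ge> 3"
  defines "n \<equiv> real CARD('n)" and "\<delta> \<equiv> 1 / sqrt (real CARD('n) * (real CARD('n) - 1))"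
  shows "trace (B ** B ** B) \<le> (n - 2) * \<delta>"
    and "(n - 1) * (n - 2) * \<delta> * trace (B ** B ** B) + trace (B ** B ** B ** B) \<le> (n - 2)\<^sup>2 / (n - 1) + 1 / n"
proof -
  have n: "n \<ge> 3" using card by (simp add: n_def)
  have \<delta>: "\<delta> > 0" "\<delta> * \<delta> = 1 / (n * (n - 1))"
    using n by (auto simp: \<delta>_def n_def[symmetric] real_sqrt_mult_self)
  define m where "m = (n - 1) * \<delta>"
  have m: "m > 0" "m * m = (n - 1) / n"
  proof -
    show "m > 0" using n \<delta> by (simp add: m_def)
    have "m * m = (n - 1) * (n - 1) * (\<delta> * \<delta>)" by (simp add: m_def)
    then show "m * m = (n - 1) / n" using n by (simp add: \<delta>(2))
  qed
  have Bx: "(B *v x) \<bullet> (B *v x) \<le> m * m * (x \<bullet> x)" for x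
    using traceless_operator_bound[OF sym tr unit, of x] card m(2) by (simp add: n_def)
  have xBx: "x \<bullet> (B *v x) \<le> m * (x \<bullet> x)" for x
  proof -
    have "(x \<bullet> (B *v x))\<^sup>2 \<le> (x \<bullet> x) * ((B *v x) \<bullet> (B *v x))" by (rule Cauchy_Schwarz_ineq)
    also have "\<dots> \<le> (x \<bullet> x) * (m * m * (x \<bullet> x))" by (intro mult_left_mono Bx) simp
    also have "\<dots> = (m * (x \<bullet> x))\<^sup>2" by (simp add: power2_eq_square)
    finally show ?thesis by (rule power2_le_imp_le) (use m(1) in simp)
  qed
  define I :: "real^'n^'n" where "I = mat 1"
  have trI: "trace I = n" by (simp add: I_def trace_I n_def)
  have I: "X ** I = X" "I ** X = X" for X by (simp_all add: I_def)
  define M where "M = B + \<delta> *\<^sub>R I"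
  have MT: "transpose M = M" by (simp add: M_def I_def transpose_simps sym)
  let ?Q = "m *\<^sub>R I - B"
  have Qv: "x \<bullet> (?Q *v x) = m * (x \<bullet> x) - x \<bullet> (B *v x)" for x
    by (simp add: I_def matrix_vector_mult_diff_rdistrib scaleR_matrix_vector_assoc[symmetric] inner_diff_right)
  have "0 \<le> trace (transpose M ** ?Q ** M)"
    by (rule trace_congruence_nonneg) (simp add: Qv xBx)
  also have "\<dots> = - trace (B ** B ** B) + (m - 2 * \<delta>) + n * m * (\<delta> * \<delta>)"
    unfolding MT by (simp add: M_def matrix_mult_simps trace_simps I trI tr unit; simp add: algebra_simps)
  also have "n * m * (\<delta> * \<delta>) = \<delta>"
    using n by (simp only: \<delta>(2)) (simp add: m_def)
  finally show "trace (B ** B ** B) \<le> (n - 2) * \<delta>"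
    by (simp add: m_def algebra_simps)
  \<comment> \<open>Chosen so that c + 2\<delta> is the required coefficient of the cubic trace. It
    is nonnegative for n at least 3, which makes \<open>?Q'\<close> a sum of two positive
    semidefinite matrices.\<close>
  define c where "c = ((n - 1) * (n - 2) - 2) * \<delta>"
  have "2 * 1 \<le> (n - 1) * (n - 2)" using n by (intro mult_mono) auto
  then have c: "c \<ge> 0" using \<delta>(1) by (simp add: c_def)
  let ?Q' = "(m * m) *\<^sub>R I - B ** B + c *\<^sub>R ?Q"
  have Q'v: "x \<bullet> (?Q' *v x) = (m * m * (x \<bullet> x) - (B *v x) \<bullet> (B *v x)) + c * (m * (x \<bullet> x) - x \<bullet> (B *v x))" for x
  proof -
    have "x \<bullet> ((B ** B) *v x) = (B *v x) \<bullet> (B *v x)"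
      by (metis dot_lmul_matrix matrix_vector_mul_assoc sym transpose_matrix_vector)
    then show ?thesis
      by (simp add: I_def matrix_vector_mult_diff_rdistrib matrix_vector_mult_add_rdistrib
          scaleR_matrix_vector_assoc[symmetric] inner_diff_right inner_add_right)
  qed
  have "0 \<le> trace (transpose M ** ?Q' ** M)"
    by (rule trace_congruence_nonneg) (unfold Q'v, use Bx xBx c in simp)
  also have "\<dots> = - trace (B ** B ** B ** B) - (c + 2 * \<delta>) * trace (B ** B ** B)
      + (m * m - \<delta> * \<delta> + c * m - 2 * c * \<delta>) + n * (\<delta> * \<delta>) * (m * m + c * m)"
    unfolding MT by (simp add: M_def matrix_mult_simps trace_simps I trI tr unit; simp add: algebra_simps)
  finally have "(c + 2 * \<delta>) * trace (B ** B ** B) + trace (B ** B ** B ** B)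
    \<le> (m * m - \<delta> * \<delta> + c * m - 2 * c * \<delta>) + n * (\<delta> * \<delta>) * (m * m + c * m)" by simp
  also have "\<dots> = (n - 2)\<^sup>2 / (n - 1) + 1 / n"
  proof -
    have cd: "c * \<delta> = ((n - 1) * (n - 2) - 2) * (\<delta> * \<delta>)" "c * m = (n - 1) * ((n - 1) * (n - 2) - 2) * (\<delta> * \<delta>)"
      by (simp_all add: c_def m_def)
    have nz: "n \<noteq> 0" "n - 1 \<noteq> 0" using n by auto
    show ?thesis
      unfolding mult.assoc[of 2 c \<delta>] cd \<delta>(2) m(2) using nz
      by (simp add: divide_simps) (simp add: power2_eq_square algebra_simps)
  qed
  finally show "(n - 1) * (n - 2) * \<delta> * trace (B ** B ** B) + trace (B ** B ** B ** B) \<le> (n - 2)\<^sup>2 / (n - 1) + 1 / n"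
    by (simp add: c_def algebra_simps)
qed

text \<open>Replacing B by -B changes only the sign of the cubic trace, so that trace may be taken
  nonnegative. Its upper bound then replaces one factor of its square, and the linear estimate
  applies.\<close>

lemma traceless_cubic_quartic:
  fixes B :: "real^'n^'n"
  assumes sym: "transpose B = B" and tr: "trace B = 0" and unit: "trace (B ** B) = 1"
    and card: "CARD('n) \<ge> 3"
  defines "n \<equiv> real CARD('n)"
  shows "(n - 1) * (trace (B ** B ** B))\<^sup>2 + trace (B ** B ** B ** B) \<le> (n - 2)\<^sup>2 / (n - 1) + 1 / n"
proof -
  have nonneg: "(n - 1) * (trace (C ** C ** C))\<^sup>2 + trace (C ** C ** C ** C) \<le> (n - 2)\<^sup>2 / (n - 1) + 1 / n"
    if C: "transpose C = C" "trace C = 0" "trace (C ** C) = 1" "trace (C ** C ** C) \<ge> 0"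
    for C :: "real^'n^'n"
  proof -
    define \<delta> where "\<delta> = 1 / sqrt (real CARD('n) * (real CARD('n) - 1))"
    note b = traceless_cubic_quartic_bounds[OF C(1-3) card, folded n_def \<delta>_def]
    have "(n - 1) * (trace (C ** C ** C))\<^sup>2 \<le> (n - 1) * ((n - 2) * \<delta> * trace (C ** C ** C))"
      using b(1) C(4) card by (intro mult_left_mono) (auto simp: power2_eq_square n_def intro!: mult_right_mono)
    then show ?thesis using b(2) by (simp add: mult.assoc)
  qed
  show ?thesis
  proof (cases "trace (B ** B ** B) \<ge> 0")
    case True
    then show ?thesis using nonneg assms by blast
  next
    case False
    then show ?thesis
      using nonneg[of "- B"] sym tr unit by (simp add: transpose_simps trace_simps matrix_mult_simps)
  qed
qed

text \<open>With b normalized to B, the pairing of a with B^2 splits into its part along B, governed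
  by tr B^3, and a part orthogonal to B and the identity. A weighted Cauchy-Schwarz inequality
  recombines both, and the weights produce exactly the combination of cubic and quartic traces
  bounded in \<open>traceless_cubic_quartic\<close>.\<close>

lemma traceless_pairing_bound:
  fixes a b :: "real^'n^'n"
  assumes a: "transpose a = a" "trace a = 0" and b: "transpose b = b" "trace b = 0"
    and card: "CARD('n) \<ge> 3"
  defines "n \<equiv> real CARD('n)"
  shows "(trace (a ** b ** b))\<^sup>2 \<le> (n - 2)\<^sup>2 * trace (b ** b) *
     (trace (a ** a) * trace (b ** b) / (n - 1) - (trace (a ** b))\<^sup>2 / n)"
proof (cases "b = 0")
  case True
  then show ?thesis by (simp add: matrix_mult_simps trace_0[simplified mat_0])
next
  case False
  have n: "n \<ge> 3" using card by (simp add: n_def)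
  define y where "y = trace (b ** b)"
  have y: "y > 0" using False inner_gt_zero_iff[of b] by (simp add: y_def inner_matrix b(1))
  define B where "B = (1 / sqrt y) *\<^sub>R b"
  have bB: "b = sqrt y *\<^sub>R B" using y by (simp add: B_def)
  have B: "transpose B = B" "trace B = 0" "trace (B ** B) = 1"
    using y by (simp_all add: B_def transpose_simps trace_simps b matrix_mult_simps y_def[symmetric])
  define \<sigma>3 where "\<sigma>3 = trace (B ** B ** B)"
  define \<sigma>4 where "\<sigma>4 = trace (B ** B ** B ** B)"
  define s where "s = trace (a ** B)"
  define t where "t = trace (a ** B ** B)"
  define N where "N = trace (a ** a)"
  define a' where "a' = a - s *\<^sub>R B"
  \<comment> \<open>The component of \<open>B ** B\<close> orthogonal to the identity and to B:
    since |B| = 1 and tr B = 0, the two projection coefficients are 1/n and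
    \<open>\<sigma>3\<close>.\<close>
  define D where "D = B ** B - (1 / n) *\<^sub>R mat 1 - \<sigma>3 *\<^sub>R B"
  have syms: "transpose a' = a'" "transpose D = D"
    by (simp_all add: a'_def D_def transpose_simps a B matrix_transpose_mul)
  have aa: "a' \<bullet> a' = N - s\<^sup>2"
    by (simp add: inner_matrix syms) (simp add: a'_def matrix_mult_simps trace_simps B N_def s_def
        trace_mul_sym[of B a] power2_eq_square)
  have trI: "trace (mat 1 :: real^'n^'n) = n" by (simp add: trace_I n_def)
  have DD: "D \<bullet> D = \<sigma>4 - 1 / n - \<sigma>3\<^sup>2"
    using n by (simp add: inner_matrix syms) (simp add: D_def matrix_mult_simps trace_simps B trI
        \<sigma>3_def[symmetric] \<sigma>4_def[symmetric] power2_eq_square)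
  have aD: "a' \<bullet> D = t - s * \<sigma>3"
    by (simp add: inner_matrix syms) (simp add: a'_def D_def matrix_mult_simps trace_simps B a
        \<sigma>3_def[symmetric] s_def[symmetric] t_def[symmetric])
  define p where "p = t - s * \<sigma>3"
  define c2 where "c2 = N - s\<^sup>2"
  define Q where "Q = \<sigma>4 - 1 / n - \<sigma>3\<^sup>2"
  have pos: "c2 \<ge> 0" "Q \<ge> 0" using aa DD inner_ge_zero[of a'] inner_ge_zero[of D] by (simp_all add: c2_def Q_def)
  have p: "p\<^sup>2 \<le> c2 * Q"
    using Cauchy_Schwarz_ineq[of a' D] by (simp add: aa DD aD p_def c2_def Q_def)
  have key: "n * \<sigma>3\<^sup>2 + Q \<le> (n - 2)\<^sup>2 / (n - 1)"
    using traceless_cubic_quartic[OF B card, folded n_def] by (simp add: Q_def \<sigma>3_def \<sigma>4_def algebra_simps)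
  \<comment> \<open>The mixed term of t^2, estimated by the inequality between arithmetic and
    geometric mean. The weights 1/n and n make the sum factor into (s^2 + n c2)/n times the quantity
    in \<open>key\<close>.\<close>
  have "2 * (s * \<sigma>3 * p) \<le> s\<^sup>2 * Q / n + n * c2 * \<sigma>3\<^sup>2"
  proof (rule power2_le_imp_le)
    have "(2 * (s * \<sigma>3 * p))\<^sup>2 = 4 * (s\<^sup>2 * \<sigma>3\<^sup>2) * p\<^sup>2" by (simp add: power_mult_distrib)
    also have "\<dots> \<le> 4 * (s\<^sup>2 * \<sigma>3\<^sup>2) * (c2 * Q)" by (intro mult_left_mono p) simp
    also have "\<dots> = 4 * ((s\<^sup>2 * Q / n) * (n * c2 * \<sigma>3\<^sup>2))" using n by simp
    also have "\<dots> \<le> (s\<^sup>2 * Q / n + n * c2 * \<sigma>3\<^sup>2)\<^sup>2"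
      using zero_le_power2[of "s\<^sup>2 * Q / n - n * c2 * \<sigma>3\<^sup>2"] by (simp add: power2_eq_square algebra_simps)
    finally show "(2 * (s * \<sigma>3 * p))\<^sup>2 \<le> (s\<^sup>2 * Q / n + n * c2 * \<sigma>3\<^sup>2)\<^sup>2" .
    show "0 \<le> s\<^sup>2 * Q / n + n * c2 * \<sigma>3\<^sup>2" using pos n by simp
  qed
  moreover have "t = s * \<sigma>3 + p" by (simp add: p_def)
  ultimately have "t\<^sup>2 \<le> s\<^sup>2 * \<sigma>3\<^sup>2 + (s\<^sup>2 * Q / n + n * c2 * \<sigma>3\<^sup>2) + c2 * Q"
    using p by (simp add: power2_sum power_mult_distrib)
  also have "\<dots> = (s\<^sup>2 + n * c2) / n * (n * \<sigma>3\<^sup>2 + Q)"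
    using n by (simp add: field_simps)
  also have "\<dots> \<le> (s\<^sup>2 + n * c2) / n * ((n - 2)\<^sup>2 / (n - 1))"
    using n pos by (intro mult_left_mono key) auto
  also have "\<dots> = (n - 2)\<^sup>2 * (N / (n - 1) - s\<^sup>2 / n)"
    using n by (simp add: c2_def divide_simps) (simp add: algebra_simps)
  finally have t: "t\<^sup>2 \<le> (n - 2)\<^sup>2 * (N / (n - 1) - s\<^sup>2 / n)" .
  have "(trace (a ** b ** b))\<^sup>2 = y\<^sup>2 * t\<^sup>2"
    using y by (simp add: bB matrix_mult_simps trace_simps t_def power_mult_distrib)
  also have "\<dots> \<le> y\<^sup>2 * ((n - 2)\<^sup>2 * (N / (n - 1) - s\<^sup>2 / n))"
    by (intro mult_left_mono t) simp
  also have "\<dots> = (n - 2)\<^sup>2 * y * (N * y / (n - 1) - (sqrt y * s)\<^sup>2 / n)"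
    using y by (simp add: power_mult_distrib power2_eq_square right_diff_distrib mult_ac)
  also have "sqrt y * s = trace (a ** b)"
    by (simp add: bB s_def matrix_mult_simps trace_simps)
  finally show ?thesis
    by (simp only: y_def[symmetric] N_def[symmetric])
qed

text \<open>Completing the square in H costs R^2 x^2 / (N n). What remains is the quadratic R^2 J /
  N + 2 R \<tau> + N y in R, and the bound on w says that its discriminant is nonpositive.\<close>

lemma quadratic_form_nonneg:
  fixes N y x w H R n :: real
  assumes N: "N \<ge> 0" and y: "y \<ge> 0" and n: "n \<ge> 3" and x: "x\<^sup>2 \<le> N * y"
    and w: "w\<^sup>2 \<le> (n - 2)\<^sup>2 * y * (N * y / (n - 1) - x\<^sup>2 / n)"
  shows "0 \<le> R\<^sup>2 * y / (n - 1) + (N * H\<^sup>2 - 2 * R * H * x) / n + N * y + 2 * R * w / (n - 2)"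
\<comment> \<open>Completing the squares divides by N and by N y. In the degenerate case x and w
  vanish, and every remaining term is nonnegative.\<close>
proof (cases "N * y = 0")
  case True
  have "x\<^sup>2 \<le> 0" using x unfolding True .
  then have x0: "x = 0" by simp
  have "w\<^sup>2 \<le> 0" using w unfolding True x0 by simp
  then have "w = 0" by simp
  then show ?thesis using True x0 N y n by auto
next
  case False
  then have N: "N > 0" and y: "y > 0" using N y by auto
  define J where "J = N * y / (n - 1) - x\<^sup>2 / n"
  define \<tau> where "\<tau> = w / (n - 2)"
  have \<tau>: "\<tau>\<^sup>2 \<le> y * J"
    using w n by (simp add: \<tau>_def J_def power_divide divide_le_eq mult_ac)
  have "0 \<le> (R * \<tau> + N * y)\<^sup>2" by simp
  also have "\<dots> = R\<^sup>2 * \<tau>\<^sup>2 + N\<^sup>2 * y\<^sup>2 + 2 * R * \<tau> * N * y"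
    by (simp add: power2_sum power_mult_distrib)
  also have "\<dots> \<le> R\<^sup>2 * (y * J) + N\<^sup>2 * y\<^sup>2 + 2 * R * \<tau> * N * y"
    by (intro add_right_mono mult_left_mono \<tau>) simp
  also have "\<dots> = N * y * (R\<^sup>2 * J / N + N * y + 2 * R * \<tau>)"
    using N by (simp add: field_simps power2_eq_square)
  finally have 1: "0 \<le> R\<^sup>2 * J / N + N * y + 2 * R * \<tau>"
    using mult_pos_pos[OF N y] by (simp add: zero_le_mult_iff)
  have "0 \<le> (N * H - R * x)\<^sup>2 / (N * n)" using N n by simp
  also have "\<dots> = (N * H\<^sup>2 - 2 * R * H * x) / n + R\<^sup>2 * x\<^sup>2 / (N * n)"
    using N n by (simp add: field_simps power2_eq_square)
  finally have 2: "0 \<le> (N * H\<^sup>2 - 2 * R * H * x) / n + R\<^sup>2 * x\<^sup>2 / (N * n)" .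
  have "R\<^sup>2 * J / N = R\<^sup>2 * y / (n - 1) - R\<^sup>2 * x\<^sup>2 / (N * n)"
    using N n by (simp add: J_def right_diff_distrib diff_divide_distrib)
  then show ?thesis using 1 2 by (simp add: \<tau>_def)
qed

text \<open>With S the Ricci tensor and K the tensor h in an orthonormal frame, the bracket
  multiplying \<open>trace S\<close> is Rm(h, h) for a curvature tensor without Weyl part. Splitting
  S and K into traces and traceless parts turns the difference of the two sides into
  \<open>quadratic_form_nonneg\<close>.\<close>

lemma weyl_free_curvature_bound:
  fixes S K :: "real^'n^'n"
  assumes S: "transpose S = S" and K: "transpose K = K" and card: "CARD('n) \<ge> 3"
  defines "n \<equiv> real CARD('n)"
  shows "trace S * (2 / (n - 2) * (trace K * trace (S ** K) - trace (S ** K ** K))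
      - trace S / ((n - 1) * (n - 2)) * ((trace K)\<^sup>2 - trace (K ** K)))
    \<le> trace (S ** S) * trace (K ** K)"
proof -
  have n: "n \<ge> 3" using card by (simp add: n_def)
  define R where "R = trace S"
  define H where "H = trace K"
  define a where "a = S - (R / n) *\<^sub>R mat 1"
  define b where "b = K - (H / n) *\<^sub>R mat 1"
  have trI: "trace (mat 1 :: real^'n^'n) = n" by (simp add: trace_I n_def)
  have a: "transpose a = a" "trace a = 0" and b: "transpose b = b" "trace b = 0"
    using n by (simp_all add: a_def b_def transpose_simps trace_simps S K R_def H_def trI)
  have Sa: "S = a + (R / n) *\<^sub>R mat 1" and Kb: "K = b + (H / n) *\<^sub>R mat 1"
    by (simp_all add: a_def b_def)
  define N where "N = trace (a ** a)"
  define y where "y = trace (b ** b)"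
  define x where "x = trace (a ** b)"
  define w where "w = trace (a ** b ** b)"
  have tr: "trace (S ** S) = R\<^sup>2 / n + N" "trace (K ** K) = H\<^sup>2 / n + y" "trace (S ** K) = R * H / n + x"
    "trace (S ** K ** K) = R / n * (H\<^sup>2 / n + y) + 2 * H / n * x + w"
    using n unfolding Sa Kb
    by (simp_all add: matrix_mult_simps trace_simps a b trI N_def y_def x_def w_def
        trace_mul_sym[of b a]; simp add: power2_eq_square field_simps)+
  have "0 \<le> R\<^sup>2 * y / (n - 1) + (N * H\<^sup>2 - 2 * R * H * x) / n + N * y + 2 * R * w / (n - 2)"
  proof (rule quadratic_form_nonneg)
    show "N \<ge> 0" "y \<ge> 0" using inner_ge_zero[of a] inner_ge_zero[of b] by (simp_all add: inner_matrix a b N_def y_def)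
    show "x\<^sup>2 \<le> N * y"
      using Cauchy_Schwarz_ineq[of a b] by (simp add: inner_matrix a b N_def y_def x_def)
    show "w\<^sup>2 \<le> (n - 2)\<^sup>2 * y * (N * y / (n - 1) - x\<^sup>2 / n)"
      using traceless_pairing_bound[OF a b card] by (simp add: w_def y_def N_def x_def n_def)
  qed (rule n)
  also have "\<dots> = trace (S ** S) * trace (K ** K)
      - R * (2 / (n - 2) * (H * trace (S ** K) - trace (S ** K ** K))
      - R / ((n - 1) * (n - 2)) * (H\<^sup>2 - trace (K ** K)))"
  proof -
    have nz: "n \<noteq> 0" "n - 1 \<noteq> 0" "n - 2 \<noteq> 0" using n by auto
    show ?thesis unfolding tr using nz
      by (simp add: divide_simps) (simp add: power2_eq_square algebra_simps)
  qed
  finally show ?thesis by (simp add: R_def H_def)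
qed

section \<open>The flow in a chart\<close>

lemma has_derivative_slice:
  fixes \<phi> :: "'a::real_normed_vector \<times> real \<Rightarrow> 'b::real_normed_vector"
  assumes "(\<phi> has_derivative D) (at (x, t) within U \<times> I)" "open U" "x \<in> U" "t \<in> I"
  shows "((\<lambda>y. \<phi> (y, t)) has_derivative (\<lambda>v. D (v, 0))) (at x)"
proof -
  have "((\<lambda>y. (y, t)) has_derivative (\<lambda>v. (v, 0))) (at x within U)"
    by (auto intro!: derivative_eq_intros)
  moreover have "(\<phi> has_derivative D) (at ((\<lambda>y. (y, t)) x) within (\<lambda>y. (y, t)) ` U)"
    using assms(4) by (auto intro: has_derivative_subset[OF assms(1)])
  ultimately have "(\<phi> \<circ> (\<lambda>y. (y, t)) has_derivative D \<circ> (\<lambda>v. (v, 0))) (at x within U)"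
    by (rule diff_chain_within)
  then show ?thesis
    using at_within_open[OF assms(3,2)] by (simp add: o_def)
qed

text \<open>A spatial partial derivative at fixed time is the derivative in the direction
  \<open>(axis i 1, 0)\<close> of the function on space-time, and therefore stays smooth up to the
  initial time.\<close>

lemma smooth_on_partial:
  fixes f :: "real \<Rightarrow> real^'n \<Rightarrow> real"
  assumes "smooth_on (U \<times> I) (\<lambda>(x, t). f t x)" "open U"
  shows "smooth_on (U \<times> I) (\<lambda>(x, t). partial i (f t) x)"
  unfolding smooth_on_def
proof
  fix k
  have "Ck_on (Suc k) (U \<times> I) (\<lambda>(x, t). f t x)" using assms(1) smooth_on_def by blast
  then obtain D where D: "\<forall>z\<in>U \<times> I. ((\<lambda>(x, t). f t x) has_derivative D z) (at z within U \<times> I)"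
    "\<forall>v. Ck_on k (U \<times> I) (\<lambda>z. D z v)"
    by auto
  show "Ck_on k (U \<times> I) (\<lambda>(x, t). partial i (f t) x)"
  proof (rule Ck_on_eqI[OF D(2)[rule_format, of "(axis i 1, 0)"]])
    fix z :: "(real^'n) \<times> real" assume z: "z \<in> U \<times> I"
    obtain x t where xt: "z = (x, t)" "x \<in> U" "t \<in> I" using z by auto
    have "(f t has_derivative (\<lambda>v. D (x, t) (v, 0))) (at x)"
      using has_derivative_slice[OF D(1)[rule_format, OF z, unfolded xt(1)] assms(2) xt(2,3)] by simp
    from frechet_derivative_at[OF this]
    show "(case z of (x, t) \<Rightarrow> partial i (f t) x) = D z (axis i 1, 0)"
      by (simp add: partial_def xt(1)) metis
  qed
qed

lemma partial_eq_dd: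
  fixes f :: "real \<Rightarrow> real^'n \<Rightarrow> real"
  assumes "smooth_on W \<phi>" "open W" "W = U \<times> I" "open U" "x \<in> U" "t \<in> I" "\<And>y. y \<in> U \<Longrightarrow> \<phi> (y, t) = f t y"
  shows "partial i (f t) x = dd (axis i 1, 0) \<phi> (x, t)"
proof -
  have xt: "(x, t) \<in> W" using assms by simp
  have "(\<phi> has_derivative (\<lambda>v. dd v \<phi> (x, t))) (at (x, t) within U \<times> I)"
    using smooth_on_imp_has_derivative[OF assms(1,2) xt] by (rule has_derivative_at_withinI)
  from has_derivative_slice[OF this assms(4-6)]
  have "(f t has_derivative (\<lambda>v. dd (v, 0) \<phi> (x, t))) (at x)"
    by (rule has_derivative_transform_within_open[OF _ assms(4,5)]) (simp add: assms(7))
  from frechet_derivative_at[OF this] show ?thesis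
    by (simp add: partial_def) metis
qed

lemma DERIV_slice_eq_dd:
  fixes \<phi> :: "'a::real_normed_vector \<times> real \<Rightarrow> real"
  assumes "smooth_on W \<phi>" "open W" "(x, t) \<in> W"
  shows "((\<lambda>s. \<phi> (x, s)) has_real_derivative dd (0, 1) \<phi> (x, t)) (at t)"
proof -
  have "(x, 0) + t *\<^sub>R (0, 1) = (x, t)" by simp
  then show ?thesis
    using dd_real_line[OF assms(1,2), of "(x, 0)" t "(0, 1)"] assms(3) by simp
qed

text \<open>Maximality is required only along the line through \<open>z\<close> in direction
  \<open>w\<close>. A positive second derivative would make the first derivative positive just
  beyond \<open>z\<close>, and the mean value theorem would give a larger value.\<close>

lemma second_derivative_test:
  fixes \<psi> :: "'a::real_normed_vector \<Rightarrow> real"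
  assumes \<psi>: "smooth_on W \<psi>" and W: "open W" and z: "z \<in> W"
    and max: "\<And>s. z + s *\<^sub>R w \<in> W \<Longrightarrow> \<psi> (z + s *\<^sub>R w) \<le> \<psi> z"
  shows "dd w \<psi> z = 0" "dd w (dd w \<psi>) z \<le> 0"
proof -
  have "open ((\<lambda>s. z + s *\<^sub>R w) -` W)"
    using W by (intro open_vimage continuous_intros)
  moreover have "0 \<in> (\<lambda>s. z + s *\<^sub>R w) -` W" using z by simp
  ultimately obtain d where d: "d > 0" "ball 0 d \<subseteq> (\<lambda>s. z + s *\<^sub>R w) -` W"
    using openE by blast
  have in_W: "z + s *\<^sub>R w \<in> W" if "\<bar>s\<bar> < d" for s
    using d(2) that by (auto simp: dist_real_def)
  have D1: "((\<lambda>s. \<psi> (z + s *\<^sub>R w)) has_real_derivative dd w \<psi> (z + s *\<^sub>R w)) (at s)" if "\<bar>s\<bar> < d" for s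
    by (rule dd_real_line[OF \<psi> W in_W[OF that]])
  have D2: "((\<lambda>s. dd w \<psi> (z + s *\<^sub>R w)) has_real_derivative dd w (dd w \<psi>) z) (at 0)"
    using dd_real_line[OF smooth_on_dd[OF \<psi> W] W in_W, of 0 w] d(1) by simp
  show 0: "dd w \<psi> z = 0"
    using DERIV_local_max[OF D1[of 0] d(1)] max in_W d(1) by simp
  show "dd w (dd w \<psi>) z \<le> 0"
  proof (rule ccontr)
    assume "\<not> ?thesis"
    then obtain b where b: "b > 0" "\<And>s. 0 < s \<Longrightarrow> s < b \<Longrightarrow> dd w \<psi> (z + s *\<^sub>R w) > 0"
      using DERIV_pos_inc_right[OF D2] 0 by auto
    define r where "r = min b d / 2"
    have r: "0 < r" "r < b" "r < d" using b d by (auto simp: r_def)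
    obtain s where s: "0 < s" "s < r" "\<psi> (z + r *\<^sub>R w) - \<psi> (z + 0 *\<^sub>R w) = (r - 0) * dd w \<psi> (z + s *\<^sub>R w)"
      using MVT2[OF r(1), of "\<lambda>s. \<psi> (z + s *\<^sub>R w)" "\<lambda>s. dd w \<psi> (z + s *\<^sub>R w)"] D1 r by auto
    have "r * dd w \<psi> (z + s *\<^sub>R w) > 0" using s r b(2)[of s] by simp
    then show False using s(3) max[of r] in_W[of r] r by auto
  qed
qed

section \<open>The coordinate formulas as matrix calculus on space-time\<close>

locale local_flow =
  fixes U :: "(real^'n::finite) set" and T :: real
    and g h :: "real \<Rightarrow> 'n local_tensor"
  assumes U: "open U"
    and card: "CARD('n) \<ge> 4"
    and smooth_g: "smooth_on (U \<times> {0..<T}) (\<lambda>(x, t). g t x)"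
    and smooth_h: "smooth_on (U \<times> {0..<T}) (\<lambda>(x, t). h t x)"
    and g_sym: "x \<in> U \<Longrightarrow> t \<in> {0..<T} \<Longrightarrow> g t x $ i $ j = g t x $ j $ i"
    and h_sym: "x \<in> U \<Longrightarrow> t \<in> {0..<T} \<Longrightarrow> h t x $ i $ j = h t x $ j $ i"
    and g_pos: "x \<in> U \<Longrightarrow> t \<in> {0..<T} \<Longrightarrow> v \<noteq> 0 \<Longrightarrow> v \<bullet> (g t x *v v) > 0"
    and g_flow: "x \<in> U \<Longrightarrow> t \<in> {0..<T} \<Longrightarrow>
      ((\<lambda>s. g s x $ i $ j) has_real_derivative - 2 * ricci (g t) i j x) (at t within {0..<T})"
    and h_flow: "x \<in> U \<Longrightarrow> t \<in> {0..<T} \<Longrightarrow>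
      ((\<lambda>s. h s x $ i $ j) has_real_derivative lichnerowicz_rhs (g t) (h t) i j x) (at t within {0..<T})"
    and scal_pos: "x \<in> U \<Longrightarrow> t \<in> {0..<T} \<Longrightarrow> scal (g t) x > 0"
    and weyl_zero: "x \<in> U \<Longrightarrow> t \<in> {0..<T} \<Longrightarrow> weyl (g t) i k j l x = 0"
begin

text \<open>\<open>V\<close> includes the initial time and carries the continuity statements;
  \<open>W\<close> is open, so that all derivatives taken there are two-sided.\<close>

abbreviation V :: "((real^'n) \<times> real) set" where "V \<equiv> U \<times> {0..<T}"
abbreviation W :: "((real^'n) \<times> real) set" where "W \<equiv> U \<times> {0<..<T}"

definition G :: "(real^'n) \<times> real \<Rightarrow> real^'n^'n" where "G = (\<lambda>(x, t). g t x)"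
definition H :: "(real^'n) \<times> real \<Rightarrow> real^'n^'n" where "H = (\<lambda>(x, t). h t x)"
definition \<Gamma> :: "'n \<Rightarrow> (real^'n) \<times> real \<Rightarrow> real^'n^'n" where
  "\<Gamma> i = (\<lambda>(x, t). \<chi> m k. christoffel (g t) m i k x)"
definition e :: "'n \<Rightarrow> (real^'n) \<times> real" where "e i = (axis i 1, 0)"
definition \<tau> :: "(real^'n) \<times> real" where "\<tau> = (0, 1)"

lemma G_app: "G (x, t) = g t x" by (simp add: G_def)
lemma H_app: "H (x, t) = h t x" by (simp add: H_def)
lemma \<Gamma>_app: "\<Gamma> i (x, t) = (\<chi> m k. christoffel (g t) m i k x)" by (simp add: \<Gamma>_def)

lemma open_W: "open W" by (intro open_Times U open_greaterThanLessThan)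

lemma W_subset: "W \<subseteq> V" by auto

lemma invertible_g: "x \<in> U \<Longrightarrow> t \<in> {0..<T} \<Longrightarrow> invertible (g t x)"
  using orthonormal_frame[of "g t x"] g_pos g_sym by (metis transpose_nth vec_eq_iff)

lemma smooth_V_g: "smooth_on V (\<lambda>(x, t). g t x $ i $ j)"
  using smooth_on_vec_nth[OF smooth_on_vec_nth[OF smooth_g]] by (simp add: case_prod_beta')

lemma smooth_V_matrix_inv: "smooth_on V (\<lambda>(x, t). matrix_inv (g t x))"
  using smooth_on_matrix_inv[OF smooth_g] invertible_g by (auto simp: case_prod_beta')

lemma smooth_V_ginv: "smooth_on V (\<lambda>(x, t). ginv (g t) i j x)"
  using smooth_on_vec_nth[OF smooth_on_vec_nth[OF smooth_V_matrix_inv]] by (simp add: ginv_def case_prod_beta')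

lemma smooth_V_christoffel: "smooth_on V (\<lambda>(x, t). christoffel (g t) k i j x)"
proof -
  note * = smooth_V_ginv[unfolded case_prod_beta'] smooth_on_partial[OF smooth_V_g U, unfolded case_prod_beta']
  show ?thesis
    unfolding christoffel_def case_prod_beta' by (intro smooth_intros *) simp
qed

lemma smooth_V_curv: "smooth_on V (\<lambda>(x, t). curv (g t) m i j k x)"
proof -
  note * = smooth_V_christoffel[unfolded case_prod_beta']
    smooth_on_partial[OF smooth_V_christoffel U, unfolded case_prod_beta']
  show ?thesis
    unfolding curv_def case_prod_beta' by (intro smooth_intros *)
qed

lemma smooth_V_scal: "smooth_on V (\<lambda>(x, t). scal (g t) x)"
proof -
  note * = smooth_V_curv[unfolded case_prod_beta'] smooth_V_ginv[unfolded case_prod_beta']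
    smooth_V_g[unfolded case_prod_beta']
  show ?thesis
    unfolding scal_def ricci_def riem_def case_prod_beta' by (intro smooth_intros *)
qed

lemma smooth_W_G: "smooth_on W G"
  unfolding G_def by (rule smooth_on_subset[OF smooth_g W_subset])

lemma smooth_W_H: "smooth_on W H"
  unfolding H_def by (rule smooth_on_subset[OF smooth_h W_subset])

lemma smooth_W_\<Gamma>: "smooth_on W (\<Gamma> i)"
proof (rule smooth_on_matrix)
  fix m k
  show "smooth_on W (\<lambda>z. \<Gamma> i z $ m $ k)"
    using smooth_on_subset[OF smooth_V_christoffel W_subset, of m i k]
    by (simp add: \<Gamma>_def case_prod_beta')
qed

lemma partial_nth:
  assumes "smooth_on W \<Phi>" "(x, t) \<in> W" "\<And>y. y \<in> U \<Longrightarrow> f y = \<Phi> (y, t) $ a $ b"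
  shows "partial i f x = dd (e i) \<Phi> (x, t) $ a $ b"
proof -
  have "partial i f x = dd (axis i 1, 0) (\<lambda>z. \<Phi> z $ a $ b) (x, t)"
    using assms
    by (intro partial_eq_dd[where f = "\<lambda>_. f" and U = U and I = "{0<..<T}" and W = W])
      (auto intro!: smooth_intros U open_W)
  then show ?thesis
    using assms(1,2) by (simp add: dd_vec_nth[OF _ open_W] smooth_intros e_def)
qed

lemma transpose_G: "z \<in> V \<Longrightarrow> transpose (G z) = G z"
  by (auto simp: G_def vec_eq_iff transpose_nth g_sym)

lemma transpose_H: "z \<in> V \<Longrightarrow> transpose (H z) = H z"
  by (auto simp: H_def vec_eq_iff transpose_nth h_sym)

lemma metric_compatible:
  assumes z: "z \<in> W"
  shows "dd (e i) G z = transpose (\<Gamma> i z) ** G z + G z ** \<Gamma> i z"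
proof -
  obtain x t where xt: "z = (x, t)" "x \<in> U" "t \<in> {0<..<T}" using z by auto
  have p: "partial i (\<lambda>y. g t y $ a $ b) x = dd (e i) G z $ a $ b" for i a b
    unfolding xt(1) by (rule partial_nth[OF smooth_W_G]) (use xt in \<open>auto simp: G_def\<close>)
  \<comment> \<open>The Christoffel symbols with the upper index lowered. Adding the transpose
    cancels two of the three derivatives of the metric and doubles the third.\<close>
  define C where "C = (\<chi> l k. (dd (e i) G z $ k $ l + dd (e k) G z $ i $ l - dd (e l) G z $ i $ k) / 2)"
  have ddG: "dd (e k) G z $ a $ b = dd (e k) G z $ b $ a" for k a b
    unfolding p[symmetric] partial_def
    by (rule dd_cong[unfolded dd_def, OF U xt(2)]) (use xt(3) in \<open>auto simp: g_sym\<close>)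
  have "\<Gamma> i z = matrix_inv (G z) ** C"
    by (simp add: \<Gamma>_def xt(1) christoffel_def ginv_def vec_eq_iff mult_nth C_def G_def sum_divide_distrib
        p[unfolded xt(1), symmetric, unfolded G_def])
  then have "G z ** \<Gamma> i z = C"
    using invertible_g[OF xt(2)] xt(3) by (simp add: matrix_mul_assoc matrix_inv_inverse xt(1) G_def)
  moreover have "transpose (\<Gamma> i z) ** G z = transpose (G z ** \<Gamma> i z)"
    using transpose_G[OF subsetD[OF W_subset z]] by (simp add: matrix_transpose_mul)
  moreover have "dd (e i) G z = transpose C + C"
    by (simp add: vec_eq_iff transpose_nth C_def ddG[of i] field_simps)
  ultimately show ?thesis by simp
qed

sublocale levi_civita W e G \<Gamma>
proof
  show "z \<in> W \<Longrightarrow> \<Gamma> i z $ m $ k = \<Gamma> k z $ m $ i" for z i m k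
  proof -
    assume z: "z \<in> W"
    obtain x t where xt: "z = (x, t)" "x \<in> U" "t \<in> {0<..<T}" using z by auto
    have "partial l (\<lambda>y. g t y $ i $ k) x = partial l (\<lambda>y. g t y $ k $ i) x" for l
      unfolding partial_def by (rule dd_cong[unfolded dd_def, OF U xt(2)]) (use xt(3) in \<open>auto simp: g_sym\<close>)
    then show ?thesis by (simp add: \<Gamma>_def xt(1) christoffel_def add.commute)
  qed
  show "invertible (G z)" if "z \<in> W" for z
    using that invertible_g by (auto simp: G_def)
qed (use open_W smooth_W_G smooth_W_\<Gamma> transpose_G metric_compatible W_subset in blast)+

lemma gi_eq: "gi (x, t) = matrix_inv (g t x)"
  by (simp add: gi_def G_app)

lemma christoffel_eq: "christoffel (g t) m i k x = \<Gamma> i (x, t) $ m $ k"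
  by (simp add: \<Gamma>_app)

lemma ginv_eq: "ginv (g t) i j x = gi (x, t) $ i $ j"
  by (simp add: ginv_def gi_eq)

lemma curv_eq:
  assumes "(x, t) \<in> W"
  shows "curv (g t) m i j l x = F i j (x, t) $ m $ l"
proof -
  have "partial i (christoffel (g t) m j l) x = dd (e i) (\<Gamma> j) (x, t) $ m $ l" for i j
    by (rule partial_nth[OF smooth_W_\<Gamma> assms]) (simp add: \<Gamma>_app)
  then show ?thesis
    by (simp add: curv_def F_def mult_nth christoffel_eq sum_subtractf mult.commute)
qed

lemma ricci_eq:
  assumes xt: "(x, t) \<in> W"
  shows "ricci (g t) k l x = Ric (x, t) $ k $ l"
proof -
  let ?z = "(x, t)"
  have "ricci (g t) k l x
      = (\<Sum>i\<in>UNIV. \<Sum>j\<in>UNIV. \<Sum>m\<in>UNIV. gi ?z $ i $ j * G ?z $ j $ m * F i k ?z $ m $ l)"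
    by (simp add: ricci_def riem_def curv_eq[OF xt] ginv_eq G_app sum_distrib_left mult.assoc)
  also have "\<dots> = (\<Sum>i\<in>UNIV. \<Sum>m\<in>UNIV. (gi ?z ** G ?z) $ i $ m * F i k ?z $ m $ l)"
    unfolding mult_nth sum_distrib_right by (intro sum.cong refl sum.swap)
  also have "\<dots> = (\<Sum>i\<in>UNIV. (mat 1 ** F i k ?z) $ i $ l)"
    unfolding gi_inverse(1)[OF xt] mult_nth ..
  finally show ?thesis by (simp add: Ric_def)
qed

text \<open>At positive times the derivative within the half-open interval is the ordinary one, so
  the evolution equations become statements about \<open>dd \<tau>\<close>.\<close>

lemma slice_derivative:
  fixes \<phi> :: "(real^'n) \<times> real \<Rightarrow> real"
  assumes "smooth_on W \<phi>" "(x, t) \<in> W"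
    and "(f has_real_derivative D) (at t within {0..<T})" "\<And>s. s \<in> {0<..<T} \<Longrightarrow> f s = \<phi> (x, s)"
  shows "dd \<tau> \<phi> (x, t) = D"
proof -
  have t: "t \<in> {0<..<T}" using assms(2) by auto
  have "(f has_real_derivative D) (at t within {0<..<T})"
    by (rule has_field_derivative_subset[OF assms(3)]) auto
  then have "(f has_real_derivative D) (at t)"
    using at_within_open[OF t open_greaterThanLessThan] by simp
  then have "((\<lambda>s. \<phi> (x, s)) has_real_derivative D) (at t)"
    by (rule has_field_derivative_transform_within_open[OF _ open_greaterThanLessThan t]) (rule assms(4))
  then show ?thesis
    using DERIV_slice_eq_dd[OF assms(1) open_W assms(2)] DERIV_unique unfolding \<tau>_def by blast
qed

lemma slice_derivative_nth:
  assumes "smooth_on W \<Phi>" "(x, t) \<in> W"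
    and "((\<lambda>s. f s $ i $ j) has_real_derivative D) (at t within {0..<T})"
    and "\<And>s. s \<in> {0<..<T} \<Longrightarrow> f s = \<Phi> (x, s)"
  shows "dd \<tau> \<Phi> (x, t) $ i $ j = D"
proof -
  have "dd \<tau> (\<lambda>z. \<Phi> z $ i $ j) (x, t) = D"
    by (rule slice_derivative[OF _ assms(2,3)]) (auto intro!: smooth_intros assms(1) simp: assms(4))
  then show ?thesis
    by (simp add: dd_vec_nth[OF _ open_W assms(2)] smooth_intros assms(1))
qed

lemma dd_\<tau>_G:
  assumes "z \<in> W"
  shows "dd \<tau> G z = - (2 *\<^sub>R Ric z)"
proof -
  obtain x t where xt: "z = (x, t)" "x \<in> U" "t \<in> {0..<T}" "(x, t) \<in> W" using assms by auto
  have "dd \<tau> G z $ i $ j = - 2 * ricci (g t) i j x" for i j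
    unfolding xt(1) by (rule slice_derivative_nth[OF smooth_W_G xt(4) g_flow[OF xt(2,3)]]) (simp add: G_app)
  then show ?thesis by (simp add: vec_eq_iff xt(1) ricci_eq[OF xt(4)])
qed

text \<open>\<open>Ric = -\<partial>\<^sub>t g / 2\<close> inherits its symmetry from \<open>g\<close>, without the pair symmetry of the
  curvature tensor.\<close>

lemma transpose_Ric:
  assumes z: "z \<in> W"
  shows "transpose (Ric z) = Ric z"
proof -
  have "transpose (dd \<tau> G z) = dd \<tau> (\<lambda>y. transpose (G y)) z"
    by (rule dd_transpose[OF smooth_W_G open_W z, symmetric])
  also have "\<dots> = dd \<tau> G z"
    by (rule dd_cong[OF open_W z]) (use transpose_G W_subset in blast)
  finally show ?thesis by (simp add: dd_\<tau>_G[OF z] transpose_simps)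
qed

sublocale ricci_flow W e G \<Gamma> \<tau>
  by standard (simp_all add: transpose_Ric dd_\<tau>_G)

lemma scal_eq:
  assumes xt: "(x, t) \<in> W"
  shows "scal (g t) x = R (x, t)"
proof -
  have "Ric (x, t) $ k $ l = Ric (x, t) $ l $ k" for k l
    using transpose_Ric[OF xt] by (metis transpose_nth)
  then show ?thesis
    by (simp add: scal_def R_def trace_mult ricci_eq[OF xt] ginv_eq)
qed

lemma nabla_eq:
  assumes xt: "(x, t) \<in> W"
  shows "nabla (g t) (h t) k i j x = cov k H (x, t) $ i $ j"
proof -
  have "partial k (\<lambda>y. h t y $ i $ j) x = dd (e k) H (x, t) $ i $ j"
    by (rule partial_nth[OF smooth_W_H xt]) (simp add: H_app)
  then show ?thesis
    by (simp add: nabla_def cov_def mult_nth transpose_nth christoffel_eq H_app sum.distrib algebra_simps)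
qed

lemma nabla2_eq:
  assumes xt: "(x, t) \<in> W"
  shows "nabla2 (g t) (h t) k l i j x = cov2 k l H (x, t) $ i $ j"
proof -
  have "partial k (nabla (g t) (h t) l i j) x = dd (e k) (cov l H) (x, t) $ i $ j"
    by (rule partial_nth[OF smooth_cov[OF smooth_W_H] xt]) (use xt in \<open>auto intro: nabla_eq\<close>)
  then show ?thesis
    by (simp add: nabla2_def cov2_def cov_def[of k "cov l H"] mult_nth transpose_nth christoffel_eq
        nabla_eq[OF xt] sum.distrib algebra_simps)
qed

lemma rough_laplacian_eq:
  assumes xt: "(x, t) \<in> W"
  shows "rough_laplacian (g t) (h t) i j x = lap_tensor H (x, t) $ i $ j"
  by (simp add: rough_laplacian_def lap_tensor_def nabla2_eq[OF xt] ginv_eq)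

text \<open>The zeroth-order term R_ikjl h_kl of the equation for h, with the curvature replaced by
  its expression in \<open>Ric\<close>, \<open>R\<close> and the metric when the Weyl tensor
  vanishes.\<close>

definition Q :: "(real^'n) \<times> real \<Rightarrow> real^'n^'n" where
  "Q z = (1 / (real CARD('n) - 2)) *\<^sub>R (trace (Ric z ** gi z ** H z ** gi z) *\<^sub>R G z + trace (gi z ** H z) *\<^sub>R Ric z
      - H z ** gi z ** Ric z - Ric z ** gi z ** H z)
    - (R z / ((real CARD('n) - 1) * (real CARD('n) - 2))) *\<^sub>R (trace (gi z ** H z) *\<^sub>R G z - H z)"

lemma curvature_term_eq:
  assumes xt: "(x, t) \<in> W"
  shows "(\<Sum>k\<in>UNIV. \<Sum>l\<in>UNIV. \<Sum>p\<in>UNIV. \<Sum>q\<in>UNIV.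
     ginv (g t) k p x * ginv (g t) l q x * riem (g t) i k j l x * h t x $ p $ q) = Q (x, t) $ i $ j"
proof -
  let ?z = "(x, t)"
  let ?c = "1 / (real CARD('n) - 2)" and ?d = "R ?z / ((real CARD('n) - 1) * (real CARD('n) - 2))"
  \<comment> \<open>h with both indices raised; each summand of the Weyl-free curvature then
    contracts with it to a trace or a matrix product.\<close>
  define K where "K = gi ?z ** H ?z ** gi ?z"
  have symm: "transpose (gi ?z) = gi ?z" "transpose (H ?z) = H ?z" "transpose (Ric ?z) = Ric ?z"
    "transpose (G ?z) = G ?z"
    using gi_sym[OF xt] transpose_Ric[OF xt] transpose_H[OF subsetD[OF W_subset xt]] G_sym[OF xt] by simp_all
  have KT: "transpose K = K"
    by (simp add: K_def matrix_transpose_mul symm matrix_mul_assoc)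
  have nth_sym: "K $ k $ l = K $ l $ k" "G ?z $ k $ l = G ?z $ l $ k" "Ric ?z $ k $ l = Ric ?z $ l $ k" for k l
    using arg_cong[OF KT, of "\<lambda>X. X $ l $ k"] arg_cong[OF symm(4), of "\<lambda>X. X $ l $ k"]
      arg_cong[OF symm(3), of "\<lambda>X. X $ l $ k"] by (simp_all add: transpose_nth)
  have K_nth: "K $ k $ l = (\<Sum>p\<in>UNIV. \<Sum>q\<in>UNIV. gi ?z $ k $ p * gi ?z $ l $ q * H ?z $ p $ q)" for k l
  proof -
    have "K $ k $ l = (\<Sum>q\<in>UNIV. \<Sum>p\<in>UNIV. gi ?z $ k $ p * gi ?z $ l $ q * H ?z $ p $ q)"
      by (simp add: K_def mult_nth gi_sym_nth[OF xt, of _ l] sum_distrib_left sum_distrib_right mult_ac)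
    then show ?thesis by (subst sum.swap)
  qed
  have riem: "riem (g t) i k j l x = ?c * (G ?z $ i $ j * Ric ?z $ k $ l + G ?z $ k $ l * Ric ?z $ i $ j
      - G ?z $ i $ l * Ric ?z $ k $ j - G ?z $ k $ j * Ric ?z $ i $ l)
      - ?d * (G ?z $ i $ j * G ?z $ k $ l - G ?z $ i $ l * G ?z $ k $ j)" for k l
    using weyl_zero[of x t i k j l] nth_sym(2)[of j k] nth_sym(3)[of j k] xt
    by (simp add: weyl_def ricci_eq[OF xt] scal_eq[OF xt] G_app)
  have "(\<Sum>k\<in>UNIV. \<Sum>l\<in>UNIV. \<Sum>p\<in>UNIV. \<Sum>q\<in>UNIV.
     ginv (g t) k p x * ginv (g t) l q x * riem (g t) i k j l x * h t x $ p $ q)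
     = (\<Sum>k\<in>UNIV. \<Sum>l\<in>UNIV. riem (g t) i k j l x * K $ k $ l)"
    unfolding K_nth sum_distrib_left by (simp add: ginv_eq H_app mult_ac)
  also have "\<dots> = ?c * (G ?z $ i $ j * (\<Sum>k\<in>UNIV. \<Sum>l\<in>UNIV. Ric ?z $ k $ l * K $ l $ k)
      + (\<Sum>k\<in>UNIV. \<Sum>l\<in>UNIV. G ?z $ k $ l * K $ l $ k) * Ric ?z $ i $ j
      - (\<Sum>k\<in>UNIV. \<Sum>l\<in>UNIV. G ?z $ i $ l * K $ l $ k * Ric ?z $ k $ j)
      - (\<Sum>k\<in>UNIV. \<Sum>l\<in>UNIV. Ric ?z $ i $ l * K $ l $ k * G ?z $ k $ j))
      - ?d * (G ?z $ i $ j * (\<Sum>k\<in>UNIV. \<Sum>l\<in>UNIV. G ?z $ k $ l * K $ l $ k)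
      - (\<Sum>k\<in>UNIV. \<Sum>l\<in>UNIV. G ?z $ i $ l * K $ l $ k * G ?z $ k $ j))"
    unfolding riem sum_distrib_left sum_distrib_right sum.distrib[symmetric] sum_subtractf[symmetric]
    by (intro sum.cong refl)
      (subst nth_sym(1), simp add: algebra_simps)
  also have "(\<Sum>k\<in>UNIV. \<Sum>l\<in>UNIV. Ric ?z $ k $ l * K $ l $ k) = trace (Ric ?z ** gi ?z ** H ?z ** gi ?z)"
    by (simp add: trace_mult[symmetric] K_def matrix_mul_assoc)
  also have "(\<Sum>k\<in>UNIV. \<Sum>l\<in>UNIV. G ?z $ k $ l * K $ l $ k) = trace (gi ?z ** H ?z)"
  proof -
    have "trace (G ?z ** K) = trace (H ?z ** gi ?z)"
      by (simp add: K_def matrix_mul_assoc gi_inverse[OF xt])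
    then show ?thesis by (simp add: trace_mult[symmetric] trace_mul_sym[of "gi ?z"])
  qed
  also have "(\<Sum>k\<in>UNIV. \<Sum>l\<in>UNIV. G ?z $ i $ l * K $ l $ k * Ric ?z $ k $ j) = (G ?z ** K ** Ric ?z) $ i $ j"
    by (simp add: mult_nth sum_distrib_right)
  also have "G ?z ** K ** Ric ?z = H ?z ** gi ?z ** Ric ?z"
    by (simp add: K_def matrix_mul_assoc gi_inverse[OF xt])
  also have "(\<Sum>k\<in>UNIV. \<Sum>l\<in>UNIV. Ric ?z $ i $ l * K $ l $ k * G ?z $ k $ j) = (Ric ?z ** K ** G ?z) $ i $ j"
    by (simp add: mult_nth sum_distrib_right)
  also have "Ric ?z ** K ** G ?z = Ric ?z ** gi ?z ** H ?z"
    by (simp add: K_def matrix_mul_assoc gi_G_cancel[OF xt])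
  also have "(\<Sum>k\<in>UNIV. \<Sum>l\<in>UNIV. G ?z $ i $ l * K $ l $ k * G ?z $ k $ j) = (G ?z ** K ** G ?z) $ i $ j"
    by (simp add: mult_nth sum_distrib_right)
  also have "G ?z ** K ** G ?z = H ?z"
    by (simp add: K_def matrix_mul_assoc gi_inverse[OF xt] gi_G_cancel[OF xt])
  finally show ?thesis by (simp add: Q_def mult.commute)
qed

lemma dd_\<tau>_H:
  assumes "z \<in> W"
  shows "dd \<tau> H z = lap_tensor H z + 2 *\<^sub>R Q z - Ric z ** gi z ** H z - H z ** gi z ** Ric z"
proof -
  obtain x t where xt: "z = (x, t)" "x \<in> U" "t \<in> {0..<T}" "(x, t) \<in> W" using assms by auto
  have "dd \<tau> H z $ i $ j = lichnerowicz_rhs (g t) (h t) i j x" for i j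
    unfolding xt(1) by (rule slice_derivative_nth[OF smooth_W_H xt(4) h_flow[OF xt(2,3)]]) (simp add: H_app)
  moreover have "(\<Sum>k\<in>UNIV. \<Sum>p\<in>UNIV. ginv (g t) k p x * ricci (g t) a k x * h t x $ p $ b)
      = (Ric z ** gi z ** H z) $ a $ b" for a b
  proof -
    have "(Ric z ** gi z ** H z) $ a $ b = (\<Sum>p\<in>UNIV. \<Sum>k\<in>UNIV. Ric z $ a $ k * gi z $ k $ p * H z $ p $ b)"
      by (simp add: mult_nth sum_distrib_right)
    then show ?thesis
      by (subst sum.swap) (simp add: ginv_eq ricci_eq[OF xt(4)] xt(1) H_app mult_ac)
  qed
  moreover have "(Ric z ** gi z ** H z) $ j $ i = (H z ** gi z ** Ric z) $ i $ j" for i j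
  proof -
    have "transpose (Ric z ** gi z ** H z) = H z ** gi z ** Ric z"
      using assms transpose_H[OF subsetD[OF W_subset assms]]
      by (simp add: matrix_transpose_mul gi_sym transpose_Ric matrix_mul_assoc)
    then show ?thesis by (metis transpose_nth)
  qed
  ultimately show ?thesis
    by (simp add: vec_eq_iff lichnerowicz_rhs_def curvature_term_eq[OF xt(4)] rough_laplacian_eq[OF xt(4)] xt(1))
qed

definition f :: "(real^'n) \<times> real \<Rightarrow> real" where
  "f z = trace (gi z ** H z ** gi z ** H z)"

definition grad_H :: "(real^'n) \<times> real \<Rightarrow> real" where
  "grad_H z = (\<Sum>k\<in>UNIV. \<Sum>l\<in>UNIV. gi z $ k $ l * trace (gi z ** cov k H z ** gi z ** cov l H z))"

text \<open>The time derivatives of the two inverse metrics contribute four times tr(Ric h h), which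
  the two Ricci terms in the equation for h cancel exactly.\<close>

lemma dd_\<tau>_f:
  assumes z: "z \<in> W"
  shows "dd \<tau> f z = lap f z - 2 * grad_H z + 4 * trace (gi z ** Q z ** gi z ** H z)"
proof -
  have "trace (gi z ** H z ** gi z ** Ric z ** gi z ** H z) = trace (gi z ** Ric z ** gi z ** H z ** gi z ** H z)"
    using trace_mul_sym[of "gi z ** H z" "gi z ** Ric z ** gi z ** H z"] by (simp add: matrix_mul_assoc)
  then show ?thesis
    unfolding f_def[abs_def] dd_\<tau>_trace_gi2[OF smooth_W_H z] lap_trace_gi2[OF smooth_W_H z] grad_H_def dd_\<tau>_H[OF z]
    by (simp add: matrix_mult_simps trace_simps \<rho>_def)
qed

lemma frame_exists:
  assumes "(x, t) \<in> V"
  obtains P :: "real^'n^'n" where "transpose P ** G (x, t) ** P = mat 1" "gi (x, t) = P ** transpose P"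
  using orthonormal_frame[of "g t x"] g_pos[of x t] transpose_G[OF assms] assms
  by (auto simp: G_app gi_def)

text \<open>Conjugation by an orthonormal frame turns the metric into the identity and every trace
  into the Euclidean one of \<open>weyl_free_curvature_bound\<close>.\<close>

lemma curvature_term_bound:
  assumes z: "z \<in> W"
  shows "R z * trace (gi z ** Q z ** gi z ** H z) \<le> trace (\<rho> z ** \<rho> z) * f z"
proof -
  obtain x t where xt: "z = (x, t)" by (cases z)
  obtain P :: "real^'n^'n" where P: "transpose P ** G z ** P = mat 1" "gi z = P ** transpose P"
    using frame_exists[of x t] z W_subset unfolding xt by blast
  define S where "S = transpose P ** Ric z ** P"
  define K where "K = transpose P ** H z ** P"
  have HT: "transpose (H z) = H z" using transpose_H W_subset z by blast
  have SK: "transpose S = S" "transpose K = K"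
    by (simp_all add: S_def K_def matrix_transpose_mul transpose_Ric[OF z] HT matrix_mul_assoc)
  have cyc: "trace (P ** transpose P ** X) = trace (transpose P ** X ** P)" for X
    using trace_mul_sym[of P "transpose P ** X"] by (simp add: matrix_mul_assoc)
  have R: "R z = trace S"
    by (simp add: R_def P(2) S_def cyc)
  have f: "f z = trace (K ** K)"
    using cyc[of "H z ** P ** transpose P ** H z"] by (simp add: f_def P(2) K_def matrix_mul_assoc)
  have rr: "trace (\<rho> z ** \<rho> z) = trace (S ** S)"
    using cyc[of "Ric z ** P ** transpose P ** Ric z"] by (simp add: \<rho>_def P(2) S_def matrix_mul_assoc)
  have trK: "trace (gi z ** H z) = trace K"
    by (simp add: P(2) K_def cyc)
  have trSK: "trace (Ric z ** gi z ** H z ** gi z) = trace (S ** K)"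
    using cyc[of "Ric z ** P ** transpose P ** H z"] trace_mul_sym[of "Ric z ** gi z ** H z" "gi z"]
    by (simp add: P(2) S_def K_def matrix_mul_assoc)
  let ?c = "1 / (real CARD('n) - 2)" and ?d = "R z / ((real CARD('n) - 1) * (real CARD('n) - 2))"
  have PQP: "transpose P ** Q z ** P = ?c *\<^sub>R (trace (S ** K) *\<^sub>R mat 1 + trace K *\<^sub>R S - K ** S - S ** K)
      - ?d *\<^sub>R (trace K *\<^sub>R mat 1 - K)"
    unfolding Q_def trSK trK
    by (simp add: matrix_mult_simps P(1)) (simp add: P(2) S_def K_def matrix_mul_assoc)
  have "trace (gi z ** Q z ** gi z ** H z) = trace ((transpose P ** Q z ** P) ** K)"
    using cyc[of "Q z ** P ** transpose P ** H z"] by (simp add: P(2) K_def matrix_mul_assoc)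
  also have "\<dots> = 2 * ?c * (trace K * trace (S ** K) - trace (S ** K ** K))
      - ?d * ((trace K)\<^sup>2 - trace (K ** K))"
  proof -
    have "trace (K ** S ** K) = trace (S ** K ** K)"
      using trace_mul_sym[of K "S ** K"] by (simp add: matrix_mul_assoc)
    then show ?thesis
      unfolding PQP by (simp add: matrix_mult_simps trace_simps power2_eq_square algebra_simps diff_divide_distrib)
  qed
  finally have "trace (gi z ** Q z ** gi z ** H z) = \<dots>" .
  then show ?thesis
    using weyl_free_curvature_bound[OF SK] card unfolding R f rr by simp
qed

lemma trace_frame:
  assumes P: "gi z = P ** transpose (P :: real^'n^'n)"
  shows "trace (gi z ** X ** gi z ** Y) = trace ((transpose P ** X ** P) ** (transpose P ** Y ** P))"
  using trace_mul_sym[of P "transpose P ** X ** P ** transpose P ** Y"] by (simp add: P matrix_mul_assoc)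

lemma gi_sum_frame:
  assumes P: "gi z = P ** transpose (P :: real^'n^'n)"
  shows "(\<Sum>k\<in>UNIV. \<Sum>l\<in>UNIV. gi z $ k $ l * b k l)
    = (\<Sum>a\<in>UNIV. \<Sum>k\<in>UNIV. \<Sum>l\<in>UNIV. P $ k $ a * P $ l $ a * b k l)"
proof -
  have "(\<Sum>k\<in>UNIV. \<Sum>l\<in>UNIV. gi z $ k $ l * b k l)
      = (\<Sum>k\<in>UNIV. \<Sum>l\<in>UNIV. \<Sum>a\<in>UNIV. P $ k $ a * P $ l $ a * b k l)"
    by (simp add: P mult_nth transpose_nth sum_distrib_right)
  also have "\<dots> = (\<Sum>k\<in>UNIV. \<Sum>a\<in>UNIV. \<Sum>l\<in>UNIV. P $ k $ a * P $ l $ a * b k l)"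
    by (intro sum.cong refl sum.swap)
  also have "\<dots> = (\<Sum>a\<in>UNIV. \<Sum>k\<in>UNIV. \<Sum>l\<in>UNIV. P $ k $ a * P $ l $ a * b k l)"
    by (rule sum.swap)
  finally show ?thesis .
qed

lemma f_frame:
  assumes V: "(x, t) \<in> V" and P: "gi (x, t) = P ** transpose (P :: real^'n^'n)"
  defines "K \<equiv> transpose P ** H (x, t) ** P"
  shows "transpose K = K" "f (x, t) = K \<bullet> K"
proof -
  show "transpose K = K"
    by (simp add: K_def matrix_transpose_mul transpose_H[OF V] matrix_mul_assoc)
  then show "f (x, t) = K \<bullet> K"
    by (simp add: f_def trace_frame[OF P] K_def[symmetric] inner_matrix)
qed

lemma f_nonneg: "(x, t) \<in> V \<Longrightarrow> f (x, t) \<ge> 0"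
  using frame_exists[of x t] f_frame(2)[of x t] by (metis inner_ge_zero)

lemma tensor_norm_eq:
  assumes V: "(x, t) \<in> V"
  shows "tensor_norm (g t) (h t) x = sqrt (f (x, t))"
proof -
  let ?z = "(x, t)"
  obtain P :: "real^'n^'n" where "gi ?z = P ** transpose P" using frame_exists[OF V] by blast
  then have gT: "transpose (gi ?z) = gi ?z" by (simp add: matrix_transpose_mul)
  have sym: "gi ?z $ i $ j = gi ?z $ j $ i" for i j
    using arg_cong[OF gT, of "\<lambda>X. X $ j $ i"] by (simp add: transpose_nth)
  have "f ?z = trace (transpose (H ?z) ** (gi ?z ** H ?z ** gi ?z))"
    using trace_mul_sym[of "H ?z" "gi ?z ** H ?z ** gi ?z"]
    by (simp add: f_def transpose_H[OF V] matrix_mul_assoc)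
  also have "\<dots> = H ?z \<bullet> (gi ?z ** H ?z ** gi ?z)"
    by (simp add: inner_matrix)
  also have "\<dots> = (\<Sum>i\<in>UNIV. \<Sum>j\<in>UNIV. \<Sum>l\<in>UNIV. \<Sum>k\<in>UNIV.
      gi ?z $ i $ k * gi ?z $ j $ l * H ?z $ i $ j * H ?z $ k $ l)"
    by (simp add: inner_vec_def mult_nth sum_distrib_left sum_distrib_right sym[of _ "_::'n"] mult_ac)
  also have "\<dots> = (\<Sum>i\<in>UNIV. \<Sum>j\<in>UNIV. \<Sum>k\<in>UNIV. \<Sum>l\<in>UNIV.
      gi ?z $ i $ k * gi ?z $ j $ l * H ?z $ i $ j * H ?z $ k $ l)"
    by (intro sum.cong refl sum.swap)
  finally show ?thesis by (simp add: tensor_norm_def ginv_eq H_app)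
qed

lemma continuous_on_f: "continuous_on V f"
proof -
  have "smooth_on V (\<lambda>z. trace ((\<lambda>(x, t). matrix_inv (g t x)) z ** (\<lambda>(x, t). h t x) z **
      (\<lambda>(x, t). matrix_inv (g t x)) z ** (\<lambda>(x, t). h t x) z))"
    by (intro smooth_on_trace smooth_on_matrix_mult smooth_h smooth_V_matrix_inv)
  then show ?thesis
    by (rule smooth_on_imp_continuous_on[THEN continuous_on_eq]) (auto simp: f_def gi_eq H_app)
qed

lemma continuous_on_ratio:
  "continuous_on V (\<lambda>z. f z / (scal (g (snd z)) (fst z))\<^sup>2)"
proof -
  have "continuous_on V (\<lambda>z. scal (g (snd z)) (fst z))"
    using smooth_on_imp_continuous_on[OF smooth_V_scal] by (simp add: case_prod_beta')
  moreover have "(scal (g (snd z)) (fst z))\<^sup>2 \<noteq> 0" if "z \<in> V" for z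
    using scal_pos[of "fst z" "snd z"] that by auto
  ultimately show ?thesis
    by (intro continuous_on_divide continuous_on_f continuous_on_power ballI)
qed

lemma smooth_f: "smooth_on W f"
  unfolding f_def[abs_def] by (intro smooth_intros smooth_gi smooth_W_H)

lemma transpose_cov_H: "z \<in> W \<Longrightarrow> transpose (cov k H z) = cov k H z"
proof -
  assume z: "z \<in> W"
  have H: "transpose (H y) = H y" if "y \<in> W" for y
    using transpose_H W_subset that by blast
  have "transpose (dd (e k) H z) = dd (e k) (\<lambda>y. transpose (H y)) z"
    by (rule dd_transpose[OF smooth_W_H open_W z, symmetric])
  also have "\<dots> = dd (e k) H z"
    by (rule dd_cong[OF open_W z H])
  finally show "transpose (cov k H z) = cov k H z"
    by (simp add: cov_def transpose_simps matrix_transpose_mul H[OF z])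
qed

text \<open>The hypotheses say that \<open>z\<close> is a critical point of \<open>f / R\<^sup>2\<close>, with value \<open>C\<close>.\<close>

lemma kato:
  assumes z: "z \<in> W" and C: "f z = C * (R z * R z)" and Rpos: "R z > 0"
    and crit: "\<And>k. dd (e k) f z = 2 * C * (R z * dd (e k) R z)"
  shows "C * (\<Sum>k\<in>UNIV. \<Sum>l\<in>UNIV. gi z $ k $ l * (dd (e k) R z * dd (e l) R z)) \<le> grad_H z"
proof -
  obtain x t where xt: "z = (x, t)" "(x, t) \<in> V" using z W_subset by (cases z) auto
  obtain P :: "real^'n^'n" where P: "gi z = P ** transpose P" using frame_exists[OF xt(2)] xt(1) by blast
  define K where "K = transpose P ** H z ** P"
  define c where "c k = transpose P ** cov k H z ** P" for k
  \<comment> \<open>\<open>D a\<close> and, below, \<open>r a\<close> are the derivatives of h and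
    of R along the a-th frame vector. The inequality is proved for each of these directions
    separately and then summed.\<close>
  define D where "D a = (\<Sum>k\<in>UNIV. P $ k $ a *\<^sub>R c k)" for a
  define r where "r a = (\<Sum>k\<in>UNIV. P $ k $ a * dd (e k) R z)" for a
  have cT: "transpose (c k) = c k" for k
    by (simp add: c_def matrix_transpose_mul transpose_cov_H[OF z] matrix_mul_assoc)
  have f: "f z = K \<bullet> K" using f_frame(2)[OF xt(2) P[unfolded xt(1)]] by (simp add: K_def xt(1))
  have gradH: "grad_H z = (\<Sum>a\<in>UNIV. D a \<bullet> D a)"
  proof -
    have "trace (gi z ** cov k H z ** gi z ** cov l H z) = c k \<bullet> c l" for k l
      by (simp add: trace_frame[OF P] c_def[symmetric] inner_matrix cT)
    then show ?thesis
      unfolding grad_H_def gi_sum_frame[OF P]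
      by (simp add: D_def inner_sum_left inner_sum_right sum_distrib_left mult_ac inner_commute)
  qed
  have gradR: "(\<Sum>k\<in>UNIV. \<Sum>l\<in>UNIV. gi z $ k $ l * (dd (e k) R z * dd (e l) R z)) = (\<Sum>a\<in>UNIV. (r a)\<^sup>2)"
    unfolding gi_sum_frame[OF P] by (simp add: r_def power2_eq_square sum_product mult_ac)
  have cK: "c k \<bullet> K = C * R z * dd (e k) R z" for k
  proof -
    have "dd (e k) f z = trace (gi z ** cov k H z ** gi z ** H z) + trace (gi z ** H z ** gi z ** cov k H z)"
      unfolding f_def[abs_def] by (rule dd_trace_gi2[OF smooth_W_H smooth_W_H z])
    also have "\<dots> = trace (c k ** K) + trace (K ** c k)"
      by (simp add: trace_frame[OF P] c_def K_def)
    also have "\<dots> = 2 * (c k \<bullet> K)"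
      by (simp add: inner_matrix cT trace_mul_sym[of K])
    finally show ?thesis using crit[of k] by simp
  qed
  have DK: "D a \<bullet> K = C * R z * r a" for a
    by (simp add: D_def r_def inner_sum_left cK sum_distrib_left mult_ac)
  have "C * (r a)\<^sup>2 \<le> D a \<bullet> D a" for a
  \<comment> \<open>If h vanishes at the point, then C = 0 because R is positive; otherwise the
    factor \<open>f z\<close> can be cancelled from the Cauchy-Schwarz inequality.\<close>
  proof (cases "f z = 0")
    case True
    then show ?thesis using C Rpos by simp
  next
    case False
    then have "f z > 0" using f by (simp add: less_le)
    moreover have "(C * R z * r a)\<^sup>2 \<le> (D a \<bullet> D a) * f z"
      using Cauchy_Schwarz_ineq[of "D a" K] by (simp add: DK f)
    moreover have "(C * R z * r a)\<^sup>2 = (C * (r a)\<^sup>2) * f z"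
      by (simp add: C power2_eq_square)
    ultimately show ?thesis by (simp add: mult_le_cancel_right)
  qed
  then show ?thesis
    unfolding gradH gradR sum_distrib_left by (intro sum_mono)
qed

text \<open>The evolution equation makes the time derivative of \<psi> nonpositive at the point,
  whereas \<open>time_max\<close>, the maximality of u - \<epsilon> t in time after multiplication
  by R^2, forces it to be at least \<epsilon> R^2, which is positive.\<close>

lemma no_interior_max:
  assumes xt: "x \<in> U" "0 < t" "t < T" and \<epsilon>: "\<epsilon> > 0"
    and C: "f (x, t) = C * (scal (g t) x)\<^sup>2"
    and space_max: "\<And>y. y \<in> U \<Longrightarrow> f (y, t) \<le> C * (scal (g t) y)\<^sup>2"
    and time_max: "\<And>s. 0 < s \<Longrightarrow> s \<le> t \<Longrightarrow> f (x, s) \<le> (C - \<epsilon> * (t - s)) * (scal (g s) x)\<^sup>2"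
  shows False
proof -
  define z where "z = (x, t)"
  have z: "z \<in> W" using xt by (simp add: z_def)
  have Rpos: "R z > 0" using scal_pos[of x t] scal_eq[of x t] xt by (simp add: z_def)
  define \<psi> where "\<psi> y = f y - C * (R y * R y)" for y
  have smooth: "smooth_on W \<psi>"
    unfolding \<psi>_def[abs_def] by (intro smooth_intros smooth_f smooth_R)
  have fz: "f z = C * (R z * R z)" using C z by (simp add: z_def scal_eq power2_eq_square)
  then have \<psi>z: "\<psi> z = 0" by (simp add: \<psi>_def)
  have \<psi>_max: "\<psi> (y, t) \<le> 0" if "(y, t) \<in> W" for y
    using space_max[of y] that by (simp add: \<psi>_def scal_eq power2_eq_square)
  have test: "dd (v, 0) \<psi> z = 0" "dd (v, 0) (dd (v, 0) \<psi>) z \<le> 0" for v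
  proof -
    have "\<psi> (z + s *\<^sub>R (v, 0)) \<le> \<psi> z" if "z + s *\<^sub>R (v, 0) \<in> W" for s
      using \<psi>_max[of "x + s *\<^sub>R v"] that \<psi>z by (simp add: z_def)
    note second_derivative_test[OF smooth open_W z this]
    then show "dd (v, 0) \<psi> z = 0" "dd (v, 0) (dd (v, 0) \<psi>) z \<le> 0" by blast+
  qed
  have crit0: "dd (e k) \<psi> z = 0" for k
    unfolding e_def by (rule test(1))
  have dd\<psi>: "dd v \<psi> y = dd v f y - 2 * C * (R y * dd v R y)" if y: "y \<in> W" for v y
    unfolding \<psi>_def[abs_def]
    by (simp add: dd_diff[OF _ _ open_W y] dd_mult[OF _ _ open_W y] smooth_intros smooth_f smooth_R)
  have hess\<psi>: "hess k l \<psi> z = hess k l f z - 2 * C * (R z * hess k l R z + dd (e k) R z * dd (e l) R z)" for k l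
  proof -
    have "dd (e k) (dd (e l) \<psi>) z = dd (e k) (\<lambda>y. dd (e l) f y - 2 * C * (R y * dd (e l) R y)) z"
      by (rule dd_cong[OF open_W z dd\<psi>])
    also have "\<dots> = dd (e k) (dd (e l) f) z
        - 2 * C * (dd (e k) R z * dd (e l) R z + R z * dd (e k) (dd (e l) R) z)"
      by (simp add: dd_diff[OF _ _ open_W z] dd_mult[OF _ _ open_W z] smooth_intros smooth_f smooth_R open_W)
    finally show ?thesis
      by (simp add: hess_def dd\<psi>[OF z] sum_subtractf sum_distrib_left algebra_simps)
  qed
  define gradR where "gradR = (\<Sum>k\<in>UNIV. \<Sum>l\<in>UNIV. gi z $ k $ l * (dd (e k) R z * dd (e l) R z))"
  have lap\<psi>: "lap \<psi> z = lap f z - 2 * C * R z * lap R z - 2 * C * gradR"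
    by (simp add: lap_def hess\<psi> gradR_def sum_subtractf sum.distrib sum_distrib_left algebra_simps)
  have "lap \<psi> z \<le> 0"
  proof -
    obtain P :: "real^'n^'n" where P: "gi z = P ** transpose P"
      using frame_exists[of x t] xt unfolding z_def by auto
    have frame_nonpos: "(\<Sum>k\<in>UNIV. \<Sum>l\<in>UNIV. P $ k $ a * P $ l $ a * hess k l \<psi> z) \<le> 0" for a
    proof -
      let ?w = "\<Sum>k\<in>UNIV. P $ k $ a *\<^sub>R e k"
      have w: "?w = (\<Sum>k\<in>UNIV. P $ k $ a *\<^sub>R axis k 1, 0)"
        by (simp add: e_def prod_eq_iff fst_sum snd_sum)
      have dd_w: "dd ?w \<phi> y = (\<Sum>k\<in>UNIV. P $ k $ a * dd (e k) \<phi> y)"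
        if "smooth_on W \<phi>" "y \<in> W" for \<phi> :: "(real^'n) \<times> real \<Rightarrow> real" and y
        by (simp add: linear_sum[OF linear_dd[OF that(1) open_W that(2)]]
            linear_scale[OF linear_dd[OF that(1) open_W that(2)]])
      have "dd ?w (dd ?w \<psi>) z = dd ?w (\<lambda>y. \<Sum>k\<in>UNIV. P $ k $ a * dd (e k) \<psi> y) z"
        by (rule dd_cong[OF open_W z dd_w[OF smooth]])
      also have "\<dots> = (\<Sum>l\<in>UNIV. P $ l $ a * dd ?w (dd (e l) \<psi>) z)"
        by (simp add: dd_sum[OF _ open_W z] dd_mult[OF _ _ open_W z] smooth_intros smooth open_W)
      also have "\<dots> = (\<Sum>l\<in>UNIV. \<Sum>k\<in>UNIV. P $ k $ a * P $ l $ a * dd (e k) (dd (e l) \<psi>) z)"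
        by (simp add: dd_w[OF smooth_on_dd[OF smooth open_W] z] sum_distrib_left mult_ac)
      \<comment> \<open>At a critical point the Christoffel part of the Hessian vanishes, so the
        Hessian along a frame vector is a plain second derivative along a straight line.\<close>
      also have "\<dots> = (\<Sum>k\<in>UNIV. \<Sum>l\<in>UNIV. P $ k $ a * P $ l $ a * hess k l \<psi> z)"
        by (subst sum.swap) (simp add: hess_def crit0)
      finally have "dd ?w (dd ?w \<psi>) z = \<dots>" .
      moreover have "dd ?w (dd ?w \<psi>) z \<le> 0"
        unfolding w by (rule test(2))
      ultimately show ?thesis by simp
    qed
    show ?thesis
      unfolding lap_def gi_sum_frame[OF P] by (rule sum_nonpos) (rule frame_nonpos)
  qed
  have kato': "C * gradR \<le> grad_H z"
    unfolding gradR_def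
    by (rule kato[OF z fz Rpos]) (use crit0 dd\<psi>[OF z] in auto)
  define q where "q = trace (\<rho> z ** \<rho> z)"
  have evolution: "dd \<tau> \<psi> z = lap \<psi> z + 2 * (C * gradR - grad_H z)
      + 4 * (trace (gi z ** Q z ** gi z ** H z) - C * R z * q)"
    by (simp add: dd\<psi>[OF z] dd_\<tau>_f[OF z] scalar_curvature_evolution[OF z] lap\<psi> q_def algebra_simps)
  have "R z * (trace (gi z ** Q z ** gi z ** H z) - C * R z * q) \<le> 0"
    using curvature_term_bound[OF z] by (simp add: fz q_def algebra_simps)
  then have "trace (gi z ** Q z ** gi z ** H z) - C * R z * q \<le> 0"
    using Rpos by (simp add: mult_le_0_iff)
  then have nonpos: "dd \<tau> \<psi> z \<le> 0"
    unfolding evolution using \<open>lap \<psi> z \<le> 0\<close> kato' by simp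
  \<comment> \<open>By \<open>time_max\<close> this is nonpositive before time t; it is zero at t,
    yet its derivative there is negative.\<close>
  define \<eta> where "\<eta> s = \<psi> (x, s) + \<epsilon> * (t - s) * (R (x, s) * R (x, s))" for s
  have D: "((\<lambda>s. \<phi> (x, s)) has_real_derivative dd \<tau> \<phi> z) (at t)" if "smooth_on W \<phi>" for \<phi>
    unfolding \<tau>_def z_def by (rule DERIV_slice_eq_dd[OF that open_W z[unfolded z_def]])
  have "(\<eta> has_real_derivative dd \<tau> \<psi> z - \<epsilon> * (R z * R z)) (at t)"
    unfolding \<eta>_def
    by (rule derivative_eq_intros D[OF smooth] D[OF smooth_R] refl)+ (simp add: z_def)
  moreover have "dd \<tau> \<psi> z - \<epsilon> * (R z * R z) < 0"
    using nonpos mult_pos_pos[OF \<epsilon> mult_pos_pos[OF Rpos Rpos]] by linarith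
  ultimately obtain d where d: "d > 0" "\<And>s. 0 < s \<Longrightarrow> s < d \<Longrightarrow> \<eta> t < \<eta> (t - s)"
    using DERIV_neg_dec_left by blast
  define s where "s = min d t / 2"
  have s: "0 < s" "s < d" "s < t" using d(1) xt by (auto simp: s_def)
  have "\<eta> t = 0" using \<psi>z by (simp add: \<eta>_def z_def)
  moreover have "\<eta> (t - s) \<le> 0"
  proof -
    have "(x, t - s) \<in> W" using xt s by simp
    then show ?thesis
      using time_max[of "t - s"] s by (simp add: \<eta>_def \<psi>_def scal_eq power2_eq_square algebra_simps)
  qed
  ultimately show False using d(2)[OF s(1,2)] by simp
qed

end

section \<open>The flow on the manifold\<close>

lemma partial_cong:
  assumes "open U" "x \<in> U" "\<And>y. y \<in> U \<Longrightarrow> \<phi> y = \<psi> y"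
  shows "partial i \<phi> x = partial i \<psi> x"
  using dd_cong[OF assms] by (simp add: partial_def dd_def)

text \<open>Agreement at a single point would not do, since the scalar curvature contains second
  derivatives of the metric. This serves to compare flows that share only their initial
  fields.\<close>

lemma scal_cong:
  assumes U: "open U" "x \<in> U" and eq: "\<And>y. y \<in> U \<Longrightarrow> G y = G' y"
  shows "scal G x = scal G' x"
proof -
  have ginv: "ginv G i j y = ginv G' i j y" if "y \<in> U" for i j y
    using eq[OF that] by (simp add: ginv_def)
  have p: "partial k (\<lambda>y. G y $ i $ j) y = partial k (\<lambda>y. G' y $ i $ j) y" if "y \<in> U" for i j k y
    by (rule partial_cong[OF U(1) that]) (simp add: eq)
  have chr: "christoffel G k i j y = christoffel G' k i j y" if "y \<in> U" for i j k y
    by (simp add: christoffel_def ginv[OF that] p[OF that])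
  have "partial k (christoffel G m i j) x = partial k (christoffel G' m i j) x" for i j k m
    by (rule partial_cong[OF U]) (rule chr)
  then show ?thesis
    by (simp add: scal_def ricci_def riem_def curv_def chr[OF U(2)] ginv[OF U(2)] eq[OF U(2)])
qed

text \<open>The identity \<open>a ** matrix_inv a = mat 1\<close> exhibits a right inverse of J,
  which for square matrices is also a left inverse; invertibility of the Jacobian thus comes from
  that of the metric.\<close>

lemma matrix_inv_congruence:
  fixes a b J :: "real^'n^'n"
  assumes a: "invertible a" and ab: "a = J ** b ** transpose J"
  shows "matrix_inv b = transpose J ** matrix_inv a ** J"
proof -
  have "J ** (b ** transpose J ** matrix_inv a) = mat 1"
    using matrix_inv_inverse(1)[OF a] ab by (simp add: matrix_mul_assoc)
  then have "(b ** transpose J ** matrix_inv a) ** J = mat 1"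
    using matrix_left_right_inverse by blast
  then have 1: "b ** (transpose J ** matrix_inv a ** J) = mat 1"
    by (simp add: matrix_mul_assoc)
  then have 2: "(transpose J ** matrix_inv a ** J) ** b = mat 1"
    using matrix_left_right_inverse by blast
  have "invertible b" using 1 2 invertible_def by blast
  then show ?thesis
    using arg_cong[OF 2, of "\<lambda>X. X ** matrix_inv b"] matrix_inv_inverse(1)[of b]
    by (simp add: matrix_mul_assoc[symmetric])
qed

lemma double_sum_congruence:
  "(\<Sum>a\<in>UNIV. \<Sum>b\<in>UNIV. (J :: real^'n^'n) $ i $ a * J $ j $ b * S $ a $ b) = (J ** S ** transpose J) $ i $ j"
proof -
  have "(J ** S ** transpose J) $ i $ j = (\<Sum>b\<in>UNIV. \<Sum>a\<in>UNIV. J $ i $ a * J $ j $ b * S $ a $ b)"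
    by (simp add: mult_nth transpose_nth sum_distrib_left sum_distrib_right mult_ac)
  then show ?thesis by (subst sum.swap) simp
qed

locale manifold_flow =
  fixes M :: "'m::t2_space set" and \<A> :: "('m, 'n::finite) chart set"
    and T :: real and g h :: "real \<Rightarrow> ('m, 'n) field2"
  assumes card: "CARD('n) \<ge> 4" and manifold: "closed_manifold M \<A>" and T: "T > 0"
    and flow: "linearized_ricci_flow \<A> T g h"
    and scal_pos: "\<And>t. t \<in> {0..<T} \<Longrightarrow> positive_scalar_curvature \<A> (g t)"
    and weyl_zero: "\<And>t. t \<in> {0..<T} \<Longrightarrow> weyl_vanishes \<A> (g t)"
begin

lemma chart:
  assumes "c \<in> \<A>"
  shows "openin (top_of_set M) (chart_dom c)" "open (chart_ran c)"
    "homeomorphism (chart_dom c) (chart_ran c) (coord c) (inv_into (chart_dom c) (coord c))"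
  using manifold assms by (auto simp: closed_manifold_def smooth_atlas_def)

lemma cover: "(\<Union>c\<in>\<A>. chart_dom c) = M"
  using manifold by (simp add: closed_manifold_def smooth_atlas_def)

lemma compact_M: "compact M"
  using manifold by (simp add: closed_manifold_def)

lemma local_flow:
  assumes c: "c \<in> \<A>"
  shows "local_flow (chart_ran c) T (\<lambda>t. g t c) (\<lambda>t. h t c)"
proof
  show "open (chart_ran c)" by (rule chart(2)[OF c])
  show "4 \<le> CARD('n)" by (rule card)
  note flow' = flow[unfolded linearized_ricci_flow_def]
  show "smooth_on (chart_ran c \<times> {0..<T}) (\<lambda>(x, t). g t c x)"
    "smooth_on (chart_ran c \<times> {0..<T}) (\<lambda>(x, t). h t c x)"
    using flow' c by (simp_all add: smooth_family_def)
  fix x t i j and v :: "real^'n" and k l :: 'n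
  assume xt: "x \<in> chart_ran c" "t \<in> {0..<T}"
  show "g t c x $ i $ j = g t c x $ j $ i"
    using flow' c xt unfolding riemannian_metric_def symmetric_tensor_field_def by blast
  show "h t c x $ i $ j = h t c x $ j $ i"
    using flow' c xt unfolding symmetric_tensor_field_def by blast
  show "v \<noteq> 0 \<Longrightarrow> v \<bullet> (g t c x *v v) > 0"
    using flow' c xt unfolding riemannian_metric_def by blast
  show "((\<lambda>s. g s c x $ i $ j) has_real_derivative - 2 * ricci (g t c) i j x) (at t within {0..<T})"
    "((\<lambda>s. h s c x $ i $ j) has_real_derivative lichnerowicz_rhs (g t c) (h t c) i j x) (at t within {0..<T})"
    using flow' c xt by blast+
  show "scal (g t c) x > 0"
    using scal_pos[OF xt(2)] c xt(1) unfolding positive_scalar_curvature_def by blast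
  show "weyl (g t c) i k j l x = 0"
    using weyl_zero[OF xt(2)] c xt(1) unfolding weyl_vanishes_def by blast
qed

text \<open>The square of the quotient to be bounded, because |h| itself need not be differentiable
  where h vanishes.\<close>

definition ratio :: "('m, 'n) chart \<Rightarrow> 'm \<Rightarrow> real \<Rightarrow> real" where
  "ratio c p t = (tensor_norm (g t c) (h t c) (coord c p))\<^sup>2 / (scal (g t c) (coord c p))\<^sup>2"

text \<open>Chart independence of the scalar curvature comes for free along the flow: \<open>Ric\<close> is a tensor
  because \<open>-2 Ric = \<partial>\<^sub>t g\<close> and the transition maps do not depend on time.\<close>

lemma ratio_chart_independent:
  assumes c: "c \<in> \<A>" "p \<in> chart_dom c" and d: "d \<in> \<A>" "p \<in> chart_dom d" and t: "t \<in> {0..<T}"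
  shows "ratio c p t = ratio d p t"
proof -
  interpret C: local_flow "chart_ran c" T "\<lambda>t. g t c" "\<lambda>t. h t c" by (rule local_flow[OF c(1)])
  interpret D: local_flow "chart_ran d" T "\<lambda>t. g t d" "\<lambda>t. h t d" by (rule local_flow[OF d(1)])
  define x where "x = coord c p"
  define y where "y = coord d p"
  have tr: "transition c d x = y"
    using chart(3)[OF c(1)] c(2) by (simp add: transition_def x_def y_def homeomorphism_def)
  have x: "x \<in> coord c ` (chart_dom c \<inter> chart_dom d)" "x \<in> chart_ran c" and y: "y \<in> chart_ran d"
    using c(2) d(2) by (auto simp: x_def y_def)
  define J :: "real^'n^'n" where "J = (\<chi> i a. partial i (\<lambda>y. transition c d y $ a) x)"
  have transform: "S c x = J ** S d y ** transpose J" if "tensor_field \<A> S" for S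
  proof -
    have "S c x $ i $ j = (\<Sum>a\<in>UNIV. \<Sum>b\<in>UNIV.
        partial i (\<lambda>y. transition c d y $ a) x * partial j (\<lambda>y. transition c d y $ b) x *
        S d (transition c d x) $ a $ b)" for i j
      using that c(1) d(1) x(1) unfolding tensor_field_def by blast
    then have "S c x $ i $ j = (J ** S d y ** transpose J) $ i $ j" for i j
      unfolding double_sum_congruence[symmetric] by (simp add: J_def tr)
    then show ?thesis by (simp add: vec_eq_iff)
  qed
  have gT: "g s c x = J ** g s d y ** transpose J" and hT: "h s c x = J ** h s d y ** transpose J"
    if "s \<in> {0..<T}" for s
    using flow that
    by (auto intro!: transform simp: linearized_ricci_flow_def riemannian_metric_def symmetric_tensor_field_def)
  define Rc :: "real^'n^'n" where "Rc = (\<chi> i j. ricci (g t c) i j x)"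
  define Rd :: "real^'n^'n" where "Rd = (\<chi> i j. ricci (g t d) i j y)"
  have RT: "Rc = J ** Rd ** transpose J"
  proof -
    have "Rc $ i $ j = (J ** Rd ** transpose J) $ i $ j" for i j
    proof -
      have "((\<lambda>s. \<Sum>a\<in>UNIV. \<Sum>b\<in>UNIV. J $ i $ a * J $ j $ b * g s d y $ a $ b) has_real_derivative
          (\<Sum>a\<in>UNIV. \<Sum>b\<in>UNIV. J $ i $ a * J $ j $ b * (- 2 * ricci (g t d) a b y))) (at t within {0..<T})"
        by (intro DERIV_sum DERIV_cmult D.g_flow y t)
      then have "((\<lambda>s. g s c x $ i $ j) has_real_derivative
          (\<Sum>a\<in>UNIV. \<Sum>b\<in>UNIV. J $ i $ a * J $ j $ b * (- 2 * ricci (g t d) a b y))) (at t within {0..<T})"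
        unfolding has_field_derivative_def
        by (rule has_derivative_transform[OF t, rotated]) (simp add: gT double_sum_congruence)
      \<comment> \<open>Every point of the half-open interval, including 0, is an accumulation
        point, so the derivative within it is unique even when one-sided.\<close>
      moreover have "at t within {0..<T} \<noteq> bot"
        using t T by (simp add: trivial_limit_within islimpt_Ico)
      ultimately have "- 2 * ricci (g t c) i j x
          = (\<Sum>a\<in>UNIV. \<Sum>b\<in>UNIV. J $ i $ a * J $ j $ b * (- 2 * ricci (g t d) a b y))"
        using C.g_flow[OF x(2) t, of i j] vector_derivative_unique_within
        unfolding has_real_derivative_iff_has_vector_derivative by blast
      also have "\<dots> = - 2 * (J ** Rd ** transpose J) $ i $ j"
        unfolding double_sum_congruence[symmetric] by (simp add: Rd_def sum_distrib_left mult_ac)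
      finally show ?thesis by (simp add: Rc_def)
    qed
    then show ?thesis by (simp add: vec_eq_iff)
  qed
  define inv_c where "inv_c = matrix_inv (g t c x)"
  define inv_d where "inv_d = matrix_inv (g t d y)"
  have inv: "inv_d = transpose J ** inv_c ** J"
    unfolding inv_c_def inv_d_def by (rule matrix_inv_congruence[OF C.invertible_g[OF x(2) t] gT[OF t]])
  have "scal (g t c) x = trace (transpose inv_c ** Rc)"
    by (simp add: scal_def ginv_def inner_matrix[symmetric] inner_vec_def inv_c_def Rc_def)
  also have "\<dots> = trace (transpose inv_d ** Rd)"
    using trace_mul_sym[of "transpose inv_c ** J ** Rd" "transpose J"]
    by (simp add: RT inv matrix_transpose_mul matrix_mul_assoc)
  also have "\<dots> = scal (g t d) y"
    by (simp add: scal_def ginv_def inner_matrix[symmetric] inner_vec_def inv_d_def Rd_def)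
  finally have scal: "scal (g t c) x = scal (g t d) y" .
  have "trace (inv_c ** h t c x ** inv_c ** h t c x) = trace (inv_d ** h t d y ** inv_d ** h t d y)"
    using trace_mul_sym[of "inv_c ** J ** h t d y ** transpose J ** inv_c ** J ** h t d y" "transpose J"]
    by (simp add: hT[OF t] inv matrix_mul_assoc)
  then have "tensor_norm (g t c) (h t c) x = tensor_norm (g t d) (h t d) y"
    using x(2) y t by (simp add: C.tensor_norm_eq D.tensor_norm_eq C.f_def D.f_def C.gi_eq D.gi_eq
        C.H_app D.H_app inv_c_def inv_d_def)
  then show ?thesis using scal by (simp add: ratio_def x_def y_def)
qed

definition u :: "'m \<times> real \<Rightarrow> real" where
  "u = (\<lambda>(p, t). ratio (SOME c. c \<in> \<A> \<and> p \<in> chart_dom c) p t)"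

lemma u_eq:
  assumes "c \<in> \<A>" "p \<in> chart_dom c" "t \<in> {0..<T}"
  shows "u (p, t) = ratio c p t"
proof -
  define d where "d = (SOME c. c \<in> \<A> \<and> p \<in> chart_dom c)"
  have "d \<in> \<A> \<and> p \<in> chart_dom d"
    unfolding d_def using assms by (intro someI[of "\<lambda>c. c \<in> \<A> \<and> p \<in> chart_dom c" c]) simp
  then have "ratio d p t = ratio c p t"
    using ratio_chart_independent[of d p c t] assms by blast
  then show ?thesis by (simp add: u_def d_def)
qed

section \<open>The comparison argument on the closed manifold\<close>

lemma continuous_on_u: "continuous_on (M \<times> {0..<T}) u"
  unfolding continuous_on_eq_continuous_within
proof
  fix z assume "z \<in> M \<times> {0..<T}"
  then obtain p t c where z: "z = (p, t)" "t \<in> {0..<T}" and c: "c \<in> \<A>" "p \<in> chart_dom c"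
    using cover by auto
  interpret C: local_flow "chart_ran c" T "\<lambda>t. g t c" "\<lambda>t. h t c" by (rule local_flow[OF c(1)])
  obtain N where N: "open N" "chart_dom c = M \<inter> N"
    using chart(1)[OF c(1)] unfolding openin_open by blast
  note C.continuous_on_ratio
  moreover have "continuous_on (chart_dom c \<times> {0..<T}) (\<lambda>z. (coord c (fst z), snd z))"
    by (rule continuous_on_Pair[OF continuous_on_compose2[OF homeomorphism_cont1[OF chart(3)[OF c(1)]]
          continuous_on_fst[OF continuous_on_id]] continuous_on_snd[OF continuous_on_id]]) auto
  moreover have "(\<lambda>z. (coord c (fst z), snd z)) ` (chart_dom c \<times> {0..<T}) \<subseteq> C.V"
    by auto
  ultimately have "continuous_on (chart_dom c \<times> {0..<T})
      (\<lambda>z. C.f (coord c (fst z), snd z) /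
        (scal (g (snd (coord c (fst z), snd z)) c) (fst (coord c (fst z), snd z)))\<^sup>2)"
    by (rule continuous_on_compose2)
  then have "continuous_on (chart_dom c \<times> {0..<T}) u"
    by (rule continuous_on_eq)
      (auto simp: u_eq[OF c(1)] ratio_def C.tensor_norm_eq C.f_nonneg)
  then have "continuous (at z within chart_dom c \<times> {0..<T}) u"
    using z c(2) by (auto simp: continuous_on_eq_continuous_within)
  \<comment> \<open>Chart domains are relatively open in M, so continuity within a chart domain is
    continuity within M.\<close>
  moreover have "at z within chart_dom c \<times> {0..<T} = at z within M \<times> {0..<T}"
    using c(2) N z by (intro at_within_nhd[of z "N \<times> UNIV"] open_Times) auto
  ultimately show "continuous (at z within M \<times> {0..<T}) u" by simp
qed

text \<open>A violation at time t1 is tested on the compact set M x [0, t1], where the penalized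
  function attains its maximum. That maximum exceeds C0, hence lies at a positive time, and any
  chart around it contradicts \<open>no_interior_max\<close>.\<close>

lemma u_le_initial_bound:
  assumes init: "\<And>p. p \<in> M \<Longrightarrow> u (p, 0) \<le> C0" and p1: "p1 \<in> M" and t1: "t1 \<in> {0..<T}"
  shows "u (p1, t1) \<le> C0"
proof (rule ccontr)
  assume "\<not> ?thesis"
  then have gt: "u (p1, t1) > C0" by simp
  then have t1_pos: "t1 > 0" using init[OF p1] t1 by (cases "t1 = 0") auto
  \<comment> \<open>Half of the excess over C0 is spent on the penalty up to time t1, so u -
    \<epsilon> t still exceeds C0 at (p1, t1).\<close>
  define \<epsilon> where "\<epsilon> = (u (p1, t1) - C0) / (2 * t1)"
  have \<epsilon>: "\<epsilon> > 0" using gt t1_pos by (simp add: \<epsilon>_def)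
  have cont: "continuous_on (M \<times> {0..t1}) (\<lambda>z. u z - \<epsilon> * snd z)"
    using t1 by (intro continuous_intros continuous_on_subset[OF continuous_on_u]) auto
  have comp: "compact (M \<times> {0..t1})"
    by (intro compact_Times compact_M compact_Icc)
  have ne: "M \<times> {0..t1} \<noteq> {}" using p1 t1 by auto
  obtain z where z: "z \<in> M \<times> {0..t1}"
    "\<And>w. w \<in> M \<times> {0..t1} \<Longrightarrow> u w - \<epsilon> * snd w \<le> u z - \<epsilon> * snd z"
    using continuous_attains_sup[OF comp ne cont] by blast
  obtain p t where pt: "z = (p, t)" "p \<in> M" "0 \<le> t" "t \<le> t1" using z(1) by auto
  have max: "u (q, s) - \<epsilon> * s \<le> u (p, t) - \<epsilon> * t" if "q \<in> M" "0 \<le> s" "s \<le> t1" for q s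
    using z(2)[of "(q, s)"] that by (simp add: pt(1))
  have "\<epsilon> * t1 = (u (p1, t1) - C0) / 2" using t1_pos by (simp add: \<epsilon>_def)
  then have "u (p, t) - \<epsilon> * t > C0" using max[OF p1, of t1] t1 gt by auto
  then have t_pos: "t > 0" using init[OF pt(2)] pt(3) by (cases "t = 0") auto
  have t_lt: "t < T" using pt(4) t1 by simp
  obtain c where c: "c \<in> \<A>" "p \<in> chart_dom c" using pt(2) cover by auto
  interpret C: local_flow "chart_ran c" T "\<lambda>t. g t c" "\<lambda>t. h t c" by (rule local_flow[OF c(1)])
  define x where "x = coord c p"
  have x: "x \<in> chart_ran c" using c(2) by (simp add: x_def)
  have f: "C.f (coord c q, s) = u (q, s) * (scal (g s c) (coord c q))\<^sup>2"
    if "q \<in> chart_dom c" "0 \<le> s" "s < T" for q s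
    using that C.scal_pos[of "coord c q" s]
    by (simp add: u_eq[OF c(1)] ratio_def C.tensor_norm_eq C.f_nonneg)
  show False
  proof (rule C.no_interior_max[OF x t_pos t_lt \<epsilon>])
    show "C.f (x, t) = u (p, t) * (scal (g t c) x)\<^sup>2"
      using f[OF c(2), of t] t_pos t_lt by (simp add: x_def)
    show "C.f (y, t) \<le> u (p, t) * (scal (g t c) y)\<^sup>2" if "y \<in> chart_ran c" for y
    proof -
      obtain q where q: "q \<in> chart_dom c" "y = coord c q" using \<open>y \<in> chart_ran c\<close> by auto
      then have "q \<in> M" using cover c(1) by auto
      then have "u (q, t) \<le> u (p, t)" using max[of q t] pt by simp
      then show ?thesis using f[OF q(1), of t] t_pos t_lt by (simp add: q(2) mult_right_mono)
    qed
    show "C.f (x, s) \<le> (u (p, t) - \<epsilon> * (t - s)) * (scal (g s c) x)\<^sup>2" if "0 < s" "s \<le> t" for s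
    proof -
      have "u (p, s) \<le> u (p, t) - \<epsilon> * (t - s)"
        using max[OF pt(2), of s] that pt(4) by (simp add: algebra_simps)
      then show ?thesis using f[OF c(2), of s] that t_lt by (simp add: x_def mult_right_mono)
    qed
  qed
qed

lemma u_initial_bounded: obtains C0 where "\<And>p. p \<in> M \<Longrightarrow> u (p, 0) \<le> C0"
proof -
  have "continuous_on M (\<lambda>p. u (p, 0))"
    using T by (intro continuous_on_compose2[OF continuous_on_u] continuous_intros) auto
  then have "bounded ((\<lambda>p. u (p, 0)) ` M)"
    using compact_M compact_continuous_image compact_imp_bounded by blast
  then show ?thesis
    using that by (auto simp: bounded_iff) (metis abs_le_D1)
qed

lemma ratio_bound_imp:
  assumes "u (p, t) \<le> C0" "c \<in> \<A>" "p \<in> chart_dom c" "t \<in> {0..<T}"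
  shows "tensor_norm (g t c) (h t c) (coord c p) / scal (g t c) (coord c p) \<le> sqrt C0"
  using assms u_eq[OF assms(2-4)] by (intro real_le_rsqrt) (simp add: ratio_def power_divide)

end

text \<open>At time 0 the ratio involves only the initial fields and spatial derivatives of the
  initial metric. This is what transfers a bound found for one flow to every other flow with the
  same initial data.\<close>

lemma initial_ratio_eq:
  assumes "manifold_flow M \<A> T g h" "manifold_flow M \<A> T' g' h'"
    and "same_field \<A> (g 0) (g' 0)" "same_field \<A> (h 0) (h' 0)" and p: "p \<in> M"
  shows "manifold_flow.u \<A> g h (p, 0) = manifold_flow.u \<A> g' h' (p, 0)"
proof -
  interpret F: manifold_flow M \<A> T g h by fact
  interpret F': manifold_flow M \<A> T' g' h' by fact
  obtain c where c: "c \<in> \<A>" "p \<in> chart_dom c" using p F.cover by auto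
  have eq: "g 0 c y = g' 0 c y" "h 0 c y = h' 0 c y" if "y \<in> chart_ran c" for y
    using assms(3,4) c(1) that by (auto simp: same_field_def)
  have x: "coord c p \<in> chart_ran c" using c(2) by simp
  have "scal (g 0 c) (coord c p) = scal (g' 0 c) (coord c p)"
    by (rule scal_cong[OF F.chart(2)[OF c(1)] x eq(1)])
  moreover have "tensor_norm (g 0 c) (h 0 c) (coord c p) = tensor_norm (g' 0 c) (h' 0 c) (coord c p)"
    by (simp add: tensor_norm_def ginv_def eq[OF x])
  ultimately show ?thesis
    using F.T F'.T by (simp add: F.u_eq[OF c] F'.u_eq[OF c] F.ratio_def F'.ratio_def)
qed

theorem theorem1p1:
  fixes M :: "'m::t2_space set"
    and \<A> :: "('m, 'n::finite) chart set"
    and g0 h0 :: "('m, 'n) field2"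
  assumes "CARD('n) \<ge> 4"
    and "closed_manifold M \<A>"
  shows "\<exists>c0::real. \<forall>T>0. \<forall>g h.
           linearized_ricci_flow \<A> T g h \<longrightarrow>
           same_field \<A> (g 0) g0 \<longrightarrow> same_field \<A> (h 0) h0 \<longrightarrow>
           (\<forall>t\<in>{0..<T}. positive_scalar_curvature \<A> (g t)) \<longrightarrow>
           (\<forall>t\<in>{0..<T}. weyl_vanishes \<A> (g t)) \<longrightarrow>
           (\<forall>p\<in>M. \<forall>t\<in>{0..<T}. \<forall>c\<in>\<A>. p \<in> chart_dom c \<longrightarrow>
              tensor_norm (g t c) (h t c) (coord c p) / scal (g t c) (coord c p) \<le> c0)"
proof -
  define admissible where "admissible T g h \<longleftrightarrow>
    manifold_flow M \<A> T g h \<and> same_field \<A> (g 0) g0 \<and> same_field \<A> (h 0) h0" for T g h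
  have "\<exists>c0. \<forall>T g h. admissible T g h \<longrightarrow>
      (\<forall>p\<in>M. \<forall>t\<in>{0..<T}. \<forall>c\<in>\<A>. p \<in> chart_dom c \<longrightarrow>
        tensor_norm (g t c) (h t c) (coord c p) / scal (g t c) (coord c p) \<le> c0)"
  \<comment> \<open>The constant must be fixed before T and the flow. If some admissible flow
    exists, its initial maximum serves for all of them; otherwise the claim is vacuous.\<close>
  proof (cases "\<exists>T g h. admissible T g h")
    case True
    then obtain T g h where F: "admissible T g h" by blast
    then obtain C0 where C0: "\<And>p. p \<in> M \<Longrightarrow> manifold_flow.u \<A> g h (p, 0) \<le> C0"
      using manifold_flow.u_initial_bounded unfolding admissible_def by blast
    have "tensor_norm (g' t c) (h' t c) (coord c p) / scal (g' t c) (coord c p) \<le> sqrt C0"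
      if F': "admissible T' g' h'" and p: "p \<in> M" "t \<in> {0..<T'}" "c \<in> \<A>" "p \<in> chart_dom c"
      for T' g' h' p t c
    proof -
      interpret F': manifold_flow M \<A> T' g' h' using F' by (simp add: admissible_def)
      have "same_field \<A> (g 0) (g' 0)" "same_field \<A> (h 0) (h' 0)"
        using F F' by (simp_all add: admissible_def same_field_def)
      then have "F'.u (q, 0) \<le> C0" if "q \<in> M" for q
        using initial_ratio_eq[of M \<A> T g h T' g' h' q] F F' C0[OF that] that by (simp add: admissible_def)
      then have "F'.u (p, t) \<le> C0"
        by (rule F'.u_le_initial_bound[OF _ p(1,2)])
      then show ?thesis by (rule F'.ratio_bound_imp[OF _ p(3,4,2)])
    qed
    then show ?thesis by blast
  qed blast
  then obtain c0 where c0: "\<And>T g h p t c. admissible T g h \<Longrightarrow> p \<in> M \<Longrightarrow> t \<in> {0..<T} \<Longrightarrow> c \<in> \<A> \<Longrightarrow>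
      p \<in> chart_dom c \<Longrightarrow> tensor_norm (g t c) (h t c) (coord c p) / scal (g t c) (coord c p) \<le> c0"
    by blast
  show ?thesis
  proof (intro exI[of _ c0] allI impI ballI)
    fix T g h p t c
    assume *: "T > 0" "linearized_ricci_flow \<A> T g h" "same_field \<A> (g 0) g0" "same_field \<A> (h 0) h0"
      "\<forall>t\<in>{0..<T}. positive_scalar_curvature \<A> (g t)" "\<forall>t\<in>{0..<T}. weyl_vanishes \<A> (g t)"
      and p: "p \<in> M" "t \<in> {0..<T}" "c \<in> \<A>" "p \<in> chart_dom c"
    have "admissible T g h"
      using assms * by (simp add: admissible_def manifold_flow_def)
    then show "tensor_norm (g t c) (h t c) (coord c p) / scal (g t c) (coord c p) \<le> c0"
      using c0 p by blast
  qed
qed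

end
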